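(* Let $f\in\mu_{q-1}[x_1^{\pm1},\dots,x_n^{\pm1}]$ be a non-constant Laurent polynomial, and let $\chi=\omega^{-d}$ with $d\in\mathbb{Z}^n/(q-1)$. Then the series $C_{f,\chi}(s,T)$ is $T$-adic entire in $s$.
   Context: $p$ is a prime, $q$ a power of $p$, $\mathbb{Z}_{q^k}=W(\mathbb{F}_{q^k})$, $\mu_{q^k-1}\subset\mathbb{Z}_{q^k}$ the group of $(q^k-1)$-th roots of unity. The notation $f\in\mu_{q-1}[x_1^{\pm1},\dots,x_n^{\pm1}]$ means $f=\sum_{u\in I}a_ux^u$ with $I\subset\mathbb{Z}^n$ finite and $a_u\in\mu_{q-1}$. $\omega$ is the Teichmüller character, $\omega:\mathbb{F}_q^\times\to\mu_{q-1}$, $x\mapsto\hat x$; for $d\in\mathbb{Z}^n/(q-1)\mathbb{Z}^n$, $\chi=\omega^{-d}$ is the character $x\mapsto\hat x^{-d}=\prod_i\hat x_i^{-d_i}$ of $(\mathbb{F}_q^\times)^n$, and $\chi_k=\chi\circ\mathrm{Norm}_{\mathbb{F}_{q^k}/\mathbb{F}_q}$, viewed also as a function on $\mu_{q^k-1}^n\cong(\mathbb{F}_{q^k}^\times)^n$; thus $\chi_k(x)=x^{-d(1+q+\cdots+q^{k-1})}$. Let $\psi(x)=(1+T)^x$ for $x\in\mathbb{Z}_p$ and $\psi_{q^k}=\psi\circ\mathrm{Tr}_{\mathbb{Z}_{q^k}/\mathbb{Z}_p}$. Put $$S_f(T,\chi_k)=S_f(T,\chi_k,\mathbb{F}_{q^k})=\sum_{x\in\mu_{q^k-1}^n}\chi_k(x)\,\psi_{q^k}(f(x)),$$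 $$C_{f,\chi}(s,T)=\exp\Big(\sum_{k=1}^{\infty}\frac{-1}{(q^k-1)^n}S_f(T,\chi_k)\frac{s^k}{k}\Big)\in 1+s\mathbb{Z}_q[[T]][[s]].$$ A series $\sum_i a_i(T)s^i$ with $a_i\in\mathbb{Z}_q[[T]]$ is $T$-adic entire in $s$ if $\mathrm{ord}_T(a_i)/i\to\infty$. *)

theory Defs
  imports
    "HOL-Library.Poly_Mapping"
    "HOL-Library.Extended_Real"
    "HOL-Library.FuncSet"
    "HOL-Computational_Algebra.Formal_Power_Series"
    "HOL-Computational_Algebra.Fraction_Field"
    "HOL-Analysis.Analysis"
begin

section \<open>Integer polynomials in arbitrarily many variables\<close>

type_synonym 'v int_mpoly = "('v \<Rightarrow>\<^sub>0 nat) \<Rightarrow>\<^sub>0 int"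

definition mvar :: "'v \<Rightarrow> 'v int_mpoly" where
  "mvar v = Poly_Mapping.single (Poly_Mapping.single v 1) 1"

definition mono_eval :: "('v \<Rightarrow> 'a::comm_ring_1) \<Rightarrow> ('v \<Rightarrow>\<^sub>0 nat) \<Rightarrow> 'a" where
  "mono_eval x m = (\<Prod>v\<in>Poly_Mapping.keys m. x v ^ Poly_Mapping.lookup m v)"

definition mpoly_eval :: "('v \<Rightarrow> 'a::comm_ring_1) \<Rightarrow> 'v int_mpoly \<Rightarrow> 'a" where
  "mpoly_eval x f = (\<Sum>m\<in>Poly_Mapping.keys f. of_int (Poly_Mapping.lookup f m) * mono_eval x m)"

lemma mono_eval_superset:
  assumes "finite A" "Poly_Mapping.keys m \<subseteq> A"
  shows "mono_eval x m = (\<Prod>v\<in>A. x v ^ Poly_Mapping.lookup m v)"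
  unfolding mono_eval_def
  by (rule prod.mono_neutral_left) (use assms in \<open>auto simp: in_keys_iff\<close>)

lemma mono_eval_add: "mono_eval x (m + n) = mono_eval x m * mono_eval x n"
proof -
  let ?A = "Poly_Mapping.keys m \<union> Poly_Mapping.keys n"
  have "mono_eval x (m + n) = (\<Prod>v\<in>?A. x v ^ Poly_Mapping.lookup (m + n) v)"
    by (rule mono_eval_superset) (simp, rule keys_add)
  also have "\<dots> = (\<Prod>v\<in>?A. x v ^ Poly_Mapping.lookup m v) * (\<Prod>v\<in>?A. x v ^ Poly_Mapping.lookup n v)"
    by (simp add: lookup_add power_add prod.distrib)
  also have "\<dots> = mono_eval x m * mono_eval x n"
    by (simp add: mono_eval_superset[of ?A])
  finally show ?thesis .
qed

lemma mono_eval_zero [simp]: "mono_eval x 0 = 1"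
  by (simp add: mono_eval_def)

lemma mpoly_eval_superset:
  assumes "finite A" "Poly_Mapping.keys f \<subseteq> A"
  shows "mpoly_eval x f = (\<Sum>m\<in>A. of_int (Poly_Mapping.lookup f m) * mono_eval x m)"
  unfolding mpoly_eval_def
  by (rule sum.mono_neutral_left) (use assms in \<open>auto simp: in_keys_iff\<close>)

lemma mpoly_eval_single [simp]:
  "mpoly_eval x (Poly_Mapping.single m c) = of_int c * mono_eval x m"
  by (subst mpoly_eval_superset[of "{m}"]) auto

lemma mpoly_eval_zero [simp]: "mpoly_eval x 0 = 0"
  by (simp add: mpoly_eval_def)

lemma mpoly_eval_one [simp]: "mpoly_eval x 1 = 1"
  by (metis mpoly_eval_single mono_eval_zero mult.right_neutral of_int_1 single_one)

lemma mpoly_eval_mvar [simp]: "mpoly_eval x (mvar v) = x v"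
  by (simp add: mvar_def mono_eval_def)

lemma mpoly_eval_add: "mpoly_eval x (f + g) = mpoly_eval x f + mpoly_eval x g"
proof -
  let ?A = "Poly_Mapping.keys f \<union> Poly_Mapping.keys g"
  have "mpoly_eval x (f + g) = (\<Sum>m\<in>?A. of_int (Poly_Mapping.lookup (f + g) m) * mono_eval x m)"
    by (rule mpoly_eval_superset) (simp, rule keys_add)
  also have "\<dots> = (\<Sum>m\<in>?A. of_int (Poly_Mapping.lookup f m) * mono_eval x m)
      + (\<Sum>m\<in>?A. of_int (Poly_Mapping.lookup g m) * mono_eval x m)"
    by (simp add: lookup_add ring_distribs sum.distrib)
  also have "\<dots> = mpoly_eval x f + mpoly_eval x g"
    by (simp add: mpoly_eval_superset[of ?A])
  finally show ?thesis .
qed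

lemma mpoly_eval_sum: "mpoly_eval x (\<Sum>i\<in>I. f i) = (\<Sum>i\<in>I. mpoly_eval x (f i))"
  by (induction I rule: infinite_finite_induct) (auto simp: mpoly_eval_add)

lemma poly_mapping_sum_single: "f = (\<Sum>m\<in>Poly_Mapping.keys f. Poly_Mapping.single m (Poly_Mapping.lookup f m))"
  by (rule poly_mapping_eqI)
     (auto simp: lookup_sum lookup_single when_def sum.delta in_keys_iff)

lemma mpoly_eval_mult: "mpoly_eval x (f * g) = mpoly_eval x f * mpoly_eval x g"
proof -
  have "f * g = (\<Sum>m\<in>Poly_Mapping.keys f. Poly_Mapping.single m (Poly_Mapping.lookup f m))
      * (\<Sum>n\<in>Poly_Mapping.keys g. Poly_Mapping.single n (Poly_Mapping.lookup g n))"
    by (simp flip: poly_mapping_sum_single)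
  also have "\<dots> = (\<Sum>m\<in>Poly_Mapping.keys f. \<Sum>n\<in>Poly_Mapping.keys g.
      Poly_Mapping.single (m + n) (Poly_Mapping.lookup f m * Poly_Mapping.lookup g n))"
    by (simp add: sum_product mult_single)
  finally have "mpoly_eval x (f * g) = (\<Sum>m\<in>Poly_Mapping.keys f. \<Sum>n\<in>Poly_Mapping.keys g.
      (of_int (Poly_Mapping.lookup f m) * mono_eval x m) * (of_int (Poly_Mapping.lookup g n) * mono_eval x n))"
    by (simp add: mpoly_eval_sum mono_eval_add mult_ac)
  then show ?thesis
    by (simp add: mpoly_eval_def sum_product)
qed

lemma mpoly_eval_uminus: "mpoly_eval x (- f) = - mpoly_eval x f"
  by (metis add.right_inverse mpoly_eval_add mpoly_eval_zero minus_unique)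

lemma mpoly_eval_diff: "mpoly_eval x (f - g) = mpoly_eval x f - mpoly_eval x g"
  by (metis add_uminus_conv_diff mpoly_eval_add mpoly_eval_uminus)

lemma mpoly_eval_power: "mpoly_eval x (f ^ k) = mpoly_eval x f ^ k"
  by (induction k) (auto simp: mpoly_eval_mult)

lemma mpoly_eval_prod: "mpoly_eval x (\<Prod>i\<in>I. f i) = (\<Prod>i\<in>I. mpoly_eval x (f i))"
  by (induction I rule: infinite_finite_induct) (auto simp: mpoly_eval_mult)

lemma mpoly_eval_of_nat [simp]: "mpoly_eval x (of_nat k) = of_nat k"
  by (induction k) (auto simp: mpoly_eval_add)

lemma mpoly_eval_of_int [simp]: "mpoly_eval x (of_int k) = of_int k"
  by (cases k) (auto simp: mpoly_eval_diff mpoly_eval_uminus simp del: of_nat_Suc)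

lemma mpoly_eval_compose:
  "mpoly_eval y (mpoly_eval x f) = mpoly_eval (\<lambda>v. mpoly_eval y (x v)) f"
proof -
  have "mpoly_eval y (mono_eval x m) = mono_eval (\<lambda>v. mpoly_eval y (x v)) m" for m
    by (simp add: mono_eval_def mpoly_eval_prod mpoly_eval_power)
  then show ?thesis
    by (subst (2 3) mpoly_eval_def) (simp add: mpoly_eval_sum mpoly_eval_mult)
qed

lemma mono_eval_mvar: "mono_eval mvar m = Poly_Mapping.single m 1"
proof -
  have pw: "Poly_Mapping.single u (1::int) ^ k = Poly_Mapping.single (\<Sum>i<k. u) 1"
    for u :: "'a \<Rightarrow>\<^sub>0 nat" and k
    by (induction k) (auto simp: mult_single single_one add.commute)
  have pr: "finite A \<Longrightarrow> (\<Prod>v\<in>A. Poly_Mapping.single (g v) (1::int))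
      = Poly_Mapping.single (\<Sum>v\<in>A. g v) 1" for A :: "'a set" and g :: "'a \<Rightarrow> 'a \<Rightarrow>\<^sub>0 nat"
    by (induction A rule: finite_induct) (auto simp: mult_single single_one)
  have s: "(\<Sum>i<k. Poly_Mapping.single v (Suc 0)) = Poly_Mapping.single v k" for v :: 'a and k
    by (induction k) (auto simp flip: single_add)
  show ?thesis
    unfolding mono_eval_def mvar_def
    by (simp add: pw pr s flip: poly_mapping_sum_single)
qed

lemma mpoly_eval_id: "mpoly_eval mvar f = f"
proof -
  have "of_int c * Poly_Mapping.single m (1::int) = Poly_Mapping.single m c"
    for c :: int and m :: "'a \<Rightarrow>\<^sub>0 nat"
    by (metis add.left_neutral mult.right_neutral mult_single single_of_int of_int_eq_id id_apply)
  then show ?thesis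
    by (simp add: mpoly_eval_def mono_eval_mvar flip: poly_mapping_sum_single)
qed

lemma mpoly_torsion_free:
  fixes f g :: "'v int_mpoly"
  assumes "of_nat p ^ k * f = of_nat p ^ k * g" "p > 0"
  shows "f = g"
proof (rule poly_mapping_eqI)
  fix m
  have "of_nat p ^ k * h = Poly_Mapping.map ((*) (int p ^ k)) h" for h :: "'v int_mpoly"
  proof -
    have "(of_nat p ^ k :: 'v int_mpoly) = Poly_Mapping.single 0 (int p ^ k)"
      by (metis of_nat_power single_of_nat)
    then show ?thesis by (simp add: mult_map_scale_conv_mult)
  qed
  moreover have "Poly_Mapping.lookup (Poly_Mapping.map ((*) (int p ^ k)) h) m = int p ^ k * Poly_Mapping.lookup h m"
    for h :: "'v int_mpoly"
    by (simp add: map.rep_eq when_def)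
  ultimately show "Poly_Mapping.lookup f m = Poly_Mapping.lookup g m"
    using assms by (metis mult_left_cancel of_nat_0_less_iff power_not_zero less_irrefl)
qed


section \<open>Ghost components and Dwork's lemma\<close>

definition ghost :: "nat \<Rightarrow> (nat \<Rightarrow> 'a::comm_ring_1) \<Rightarrow> nat \<Rightarrow> 'a" where
  "ghost p x n = (\<Sum>i\<le>n. of_nat p ^ i * x i ^ (p ^ (n - i)))"

lemma mpoly_eval_ghost:
  "mpoly_eval e (ghost p x n) = ghost p (\<lambda>i. mpoly_eval e (x i)) n"
  by (simp add: ghost_def mpoly_eval_sum mpoly_eval_mult mpoly_eval_power)

lemma ghost_split:
  "ghost p x n = (\<Sum>i<n. of_nat p ^ i * x i ^ (p ^ (n - i))) + of_nat p ^ n * x n"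
  by (simp add: ghost_def flip: lessThan_Suc_atMost)

lemma ghost_Suc: "ghost p x (Suc n) = ghost p (\<lambda>i. x i ^ p) n + of_nat p ^ Suc n * x (Suc n)"
proof -
  have "x i ^ (p ^ (Suc n - i)) = (x i ^ p) ^ (p ^ (n - i))" if "i \<le> n" for i
    using that by (simp add: Suc_diff_le flip: power_mult)
  then show ?thesis
    by (simp add: ghost_split[of p x] ghost_def lessThan_Suc_atMost)
qed

lemma ghost_inj:
  fixes x y :: "nat \<Rightarrow> 'v int_mpoly"
  assumes "\<And>n. ghost p x n = ghost p y n" "p > 0"
  shows "x = y"
proof
  fix n show "x n = y n"
  proof (induction n rule: less_induct)
    case (less n)
    then have "of_nat p ^ n * x n = of_nat p ^ n * y n"
      using assms(1)[of n] by (simp add: ghost_split)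
    then show ?case using mpoly_torsion_free assms(2) by blast
  qed
qed

lemma prime_dvd_binomial_sum:
  fixes x y :: "'a::comm_ring_1"
  assumes "prime p"
  shows "of_nat p dvd (x + y) ^ p - (x ^ p + y ^ p)"
proof -
  obtain r where r: "p = Suc r" "r > 0"
    using assms by (metis Suc_lessD gr0_implies_Suc prime_gt_1_nat not_gr0 less_irrefl One_nat_def)
  let ?t = "\<lambda>k. of_nat (p choose k) * x ^ k * y ^ (p - k)"
  have split: "{..p} = insert 0 (insert p {1..<p})"
    using r by auto
  have "(x + y) ^ p = (\<Sum>k\<le>p. ?t k)" by (rule binomial_ring)
  also have "\<dots> = y ^ p + (x ^ p + (\<Sum>k\<in>{1..<p}. ?t k))"
    unfolding split using r by (subst sum.insert; simp)
  finally have "(x + y) ^ p - (x ^ p + y ^ p) = (\<Sum>k\<in>{1..<p}. ?t k)"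
    by simp
  moreover have "of_nat p dvd ?t k" if "k \<in> {1..<p}" for k
  proof -
    have "p dvd p choose k" using that assms by (intro dvd_choose_prime) auto
    then obtain c where "p choose k = p * c" by blast
    then show ?thesis by (simp add: mult.assoc)
  qed
  ultimately show ?thesis by (auto intro!: dvd_sum)
qed

lemma dvd_power_prime_lift:
  fixes x y :: "'a::comm_ring_1"
  assumes "of_nat p ^ Suc j dvd x - y" 
  shows "of_nat p ^ Suc (Suc j) dvd x ^ p - y ^ p"
proof -
  have 1: "of_nat p dvd x ^ i - y ^ i" for i
  proof (induction i)
    case (Suc i)
    have "x ^ Suc i - y ^ Suc i = x * (x ^ i - y ^ i) + (x - y) * y ^ i"
      by (simp add: algebra_simps)
    moreover have "of_nat p dvd x - y" using assms by (metis dvd_mult_left power_Suc)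
    ultimately show ?case using Suc by (metis dvd_add dvd_mult dvd_mult2)
  qed auto
  have "(\<Sum>i<p. y ^ (p - Suc i) * x ^ i)
      = (\<Sum>i<p. y ^ (p - Suc i) * (x ^ i - y ^ i)) + (\<Sum>i<p. y ^ (p - Suc i) * y ^ i)"
    by (simp add: ring_distribs flip: sum.distrib)
  moreover have "(\<Sum>i<p. y ^ (p - Suc i) * y ^ i) = (\<Sum>i<p. y ^ (p - 1))"
    by (rule sum.cong) (auto simp flip: power_add)
  ultimately have 2: "of_nat p dvd (\<Sum>i<p. y ^ (p - Suc i) * x ^ i)"
    using 1 by (auto intro!: dvd_add dvd_sum)
  have "x ^ p - y ^ p = (x - y) * (\<Sum>i<p. y ^ (p - Suc i) * x ^ i)"
    by (rule power_diff_sumr2)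
  then show ?thesis
    using mult_dvd_mono[OF assms 2] by (simp add: mult_ac)
qed

lemma dvd_power_prime_power:
  fixes x y :: "'a::comm_ring_1"
  assumes "of_nat p dvd x - y"
  shows "of_nat p ^ Suc j dvd x ^ (p ^ j) - y ^ (p ^ j)"
proof (induction j)
  case (Suc j)
  from dvd_power_prime_lift[OF this] show ?case
    by (simp add: mult.commute flip: power_mult)
qed (use assms in simp)

definition mpoly_frob :: "nat \<Rightarrow> 'v int_mpoly \<Rightarrow> 'v int_mpoly" where
  "mpoly_frob p = mpoly_eval (\<lambda>v. mvar v ^ p)"

lemma mpoly_frob_cong:
  fixes f :: "'v int_mpoly"
  assumes "prime p"
  shows "of_nat p dvd mpoly_frob p f - f ^ p"
proof -
  let ?P = "\<lambda>f :: 'v int_mpoly. of_nat p dvd mpoly_frob p f - f ^ p"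
  note hom = mpoly_frob_def mpoly_eval_add mpoly_eval_mult mpoly_eval_diff
  have p0: "p > 0" using assms prime_gt_0_nat by blast
  have frob1: "mpoly_frob p 1 = (1 :: 'v int_mpoly)" by (simp add: hom)
  have P0: "?P 0" and P1: "?P 1" using p0 by (auto simp: hom zero_power)
  have add: "?P (f + g)" if "?P f" "?P g" for f g
  proof -
    have "mpoly_frob p (f + g) - (f + g) ^ p
        = (mpoly_frob p f - f ^ p) + (mpoly_frob p g - g ^ p) - ((f + g) ^ p - (f ^ p + g ^ p))"
      by (simp add: hom)
    then show ?thesis
      using that prime_dvd_binomial_sum[OF assms] by (metis dvd_add dvd_diff)
  qed
  have diff: "?P (f - g)" if "?P f" "?P g" for f g
  proof -
    have "mpoly_frob p (f - g) - (f - g) ^ p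
        = (mpoly_frob p f - f ^ p) - (mpoly_frob p g - g ^ p)
          + (((f - g) + g) ^ p - ((f - g) ^ p + g ^ p))"
      by (simp add: hom)
    then show ?thesis
      using that prime_dvd_binomial_sum[OF assms] by (metis dvd_add dvd_diff)
  qed
  have mult: "?P (f * g)" if "?P f" "?P g" for f g
  proof -
    have "mpoly_frob p (f * g) - (f * g) ^ p
        = (mpoly_frob p f - f ^ p) * mpoly_frob p g + f ^ p * (mpoly_frob p g - g ^ p)"
      by (simp add: hom power_mult_distrib algebra_simps)
    then show ?thesis using that by (metis dvd_add dvd_mult dvd_mult2)
  qed
  have sum: "?P (\<Sum>i\<in>I. h i)" if "\<And>i. i \<in> I \<Longrightarrow> ?P (h i)" for h and I :: "('v \<Rightarrow>\<^sub>0 nat) set"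
    using that by (induction I rule: infinite_finite_induct) (auto intro: P0 add)
  have power: "?P (f ^ k)" if "?P f" for f k
    using that by (induction k) (simp_all add: frob1 mult)
  have prod: "?P (\<Prod>i\<in>I. h i)" if "\<And>i. i \<in> I \<Longrightarrow> ?P (h i)" for h and I :: "'v set"
    using that by (induction I rule: infinite_finite_induct) (auto intro: mult simp: frob1)
  have nat: "?P (of_nat k)" for k
    by (induction k) (auto intro!: P0 P1 add)
  have int: "?P (of_int k)" for k
    using nat diff[OF P0 nat] by (cases k rule: int_cases2) auto
  have var: "?P (mvar v)" for v
    by (simp add: hom)
  have "?P (mpoly_eval mvar f)"
    unfolding mpoly_eval_def mono_eval_def
    by (intro sum mult prod power int var)
  then show ?thesis by (simp add: mpoly_eval_id)
qed

definition dwork_seq :: "nat \<Rightarrow> (nat \<Rightarrow> 'v int_mpoly) \<Rightarrow> bool" where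
  "dwork_seq p w \<longleftrightarrow> (\<forall>n. of_nat p ^ Suc n dvd w (Suc n) - mpoly_frob p (w n))"

lemma dwork_lemma:
  fixes w :: "nat \<Rightarrow> 'v int_mpoly"
  assumes p: "prime p" and w: "dwork_seq p w"
  shows "\<exists>!x. \<forall>n. ghost p x n = w n"
proof -
  have p0: "p > 0" using p prime_gt_0_nat by blast
  let ?s = "\<lambda>f n. \<Sum>i<n. of_nat p ^ i * f i ^ (p ^ (n - i))"
  have "\<exists>x. \<forall>n. w n = ?s x n + of_nat p ^ n * x n"
  proof (rule dependent_wf_choice[OF wf_less_than])
    fix f g :: "nat \<Rightarrow> 'v int_mpoly" and n r
    assume "\<And>z. (z, n) \<in> less_than \<Longrightarrow> f z = g z"
    then have "?s f n = ?s g n" by (intro sum.cong) auto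
    then show "(w n = ?s f n + of_nat p ^ n * r) = (w n = ?s g n + of_nat p ^ n * r)" by simp
  next
    fix n and f :: "nat \<Rightarrow> 'v int_mpoly"
    assume IH: "\<And>y. (y, n) \<in> less_than \<Longrightarrow> w y = ?s f y + of_nat p ^ y * f y"
    show "\<exists>r. w n = ?s f n + of_nat p ^ n * r"
    proof (cases n)
      case 0
      then show ?thesis by auto
    next
      case (Suc m)
      let ?\<phi> = "mpoly_frob p"
      have "w m = ghost p f m" using IH[of m] Suc by (simp add: ghost_split)
      then have 1: "?\<phi> (w m) = ghost p (\<lambda>i. ?\<phi> (f i)) m"
        by (simp add: mpoly_frob_def mpoly_eval_ghost)
      have 2: "?s f n = ghost p (\<lambda>i. f i ^ p) m"
        using ghost_Suc[of p f m] Suc by (simp add: ghost_split[of p f "Suc m"])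
      have 3: "?\<phi> (w m) - ?s f n = (\<Sum>i\<le>m. of_nat p ^ i *
          (?\<phi> (f i) ^ (p ^ (m - i)) - (f i ^ p) ^ (p ^ (m - i))))"
        unfolding 1 2 by (simp add: ghost_def right_diff_distrib sum_subtractf)
      have 4: "of_nat p ^ n dvd of_nat p ^ i *
          (?\<phi> (f i) ^ (p ^ (m - i)) - (f i ^ p) ^ (p ^ (m - i)))" if "i \<le> m" for i
      proof -
        have "of_nat p ^ i * of_nat p ^ Suc (m - i) dvd of_nat p ^ i *
          (?\<phi> (f i) ^ (p ^ (m - i)) - (f i ^ p) ^ (p ^ (m - i)))"
          by (intro mult_dvd_mono dvd_power_prime_power mpoly_frob_cong p) auto
        moreover have "of_nat p ^ i * of_nat p ^ Suc (m - i) = (of_nat p ^ n :: 'v int_mpoly)"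
          using that unfolding Suc power_add[symmetric] by simp
        ultimately show ?thesis by simp
      qed
      have "of_nat p ^ n dvd ?\<phi> (w m) - ?s f n" unfolding 3 by (rule dvd_sum) (use 4 in auto)
      moreover have "of_nat p ^ n dvd w n - ?\<phi> (w m)"
        using w Suc by (simp add: dwork_seq_def)
      ultimately have "of_nat p ^ n dvd (w n - ?\<phi> (w m)) + (?\<phi> (w m) - ?s f n)"
        by (rule dvd_add[rotated])
      then obtain r where "w n - ?s f n = of_nat p ^ n * r" by (auto simp: dvd_def)
      then have "w n = ?s f n + of_nat p ^ n * r" by (simp add: algebra_simps)
      then show ?thesis ..
    qed
  qed
  then obtain x where "\<forall>n. w n = ?s x n + of_nat p ^ n * x n" ..
  then have x: "\<forall>n. ghost p x n = w n" by (simp add: ghost_split)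
  show ?thesis
  proof (rule ex1I[of _ x])
    fix y assume "\<forall>n. ghost p y n = w n"
    with x show "y = x" by (intro ghost_inj[OF _ p0]) simp
  qed (fact x)
qed

lemma dwork_seq_vars: "dwork_seq p (ghost p (\<lambda>i. mvar (h i)))"
  unfolding dwork_seq_def
  by (simp add: ghost_Suc mpoly_frob_def mpoly_eval_ghost del: power_Suc)

lemma dwork_seq_add:
  assumes "dwork_seq p v" "dwork_seq p w"
  shows "dwork_seq p (\<lambda>n. v n + w n)"
  unfolding dwork_seq_def
proof
  fix n
  have "v (Suc n) + w (Suc n) - mpoly_frob p (v n + w n)
      = (v (Suc n) - mpoly_frob p (v n)) + (w (Suc n) - mpoly_frob p (w n))"
    by (simp add: mpoly_frob_def mpoly_eval_add)
  then show "of_nat p ^ Suc n dvd v (Suc n) + w (Suc n) - mpoly_frob p (v n + w n)"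
    using assms by (metis dvd_add dwork_seq_def)
qed

lemma dwork_seq_mult:
  assumes "dwork_seq p v" "dwork_seq p w"
  shows "dwork_seq p (\<lambda>n. v n * w n)"
  unfolding dwork_seq_def
proof
  fix n
  have "v (Suc n) * w (Suc n) - mpoly_frob p (v n * w n)
      = (v (Suc n) - mpoly_frob p (v n)) * w (Suc n)
        + mpoly_frob p (v n) * (w (Suc n) - mpoly_frob p (w n))"
    by (simp add: mpoly_frob_def mpoly_eval_mult algebra_simps)
  then show "of_nat p ^ Suc n dvd v (Suc n) * w (Suc n) - mpoly_frob p (v n * w n)"
    using assms by (metis dvd_add dvd_mult dvd_mult2 dwork_seq_def)
qed

lemma dwork_seq_uminus:
  assumes "dwork_seq p v"
  shows "dwork_seq p (\<lambda>n. - v n)"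
  unfolding dwork_seq_def
proof
  fix n
  have "- v (Suc n) - mpoly_frob p (- v n) = - (v (Suc n) - mpoly_frob p (v n))"
    by (simp add: mpoly_frob_def mpoly_eval_uminus)
  then show "of_nat p ^ Suc n dvd - v (Suc n) - mpoly_frob p (- v n)"
    using assms by (metis dvd_minus_iff dwork_seq_def)
qed


section \<open>Witt vectors\<close>

text \<open>
  The universal Witt polynomials, determined by their ghost components; existence and uniqueness
  follow from \<open>dwork_lemma\<close>.
\<close>

definition witt_add_poly :: "nat \<Rightarrow> nat \<Rightarrow> (nat + nat) int_mpoly" where
  "witt_add_poly p = (THE S. \<forall>n. ghost p S n
     = ghost p (\<lambda>i. mvar (Inl i)) n + ghost p (\<lambda>i. mvar (Inr i)) n)"

definition witt_mult_poly :: "nat \<Rightarrow> nat \<Rightarrow> (nat + nat) int_mpoly" where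
  "witt_mult_poly p = (THE S. \<forall>n. ghost p S n
     = ghost p (\<lambda>i. mvar (Inl i)) n * ghost p (\<lambda>i. mvar (Inr i)) n)"

definition witt_uminus_poly :: "nat \<Rightarrow> nat \<Rightarrow> nat int_mpoly" where
  "witt_uminus_poly p = (THE S. \<forall>n. ghost p S n = - ghost p mvar n)"

lemma witt_polys:
  assumes "prime p"
  shows "ghost p (witt_add_poly p) n
      = ghost p (\<lambda>i. mvar (Inl i)) n + ghost p (\<lambda>i. mvar (Inr i)) n"
    and "ghost p (witt_mult_poly p) n
      = ghost p (\<lambda>i. mvar (Inl i)) n * ghost p (\<lambda>i. mvar (Inr i)) n"
    and "ghost p (witt_uminus_poly p) n = - ghost p mvar n"
proof -
  note v = dwork_seq_vars[of p Inl] dwork_seq_vars[of p Inr] dwork_seq_vars[of p "\<lambda>i. i"]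
  show "ghost p (witt_add_poly p) n
      = ghost p (\<lambda>i. mvar (Inl i)) n + ghost p (\<lambda>i. mvar (Inr i)) n"
    using theI'[OF dwork_lemma[OF assms dwork_seq_add[OF v(1,2)]]]
    unfolding witt_add_poly_def by (rule spec)
  show "ghost p (witt_mult_poly p) n
      = ghost p (\<lambda>i. mvar (Inl i)) n * ghost p (\<lambda>i. mvar (Inr i)) n"
    using theI'[OF dwork_lemma[OF assms dwork_seq_mult[OF v(1,2)]]]
    unfolding witt_mult_poly_def by (rule spec)
  show "ghost p (witt_uminus_poly p) n = - ghost p mvar n"
    using theI'[OF dwork_lemma[OF assms dwork_seq_uminus[OF v(3)]]]
    unfolding witt_uminus_poly_def by (rule spec)
qed

definition wadd :: "nat \<Rightarrow> (nat \<Rightarrow> 'a::comm_ring_1) \<Rightarrow> (nat \<Rightarrow> 'a) \<Rightarrow> nat \<Rightarrow> 'a" where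
  "wadd p x y n = mpoly_eval (case_sum x y) (witt_add_poly p n)"

definition wmult :: "nat \<Rightarrow> (nat \<Rightarrow> 'a::comm_ring_1) \<Rightarrow> (nat \<Rightarrow> 'a) \<Rightarrow> nat \<Rightarrow> 'a" where
  "wmult p x y n = mpoly_eval (case_sum x y) (witt_mult_poly p n)"

definition wuminus :: "nat \<Rightarrow> (nat \<Rightarrow> 'a::comm_ring_1) \<Rightarrow> nat \<Rightarrow> 'a" where
  "wuminus p x n = mpoly_eval x (witt_uminus_poly p n)"

definition wzero :: "nat \<Rightarrow> 'a::comm_ring_1" where
  "wzero n = 0"

definition wone :: "nat \<Rightarrow> 'a::comm_ring_1" where
  "wone n = (if n = 0 then 1 else 0)"

lemma ghost_wadd: "prime p \<Longrightarrow> ghost p (wadd p x y) n = ghost p x n + ghost p y n"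
  using arg_cong[OF witt_polys(1), of p "mpoly_eval (case_sum x y)"]
  by (simp add: mpoly_eval_ghost mpoly_eval_add wadd_def[abs_def])

lemma ghost_wmult: "prime p \<Longrightarrow> ghost p (wmult p x y) n = ghost p x n * ghost p y n"
  using arg_cong[OF witt_polys(2), of p "mpoly_eval (case_sum x y)"]
  by (simp add: mpoly_eval_ghost mpoly_eval_mult wmult_def[abs_def])

lemma ghost_wuminus: "prime p \<Longrightarrow> ghost p (wuminus p x) n = - ghost p x n"
  using arg_cong[OF witt_polys(3), of p "mpoly_eval x"]
  by (simp add: mpoly_eval_ghost mpoly_eval_uminus wuminus_def[abs_def])

lemma ghost_wzero: "p > 0 \<Longrightarrow> ghost p wzero n = 0"
  by (simp add: ghost_def wzero_def zero_power)

lemma ghost_wone: "p > 0 \<Longrightarrow> ghost p wone n = 1"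
proof -
  assume "p > 0"
  then have "ghost p wone n = (\<Sum>i\<le>n. if i = 0 then 1 else 0 :: 'a)"
    unfolding ghost_def by (intro sum.cong) (auto simp: wone_def zero_power)
  then show ?thesis by simp
qed

lemma case_sum_eval:
  "mpoly_eval e (case_sum x y v) = case_sum (\<lambda>i. mpoly_eval e (x i)) (\<lambda>i. mpoly_eval e (y i)) v"
  by (cases v) auto

lemma mpoly_eval_wadd:
  "mpoly_eval e (wadd p x y n) = wadd p (\<lambda>i. mpoly_eval e (x i)) (\<lambda>i. mpoly_eval e (y i)) n"
  by (simp add: wadd_def mpoly_eval_compose case_sum_eval)

lemma mpoly_eval_wmult:
  "mpoly_eval e (wmult p x y n) = wmult p (\<lambda>i. mpoly_eval e (x i)) (\<lambda>i. mpoly_eval e (y i)) n"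
  by (simp add: wmult_def mpoly_eval_compose case_sum_eval)

lemma mpoly_eval_wuminus:
  "mpoly_eval e (wuminus p x n) = wuminus p (\<lambda>i. mpoly_eval e (x i)) n"
  by (simp add: wuminus_def mpoly_eval_compose)

lemma mpoly_eval_wzero: "mpoly_eval e (wzero n) = wzero n"
  by (simp add: wzero_def)

lemma mpoly_eval_wone: "mpoly_eval e (wone n) = wone n"
  by (simp add: wone_def)

lemmas mpoly_eval_witt =
  mpoly_eval_wadd mpoly_eval_wmult mpoly_eval_wuminus mpoly_eval_wzero mpoly_eval_wone

lemma witt_ring_laws:
  fixes x y z :: "nat \<Rightarrow> 'a::comm_ring_1"
  assumes p: "prime p"
  shows "wadd p (wadd p x y) z = wadd p x (wadd p y z)"
    and "wadd p x y = wadd p y x"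
    and "wadd p wzero x = x"
    and "wadd p (wuminus p x) x = wzero"
    and "wmult p (wmult p x y) z = wmult p x (wmult p y z)"
    and "wmult p x y = wmult p y x"
    and "wmult p wone x = x"
    and "wmult p (wadd p x y) z = wadd p (wmult p x z) (wmult p y z)"
proof -
  define e where "e = case_sum x (case_sum y z)"
  define X Y Z :: "nat \<Rightarrow> (nat + nat + nat) int_mpoly"
    where "X = (\<lambda>i. mvar (Inl i))" and "Y = (\<lambda>i. mvar (Inr (Inl i)))"
      and "Z = (\<lambda>i. mvar (Inr (Inr i)))"
  have e: "(\<lambda>i. mpoly_eval e (X i)) = x" "(\<lambda>i. mpoly_eval e (Y i)) = y"
    "(\<lambda>i. mpoly_eval e (Z i)) = z"
    by (auto simp: X_def Y_def Z_def e_def)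
  have p0: "p > 0" using p prime_gt_0_nat by blast
  have transfer: "(\<lambda>i. mpoly_eval e (s i)) = (\<lambda>i. mpoly_eval e (t i))"
    if "\<And>n. ghost p s n = ghost p t n" for s t :: "nat \<Rightarrow> (nat + nat + nat) int_mpoly"
    using ghost_inj[OF that p0] by simp
  note g = ghost_wadd[OF p] ghost_wmult[OF p] ghost_wuminus[OF p]
    ghost_wzero[OF p0] ghost_wone[OF p0]
  show "wadd p (wadd p x y) z = wadd p x (wadd p y z)"
    using transfer[of "wadd p (wadd p X Y) Z" "wadd p X (wadd p Y Z)"]
    by (simp add: g mpoly_eval_witt e add_ac)
  show "wadd p x y = wadd p y x"
    using transfer[of "wadd p X Y" "wadd p Y X"]
    by (simp add: g mpoly_eval_witt e add_ac)
  show "wadd p wzero x = x"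
    using transfer[of "wadd p wzero X" "X"]
    by (simp add: g mpoly_eval_witt e)
  show "wadd p (wuminus p x) x = wzero"
    using transfer[of "wadd p (wuminus p X) X" wzero]
    by (simp add: g mpoly_eval_witt e)
  show "wmult p (wmult p x y) z = wmult p x (wmult p y z)"
    using transfer[of "wmult p (wmult p X Y) Z" "wmult p X (wmult p Y Z)"]
    by (simp add: g mpoly_eval_witt e mult_ac)
  show "wmult p x y = wmult p y x"
    using transfer[of "wmult p X Y" "wmult p Y X"]
    by (simp add: g mpoly_eval_witt e mult_ac)
  show "wmult p wone x = x"
    using transfer[of "wmult p wone X" "X"]
    by (simp add: g mpoly_eval_witt e)
  show "wmult p (wadd p x y) z = wadd p (wmult p x z) (wmult p y z)"
    using transfer[of "wmult p (wadd p X Y) Z" "wadd p (wmult p X Z) (wmult p Y Z)"]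
    by (simp add: g mpoly_eval_witt e ring_distribs)
qed

text \<open>The ring \<open>W(R)\<close> of \<open>p\<close>-typical Witt vectors of a ring of characteristic \<open>p\<close>.\<close>

typedef 'a witt = "UNIV :: (nat \<Rightarrow> 'a) set"
  morphisms witt_coord Witt by auto

setup_lifting type_definition_witt

instantiation witt :: (comm_ring_prime_char) comm_ring_1
begin

lift_definition zero_witt :: "'a witt" is wzero .
lift_definition one_witt :: "'a witt" is wone .
lift_definition plus_witt :: "'a witt \<Rightarrow> 'a witt \<Rightarrow> 'a witt" is "wadd CHAR('a)" .
lift_definition times_witt :: "'a witt \<Rightarrow> 'a witt \<Rightarrow> 'a witt" is "wmult CHAR('a)" .
lift_definition uminus_witt :: "'a witt \<Rightarrow> 'a witt" is "wuminus CHAR('a)" .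
definition minus_witt :: "'a witt \<Rightarrow> 'a witt \<Rightarrow> 'a witt" where
  "minus_witt x y = x + - y"

instance
proof
  fix x y z :: "'a witt"
  have p: "prime CHAR('a)" by simp
  show "x + y + z = x + (y + z)" by transfer (rule witt_ring_laws[OF p])
  show "x + y = y + x" by transfer (rule witt_ring_laws[OF p])
  show "0 + x = x" by transfer (rule witt_ring_laws[OF p])
  show "- x + x = 0" by transfer (rule witt_ring_laws[OF p])
  show "x - y = x + - y" by (rule minus_witt_def)
  show "x * y * z = x * (y * z)" by transfer (rule witt_ring_laws[OF p])
  show "x * y = y * x" by transfer (rule witt_ring_laws[OF p])
  show "1 * x = x" by transfer (rule witt_ring_laws[OF p])
  show "(x + y) * z = x * z + y * z" by transfer (rule witt_ring_laws[OF p])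
  show "(0 :: 'a witt) \<noteq> 1"
    by transfer (auto simp: wzero_def wone_def fun_eq_iff)
qed

end

lemma ghost_shift:
  fixes x :: "nat \<Rightarrow> 'a::comm_ring_1"
  assumes "p > 0" "\<And>i. i < m \<Longrightarrow> x i = 0"
  shows "of_nat p ^ m dvd ghost p x n"
    and "\<exists>r. ghost p x (m + n) = of_nat p ^ m * x m ^ (p ^ n) + of_nat p ^ Suc m * r"
proof -
  let ?t = "\<lambda>n i. of_nat p ^ i * x i ^ (p ^ (n - i))"
  have 0: "?t n i = 0" if "i < m" for i n
    using that assms by (simp add: zero_power)
  have 1: "of_nat p ^ l dvd ?t n i" if "l \<le> i" for l i n
    using that by (simp add: le_imp_power_dvd)
  show "of_nat p ^ m dvd ghost p x n"
    unfolding ghost_def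
  proof (rule dvd_sum)
    fix i show "of_nat p ^ m dvd ?t n i"
      using 0[of i n] 1[of m i n] by (cases "i < m") auto
  qed
  have "ghost p x (m + n) = ?t (m + n) m + (\<Sum>i\<in>{..m + n} - {m}. ?t (m + n) i)"
    unfolding ghost_def by (rule sum.remove) auto
  moreover have "of_nat p ^ Suc m dvd (\<Sum>i\<in>{..m + n} - {m}. ?t (m + n) i)"
  proof (rule dvd_sum)
    fix i assume "i \<in> {..m + n} - {m}"
    then consider "i < m" | "Suc m \<le> i" by force
    then show "of_nat p ^ Suc m dvd ?t (m + n) i"
      by cases (use 0 1 in \<open>auto simp del: power_Suc\<close>)
  qed
  ultimately show "\<exists>r. ghost p x (m + n) = of_nat p ^ m * x m ^ (p ^ n) + of_nat p ^ Suc m * r"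
    by (auto simp: dvd_def)
qed

lemma wmult_leading:
  fixes a b :: "nat \<Rightarrow> 'a::comm_ring_prime_char"
  defines "p \<equiv> CHAR('a)"
  assumes a: "\<And>i. i < m \<Longrightarrow> a i = 0" and b: "\<And>i. i < n \<Longrightarrow> b i = 0"
  shows "wmult p a b (m + n) = a m ^ (p ^ n) * b n ^ (p ^ m)"
proof -
  define X Y :: "nat \<Rightarrow> (nat + nat) int_mpoly"
    where "X = (\<lambda>i. if i < m then 0 else mvar (Inl i))"
      and "Y = (\<lambda>i. if i < n then 0 else mvar (Inr i))"
  define C where "C = wmult p X Y"
  let ?p = "of_nat p :: (nat + nat) int_mpoly"
  have p: "prime p" and p0: "p > 0" and p2: "p \<ge> 2"
    using prime_ge_2_nat by (auto simp: p_def)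
  have gX: "?p ^ m dvd ghost p X j" and gY: "?p ^ n dvd ghost p Y j" for j
    by (rule ghost_shift(1)[OF p0]; simp add: X_def Y_def)+
  have gC: "ghost p C j = ghost p X j * ghost p Y j" for j
    unfolding C_def by (rule ghost_wmult[OF p])
  have tail: "?p ^ Suc j dvd (\<Sum>i<j. ?p ^ i * C i ^ (p ^ (j - i)))"
    if "\<And>i. i < j \<Longrightarrow> ?p dvd C i" for j
  proof (rule dvd_sum)
    fix i assume "i \<in> {..<j}"
    then have ij: "i < j" by simp
    have "Suc (j - i) \<le> 2 ^ (j - i)" by (simp add: Suc_le_eq)
    also have "\<dots> \<le> p ^ (j - i)" using p2 by (simp add: power_mono)
    finally have "?p ^ Suc (j - i) dvd ?p ^ (p ^ (j - i))" by (rule le_imp_power_dvd)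
    also have "\<dots> dvd C i ^ (p ^ (j - i))" using that[OF ij] by (rule dvd_power_same)
    finally have "?p ^ i * ?p ^ Suc (j - i) dvd ?p ^ i * C i ^ (p ^ (j - i))"
      by (intro mult_dvd_mono) auto
    then show "?p ^ Suc j dvd ?p ^ i * C i ^ (p ^ (j - i))"
      unfolding power_add[symmetric] using ij by simp
  qed
  have C: "?p dvd C j" if "j < m + n" for j
    using that
  proof (induction j rule: less_induct)
    case (less j)
    have "?p ^ (m + n) dvd ghost p C j"
      unfolding gC power_add by (intro mult_dvd_mono gX gY)
    moreover have "?p ^ Suc j dvd ?p ^ (m + n)"
      using less.prems by (intro le_imp_power_dvd) simp
    ultimately have "?p ^ Suc j dvd ghost p C j" by (rule dvd_trans[rotated])
    moreover have "?p ^ Suc j dvd (\<Sum>i<j. ?p ^ i * C i ^ (p ^ (j - i)))"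
      using less by (intro tail) auto
    ultimately have "?p ^ Suc j dvd ghost p C j - (\<Sum>i<j. ?p ^ i * C i ^ (p ^ (j - i)))"
      by (rule dvd_diff)
    then have "?p ^ Suc j dvd ?p ^ j * C j" by (simp add: ghost_split)
    then obtain r where "?p ^ j * C j = ?p ^ Suc j * r" by (elim dvdE)
    then have "?p ^ j * C j = ?p ^ j * (?p * r)" by (simp add: mult_ac)
    then have "C j = ?p * r" using p0 by (rule mpoly_torsion_free)
    then show ?case by simp
  qed
  obtain r where r: "ghost p X (m + n) = ?p ^ m * X m ^ (p ^ n) + ?p ^ Suc m * r"
    using ghost_shift(2)[OF p0, of m X n] by (auto simp: X_def)
  obtain s where s: "ghost p Y (n + m) = ?p ^ n * Y n ^ (p ^ m) + ?p ^ Suc n * s"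
    using ghost_shift(2)[OF p0, of n Y m] by (auto simp: Y_def)
  obtain t where t: "(\<Sum>i<m+n. ?p ^ i * C i ^ (p ^ (m + n - i))) = ?p ^ Suc (m + n) * t"
    using tail[OF C] by (auto elim!: dvdE)
  define u where "u = X m ^ (p ^ n) * s + r * Y n ^ (p ^ m) + ?p * r * s - t"
  have "?p ^ (m + n) * C (m + n) = ghost p X (m + n) * ghost p Y (n + m) - ?p ^ Suc (m + n) * t"
    using gC[of "m + n"] unfolding ghost_split[of p C] t add.commute[of n m]
    by (simp add: eq_diff_eq add_ac)
  also have "\<dots> = ?p ^ (m + n) * (X m ^ (p ^ n) * Y n ^ (p ^ m) + ?p * u)"
    unfolding r s u_def by (simp add: power_add algebra_simps)
  finally have lead: "C (m + n) = X m ^ (p ^ n) * Y n ^ (p ^ m) + ?p * u"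
    using p0 by (rule mpoly_torsion_free)
  define e where "e = case_sum a b"
  have X: "(\<lambda>i. mpoly_eval e (X i)) = a" and Y: "(\<lambda>i. mpoly_eval e (Y i)) = b"
    using a b by (auto simp: X_def Y_def e_def)
  have "wmult p a b (m + n) = mpoly_eval e (C (m + n))"
    by (simp add: C_def mpoly_eval_wmult X Y)
  also have "\<dots> = mpoly_eval e (X m) ^ (p ^ n) * mpoly_eval e (Y n) ^ (p ^ m)"
    by (simp add: lead mpoly_eval_add mpoly_eval_mult mpoly_eval_power p_def)
  finally show ?thesis using X Y by (metis (no_types, lifting))
qed

instance witt :: (idom_prime_char) idom
proof
  fix x y :: "'a witt"
  let ?a = "witt_coord x" and ?b = "witt_coord y"
  assume "x \<noteq> 0" "y \<noteq> 0"
  then have "\<exists>m. ?a m \<noteq> 0" "\<exists>n. ?b n \<noteq> 0"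
    by (transfer; auto simp: wzero_def fun_eq_iff)+
  then obtain m n where m: "?a m \<noteq> 0" "\<And>i. i < m \<Longrightarrow> ?a i = 0"
    and n: "?b n \<noteq> 0" "\<And>i. i < n \<Longrightarrow> ?b i = 0"
    using exists_least_iff[of "\<lambda>m. ?a m \<noteq> 0"] exists_least_iff[of "\<lambda>m. ?b m \<noteq> 0"] by blast
  have "witt_coord (x * y) (m + n) \<noteq> 0"
    using m n by (simp add: times_witt.rep_eq wmult_leading)
  then show "x * y \<noteq> 0"
    by (metis wzero_def zero_witt.rep_eq)
qed

lemma witt_of_nat_CHAR: "witt_coord (of_nat CHAR('a) :: 'a::comm_ring_prime_char witt) 1 = 1"
proof -
  define p where "p = CHAR('a)"
  have p: "prime p" and p0: "p > 0" and p2: "p \<ge> 2"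
    using prime_ge_2_nat by (auto simp: p_def)
  define U :: "nat \<Rightarrow> nat \<Rightarrow> nat int_mpoly"
    where "U k = ((wadd p wone) ^^ k) wzero" for k
  have g: "ghost p (U k) n = of_nat k" for k n
    by (induction k) (simp_all add: U_def ghost_wzero ghost_wadd ghost_wone p p0)
  have e: "(\<lambda>n. mpoly_eval (\<lambda>_. 0) (U k n)) = witt_coord (of_nat k :: 'a witt)" for k
  proof (induction k)
    case 0
    then show ?case by (simp add: U_def mpoly_eval_witt zero_witt.rep_eq)
  next
    case (Suc k)
    then show ?case
      by (simp add: U_def mpoly_eval_witt one_witt.rep_eq plus_witt.rep_eq p_def)
  qed
  have U0: "U p 0 = of_nat p" using g[of p 0] by (simp add: ghost_def)
  have "of_nat p ^ 1 * U p 1 = of_nat p ^ 1 * (1 - of_nat p ^ (p - 1))"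
    using g[of p 1] p0 by (simp add: ghost_def U0 right_diff_distrib eq_diff_eq add.commute
        flip: power_Suc)
  then have "U p 1 = 1 - of_nat p ^ (p - 1)"
    using p0 by (rule mpoly_torsion_free)
  then have "mpoly_eval (\<lambda>_. 0) (U p 1) = (1 :: 'a)"
    using p2 by (simp add: mpoly_eval_diff mpoly_eval_power p_def zero_power)
  then show ?thesis
    using fun_cong[OF e, of p 1] by (simp add: p_def)
qed

lemma witt_coord_of_nat_0: "witt_coord (of_nat k :: 'a::comm_ring_prime_char witt) 0 = of_nat k"
proof -
  have *: "wadd p a b 0 = a 0 + b 0" if "prime p" for p and a b :: "nat \<Rightarrow> 'a"
    using ghost_wadd[OF that, of a b 0] by (simp add: ghost_def)
  show ?thesis
    by (induction k) (simp_all add: plus_witt.rep_eq one_witt.rep_eq zero_witt.rep_eq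
        wzero_def wone_def *)
qed

instance witt :: (idom_prime_char) ring_char_0
proof
  let ?c = "CHAR('a witt)" and ?p = "CHAR('a)"
  have "?c = 0"
  proof (rule ccontr)
    assume "?c \<noteq> 0"
    then have c: "prime ?c" by (intro prime_CHAR_semidom) simp
    have "(of_nat ?c :: 'a) = 0"
      using witt_coord_of_nat_0[of ?c, where ?'a = 'a] by (simp add: zero_witt.rep_eq wzero_def)
    then have "?p dvd ?c" by (simp add: of_nat_eq_0_iff_char_dvd)
    then have "?p = ?c" using c by (intro primes_dvd_imp_eq) simp_all
    then show False
      using witt_of_nat_CHAR[where ?'a = 'a] by (simp add: zero_witt.rep_eq wzero_def)
  qed
  then have nz: "of_nat k = (0 :: 'a witt) \<longleftrightarrow> k = 0" for k
    by (simp add: of_nat_eq_0_iff_char_dvd)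
  show "inj (of_nat :: nat \<Rightarrow> 'a witt)"
  proof (rule injI)
    fix i j :: nat
    assume eq: "(of_nat i :: 'a witt) = of_nat j"
    show "i = j"
    proof (cases "i \<le> j")
      case True
      then have "(of_nat (j - i) :: 'a witt) = 0" using eq by (simp add: of_nat_diff)
      then show ?thesis using nz[of "j - i"] True by simp
    next
      case False
      then have "(of_nat (i - j) :: 'a witt) = 0" using eq by (simp add: of_nat_diff)
      then show ?thesis using nz[of "i - j"] False by simp
    qed
  qed
qed

instance fract :: ("{idom, ring_char_0}") field_char_0
proof
  have "(of_nat k :: 'a fract) = Fraction_Field.Fract (of_nat k) 1" for k
    by (induction k) (auto simp: Zero_fract_def One_fract_def)
  then show "inj (of_nat :: nat \<Rightarrow> 'a fract)"
    by (auto simp: inj_def eq_fract)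
qed


section \<open>Unramified extensions, Teichmueller representatives, traces and norms\<close>

text \<open>
  Everything takes place inside the field of fractions of \<open>W(k)\<close>, where \<open>k\<close> is an algebraically
  closed field of characteristic \<open>p\<close>. It contains \<open>W(F)\<close> for every finite field \<open>F\<close> of
  characteristic \<open>p\<close>, together with the inclusions between these rings.
\<close>

definition Fq :: "nat \<Rightarrow> 'k::{alg_closed_field, field_prime_char} set" where
  "Fq q = {x. x ^ q = x}"

definition Zq :: "nat \<Rightarrow> 'k::{alg_closed_field, field_prime_char} witt fract set" where
  "Zq q = (\<lambda>w. Fraction_Field.Fract w 1) ` {w. \<forall>i. witt_coord w i \<in> Fq q}"

text \<open>Note the index: \<open>mu q\<close> is \<open>\<mu>\<^bsub>q-1\<^esub>\<close>.\<close>

definition mu :: "nat \<Rightarrow> 'k::{alg_closed_field, field_prime_char} witt fract set" where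
  "mu q = {x \<in> Zq q. x ^ (q - 1) = 1}"

definition teich :: "'k::{alg_closed_field, field_prime_char} \<Rightarrow> 'k witt fract" where
  "teich a = Fraction_Field.Fract (Witt (\<lambda>i. if i = 0 then a else 0)) 1"

text \<open>
  Automorphisms of the ring \<open>B\<close> over the subring \<open>A\<close>; requiring extensionality makes each
  automorphism of \<open>B\<close> a single function.
\<close>

definition Gal :: "'a::comm_ring_1 set \<Rightarrow> 'a set \<Rightarrow> ('a \<Rightarrow> 'a) set" where
  "Gal B A = {\<sigma> \<in> extensional B. bij_betw \<sigma> B B \<and>
     (\<forall>x\<in>B. \<forall>y\<in>B. \<sigma> (x + y) = \<sigma> x + \<sigma> y \<and> \<sigma> (x * y) = \<sigma> x * \<sigma> y) \<and>
     (\<forall>x\<in>A. \<sigma> x = x)}"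

text \<open>
  Trace and norm as sum and product of the conjugates. This is meant for the Galois extensions
  \<open>Zq (q ^ k)\<close> of \<open>Zq p\<close> and \<open>Fq (q ^ k)\<close> of \<open>Fq q\<close>, where \<^const>\<open>Gal\<close> is finite.
\<close>

definition Tr :: "'a::comm_ring_1 set \<Rightarrow> 'a set \<Rightarrow> 'a \<Rightarrow> 'a" where
  "Tr B A x = (\<Sum>\<sigma>\<in>Gal B A. \<sigma> x)"

definition Norm :: "'a::comm_ring_1 set \<Rightarrow> 'a set \<Rightarrow> 'a \<Rightarrow> 'a" where
  "Norm B A x = (\<Prod>\<sigma>\<in>Gal B A. \<sigma> x)"


section \<open>Exponential sums and the \<open>C\<close>-function\<close>

text \<open>The character \<open>\<omega>\<^bsup>-d\<^esup>\<close>. Only the class of \<open>d\<close> modulo \<open>q - 1\<close> matters on \<open>(Fq q - {0})\<^sup>n\<close>.\<close>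

definition omega_char ::
    "int ^ 'n \<Rightarrow> 'k ^ 'n \<Rightarrow> 'k::{alg_closed_field, field_prime_char} witt fract" where
  "omega_char d x = (\<Prod>i\<in>UNIV. teich (x $ i) powi (- (d $ i)))"

text \<open>
  \<open>\<chi>\<^sub>k\<close> as a function on \<open>\<mu>\<^sup>n\<close>: the isomorphism from \<open>\<mu>\<close> to the units of the residue field is
  inverse to \<^const>\<open>teich\<close>.
\<close>

definition omega_char_ext ::
    "int ^ 'n \<Rightarrow> nat \<Rightarrow> nat \<Rightarrow> 'k witt fract ^ 'n \<Rightarrow> 'k::{alg_closed_field, field_prime_char} witt fract"
  where "omega_char_ext d q k x =
    omega_char d (\<chi> i. Norm (Fq (q ^ k)) (Fq q) (inv teich (x $ i)))"

text \<open>A Laurent polynomial over \<open>K\<close> in \<open>n\<close> variables is a finitely supported map from \<open>\<int>\<^sup>n\<close> to \<open>K\<close>.\<close>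

definition laurent_eval :: "(int ^ 'n \<Rightarrow>\<^sub>0 'a) \<Rightarrow> 'a ^ 'n \<Rightarrow> 'a::field" where
  "laurent_eval f x =
    (\<Sum>u\<in>Poly_Mapping.keys f. Poly_Mapping.lookup f u * (\<Prod>i\<in>UNIV. x $ i powi (u $ i)))"

text \<open>
  \<^term>\<open>fps_binomial c\<close> is \<open>(1 + T)\<^sup>c\<close>, so \<open>\<psi>\<close> is the restriction of \<^const>\<open>fps_binomial\<close> to the
  \<open>p\<close>-adic integers \<open>Zq p\<close>.
\<close>

definition S_sum ::
    "(int ^ 'n \<Rightarrow>\<^sub>0 'k witt fract) \<Rightarrow> int ^ 'n \<Rightarrow> nat \<Rightarrow> nat
      \<Rightarrow> 'k::{alg_closed_field, field_prime_char} witt fract fps" where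
  "S_sum f d q k = (\<Sum>x\<in>{x. \<forall>i. x $ i \<in> mu (q ^ k)}.
     fps_const (omega_char_ext d q k x) *
     fps_binomial (Tr (Zq (q ^ k)) (Zq CHAR('k)) (laurent_eval f x)))"

text \<open>\<open>exp\<close> of a power series without constant term over a \<open>\<rat>\<close>-algebra of power series:\<close>

definition exp_fps :: "'a::field_char_0 fps fps \<Rightarrow> 'a fps fps" where
  "exp_fps g = fps_compose (Abs_fps (\<lambda>j. fps_const (1 / fact j))) g"

text \<open>\<open>C\<^bsub>f,\<chi>\<^esub>(s,T)\<close>; the outer series variable is \<open>s\<close>, the inner one \<open>T\<close>.\<close>

definition C_fun ::
    "(int ^ 'n \<Rightarrow>\<^sub>0 'k witt fract) \<Rightarrow> int ^ 'n \<Rightarrow> nat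
      \<Rightarrow> 'k::{alg_closed_field, field_prime_char} witt fract fps fps" where
  "C_fun f d q = exp_fps (Abs_fps (\<lambda>k. if k = 0 then 0 else
     fps_const (- 1 / (of_nat q ^ k - 1) ^ CARD('n) / of_nat k) * S_sum f d q k))"

text \<open>Unlike \<^const>\<open>subdegree\<close>, the \<open>T\<close>-adic order of \<open>0\<close> is infinite.\<close>

definition ord_T :: "'a::zero fps \<Rightarrow> ereal" where
  "ord_T a = (if a = 0 then \<infinity> else ereal (real (subdegree a)))"

text \<open>
  The notion is defined for series with coefficients in \<open>R[[T]]\<close>; since \<^const>\<open>C_fun\<close> is formed over
  the field of fractions, this integrality is part of the definition.
\<close>

definition T_adic_entire :: "'a::zero set \<Rightarrow> 'a fps fps \<Rightarrow> bool" where
  "T_adic_entire R F \<longleftrightarrow>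
     (\<forall>i j. fps_nth (fps_nth F i) j \<in> R) \<and>
     (\<lambda>i. ord_T (fps_nth F i) / ereal (real i)) \<longlonglongrightarrow> \<infinity>"

end

theory Submission
  imports
    Defs
    "HOL-Computational_Algebra.Polynomial_Factorial"
    "HOL-Number_Theory.Residues"
    "HOL-Algebra.Multiplicative_Group"
    "Jordan_Normal_Form.Determinant"
begin

text \<open>
  Write \<open>K\<close> for the field of fractions of \<open>W(k)\<close> and \<open>S\<^sub>k\<close> for the exponential sum over \<open>\<mu>\<^sup>n\<close>, where \<open>\<mu>\<close>
  is the group of \<open>(q^k - 1)\<close>-th roots of unity. The two halves of the statement, integrality of
  the coefficients of \<open>C = exp (- \<Sum> S\<^sub>k / (q^k - 1)^n s^k / k)\<close> and the growth of their \<open>T\<close>-adic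
  orders, have different reasons.

  \<^emph>\<open>The sums in closed form.\<close> The Galois group of \<open>Zq (q ^ k)\<close> over \<open>Zq p\<close> consists of the powers of
  the Frobenius map (\<open>Tr_Zq\<close>), which raises the roots of unity to the power \<open>p\<close>; that of \<open>Fq (q ^ k)\<close>
  over \<open>Fq q\<close> consists of the powers of \<open>x \<mapsto> x^q\<close> (\<open>Norm_Fq\<close>). Hence the summand of \<open>S\<^sub>k\<close> at \<open>x\<close> is the product of \<open>w (x^(q^j))\<close> over
  \<open>j < k\<close>, where \<open>w x = x^(-d) (1 + T)^(g x)\<close> and \<open>g\<close> is the sum of \<open>f\<^sup>\<sigma> (x^(p^i))\<close> over \<open>i < a\<close>, with
  \<open>\<sigma>\<close> the \<open>i\<close>-th power of Frobenius (\<open>S_sum_eq\<close>, \<open>weight_prod\<close>).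

  \<^emph>\<open>Growth.\<close> This is Dwork's argument, and \<open>T\<close>-adically it needs no integral splitting function: since
  \<open>(1 + T)^c = \<Sum> (c gchoose j) T^j\<close> and \<open>c gchoose j\<close> is a polynomial of degree \<open>j\<close> in \<open>c\<close>, the series
  \<open>(1 + T)^(g x)\<close> is, modulo any power of \<open>T\<close>, a Laurent polynomial \<open>G\<close> in \<open>x\<close> over \<open>K[[T]]\<close> whose
  coefficient at \<open>x^v\<close> is divisible by \<open>T^m\<close> with \<open>m \<ge> |v| / D\<close> for a constant \<open>D\<close>
  (\<open>tame_binomial_trunc\<close>, \<open>leval_binomial_trunc\<close>). Put \<open>A(r,w) = G\<^sub>v\<close> with \<open>v = q r - w + d\<close>, for
  exponent vectors \<open>r\<close>, \<open>w\<close> in a large finite box. Orthogonality of characters gives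
  \<open>S\<^sub>k = (q^k - 1)^n tr (A^k)\<close> (\<open>dwork_trace_formula\<close>), hence \<open>C = det (1 - s A)\<close> modulo that power of
  \<open>T\<close> (\<open>is_exp_det_charmat\<close>). The coefficient of \<open>s^m\<close> in the determinant is a signed sum of products
  of \<open>A(r, \<pi> r)\<close> over \<open>m\<close>-element sets \<open>R\<close> and permutations \<open>\<pi>\<close> of \<open>R\<close>. Because \<open>q \<ge> 2\<close>, the order of
  such a product is at least \<open>(\<Sum>r\<in>R. |r| - |d|) / D\<close>, and this bound does not depend on the box. Only
  finitely many vectors have a given norm, so it grows faster than any multiple of \<open>m\<close>
  (\<open>C_fun_coeff_support\<close>, \<open>sum_vnorm_superlinear\<close>).

  \<^emph>\<open>Integrality.\<close> The series \<open>L = exp (- \<Sum> S\<^sub>k s^k / k)\<close> is an Euler product over the orbits of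
  \<open>x \<mapsto> x^q\<close>, whose factors involve only the summands of the \<open>S\<^sub>k\<close>; these are integral because the
  binomial coefficients of \<open>p\<close>-adic integers are (\<open>gbinomial_Zp\<close>, \<open>L_function_integral\<close>). Dividing the
  \<open>k\<close>-th exponent by \<open>q^k - 1\<close> turns a series \<open>F\<close> into a solution \<open>F'\<close> of \<open>F'(q s) = F'(s) F(s)\<close>; its
  coefficients are determined recursively after division by \<open>q^m - 1\<close>, which is a unit, and so stay
  integral (\<open>divide_by_q_power_minus_1_integral\<close>). Doing this \<open>n\<close> times leads from \<open>L\<close> to \<open>C\<close>.
\<close>


section \<open>Witt vectors in characteristic \<open>p\<close>\<close>

text \<open>
  The standard principle for computing Witt vectors modulo \<open>p\<close>: the ghost map is only injective in
  characteristic \<open>0\<close>, but congruences of ghost components modulo \<open>p^(n+1)\<close> descend to congruences of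
  the coordinates modulo \<open>p\<close>, since \<open>x \<equiv> y\<close> modulo \<open>p\<close> implies \<open>x^(p^j) \<equiv> y^(p^j)\<close> modulo \<open>p^(j+1)\<close>.
\<close>

lemma ghost_cong_imp_cong:
  fixes x y :: "nat \<Rightarrow> 'v int_mpoly"
  assumes p: "prime p" and "\<And>n. of_nat p ^ Suc n dvd ghost p x n - ghost p y n"
  shows "of_nat p dvd x n - y n"
proof (induction n rule: less_induct)
  case (less n)
  let ?p = "of_nat p :: 'v int_mpoly"
  have p0: "p > 0" using p prime_gt_0_nat by blast
  have "?p ^ Suc n dvd ?p ^ i * (x i ^ (p ^ (n - i)) - y i ^ (p ^ (n - i)))" if "i < n" for i
  proof -
    have "?p ^ i * ?p ^ Suc (n - i) dvd ?p ^ i * (x i ^ (p ^ (n - i)) - y i ^ (p ^ (n - i)))"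
      using less that by (intro mult_dvd_mono dvd_power_prime_power) auto
    then show ?thesis
      using that unfolding power_add[symmetric] by simp
  qed
  then have S: "?p ^ Suc n dvd (\<Sum>i<n. ?p ^ i * (x i ^ (p ^ (n - i)) - y i ^ (p ^ (n - i))))"
    by (intro dvd_sum) auto
  have "ghost p x n - ghost p y n =
      (\<Sum>i<n. ?p ^ i * (x i ^ (p ^ (n - i)) - y i ^ (p ^ (n - i)))) + ?p ^ n * (x n - y n)"
    by (simp add: ghost_split right_diff_distrib sum_subtractf)
  with assms(2)[of n] have "?p ^ Suc n dvd ?p ^ n * (x n - y n)"
    by (simp only: dvd_add_right_iff[OF S])
  then obtain r where "?p ^ n * (x n - y n) = ?p ^ Suc n * r" by (elim dvdE)
  then have "?p ^ n * (x n - y n) = ?p ^ n * (?p * r)" by (simp add: mult_ac)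
  then have "x n - y n = ?p * r" using p0 by (rule mpoly_torsion_free)
  then show ?case by simp
qed

lemma mpoly_eval_cong_CHAR:
  fixes x :: "'v \<Rightarrow> 'a::comm_ring_1"
  assumes "of_nat CHAR('a) dvd f - g"
  shows "mpoly_eval x f = mpoly_eval x g"
proof -
  obtain r where "f - g = of_nat CHAR('a) * r" using assms by (elim dvdE)
  then have "mpoly_eval x (f - g) = 0" by (simp add: mpoly_eval_mult)
  then show ?thesis by (simp add: mpoly_eval_diff)
qed

text \<open>
  Multiplication by \<open>p\<close> is Verschiebung after Frobenius. For polynomials over \<open>\<int>\<close> the two sides have
  ghost components that differ by \<open>p^(n+1)\<close> times the \<open>n\<close>-th variable, so their coordinates agree modulo \<open>p\<close>.
\<close>

lemma witt_coord_CHAR_mult: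
  fixes x :: "'a::comm_ring_prime_char witt"
  shows "witt_coord (of_nat CHAR('a) * x) n =
    (if n = 0 then 0 else witt_coord x (n - 1) ^ CHAR('a))"
proof -
  define p where "p = CHAR('a)"
  have p: "prime p" and p0: "p > 0"
    using prime_gt_0_nat by (auto simp: p_def)
  define X :: "nat \<Rightarrow> nat int_mpoly" where "X = mvar"
  \<comment> \<open>\<open>U k\<close> is \<open>k\<close> times the universal Witt vector, \<open>V\<close> the Verschiebung of its Frobenius.\<close>
  define U :: "nat \<Rightarrow> nat \<Rightarrow> nat int_mpoly" where "U k = ((wadd p X) ^^ k) wzero" for k
  define V :: "nat \<Rightarrow> nat int_mpoly" where "V n = (if n = 0 then 0 else X (n - 1) ^ p)" for n
  have gU: "ghost p (U k) n = of_nat k * ghost p X n" for k n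
    by (induction k) (simp_all add: U_def ghost_wzero ghost_wadd p p0 algebra_simps)
  have eU: "(\<lambda>n. mpoly_eval (witt_coord x) (U k n)) = witt_coord (of_nat k * x)" for k
  proof (induction k)
    case 0
    then show ?case by (simp add: U_def mpoly_eval_witt zero_witt.rep_eq)
  next
    case (Suc k)
    then show ?case
      by (simp add: U_def mpoly_eval_witt plus_witt.rep_eq p_def X_def distrib_right)
  qed
  have gV: "ghost p V n = of_nat p * ghost p X n - of_nat p ^ Suc n * X n" for n
  proof (cases n)
    case 0
    then show ?thesis by (simp add: ghost_def V_def)
  next
    case (Suc m)
    have "ghost p V n = (\<Sum>i\<le>m. of_nat p ^ Suc i * (X i ^ p) ^ (p ^ (m - i)))"
      using p0 unfolding ghost_def Suc
      by (subst sum.atMost_Suc_shift) (simp add: V_def zero_power)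
    also have "\<dots> = of_nat p * ghost p (\<lambda>i. X i ^ p) m"
      by (simp add: ghost_def sum_distrib_left mult_ac)
    finally show ?thesis
      unfolding Suc ghost_Suc by (simp add: algebra_simps)
  qed
  have "of_nat p dvd U p n - V n"
    by (rule ghost_cong_imp_cong[OF p]) (simp add: gU gV)
  then have "mpoly_eval (witt_coord x) (U p n) = mpoly_eval (witt_coord x) (V n)"
    unfolding p_def by (rule mpoly_eval_cong_CHAR)
  then show ?thesis
    using fun_cong[OF eU[of p], of n]
    by (simp add: V_def X_def p_def mpoly_eval_power split: if_splits)
qed

lemma witt_coord_CHAR_power_mult:
  fixes x :: "'a::comm_ring_prime_char witt"
  shows "witt_coord (of_nat CHAR('a) ^ m * x) n =
    (if n < m then 0 else witt_coord x (n - m) ^ (CHAR('a) ^ m))"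
proof (induction m arbitrary: n)
  case (Suc m)
  have "witt_coord (of_nat CHAR('a) ^ Suc m * x) n = witt_coord (of_nat CHAR('a) * (of_nat CHAR('a) ^ m * x)) n"
    by (simp add: mult.assoc)
  also have "\<dots> = (if n < Suc m then 0 else witt_coord x (n - Suc m) ^ (CHAR('a) ^ Suc m))"
    unfolding witt_coord_CHAR_mult Suc power_Suc2 power_mult
    by (cases n) (auto simp: zero_power)
  finally show ?case .
qed simp

text \<open>
  If in every position one of the two coordinates vanishes, the ghost components of the coordinatewise
  sum are visibly the sums of the ghost components, so no carries occur.
\<close>

lemma witt_add_disjoint:
  fixes x y :: "'a::comm_ring_prime_char witt"
  assumes "\<And>i. witt_coord x i = 0 \<or> witt_coord y i = 0"
  shows "x + y = Witt (\<lambda>i. witt_coord x i + witt_coord y i)"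
proof -
  define p where "p = CHAR('a)"
  have p: "prime p" and p0: "p > 0"
    using prime_gt_0_nat by (auto simp: p_def)
  let ?a = "witt_coord x" and ?b = "witt_coord y"
  define X Y :: "nat \<Rightarrow> (nat + nat) int_mpoly"
    where "X = (\<lambda>i. if ?a i = 0 then 0 else mvar (Inl i))"
      and "Y = (\<lambda>i. if ?b i = 0 then 0 else mvar (Inr i))"
  define e where "e = case_sum ?a ?b"
  have eX: "(\<lambda>i. mpoly_eval e (X i)) = ?a" and eY: "(\<lambda>i. mpoly_eval e (Y i)) = ?b"
    by (auto simp: X_def Y_def e_def)
  have "(X i + Y i) ^ (p ^ j) = X i ^ (p ^ j) + Y i ^ (p ^ j)" for i j
    using assms[of i] p0 by (auto simp: X_def Y_def zero_power)
  then have "ghost p (\<lambda>i. X i + Y i) n = ghost p X n + ghost p Y n" for n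
    by (simp add: ghost_def sum.distrib distrib_left)
  then have "wadd p X Y = (\<lambda>i. X i + Y i)"
    by (intro ghost_inj[OF _ p0]) (simp add: ghost_wadd[OF p])
  then have "mpoly_eval e (wadd p X Y n) = mpoly_eval e (X n + Y n)" for n by simp
  then have "wadd p ?a ?b n = ?a n + ?b n" for n
    using fun_cong[OF eX, of n] fun_cong[OF eY, of n] by (simp add: mpoly_eval_wadd eX eY mpoly_eval_add)
  then have "witt_coord (x + y) = (\<lambda>i. witt_coord x i + witt_coord y i)"
    by (auto simp: plus_witt.rep_eq p_def)
  then show ?thesis by (metis witt_coord_inverse)
qed

definition teich_witt :: "'a::comm_ring_prime_char \<Rightarrow> 'a witt" where
  "teich_witt a = Witt (\<lambda>i. if i = 0 then a else 0)"

lemma witt_coord_teich_witt: "witt_coord (teich_witt a) i = (if i = 0 then a else 0)"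
  by (simp add: teich_witt_def Witt_inverse)

text \<open>
  The ghost components of \<open>(X, 0, 0, \<dots>)\<close> are the powers \<open>X^(p^n)\<close>, which are multiplicative in \<open>X\<close>.
\<close>

lemma teich_witt_mult: "teich_witt (a * b) = teich_witt a * teich_witt (b :: 'a::comm_ring_prime_char)"
proof -
  define p where "p = CHAR('a)"
  have p: "prime p" and p0: "p > 0"
    using prime_gt_0_nat by (auto simp: p_def)
  define s :: "bool int_mpoly \<Rightarrow> nat \<Rightarrow> bool int_mpoly" where "s X i = (if i = 0 then X else 0)" for X i
  have g: "ghost p (s X) n = X ^ (p ^ n)" for X n
  proof -
    have "ghost p (s X) n = (\<Sum>i\<le>n. if i = 0 then X ^ (p ^ n) else 0)"
      unfolding ghost_def using p0 by (intro sum.cong) (auto simp: s_def zero_power)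
    then show ?thesis by simp
  qed
  let ?X = "mvar True" and ?Y = "mvar False"
  define e where "e v = (if v then a else b)" for v
  have "s (?X * ?Y) = wmult p (s ?X) (s ?Y)"
    by (intro ghost_inj[OF _ p0]) (simp add: g ghost_wmult[OF p] power_mult_distrib)
  then have "mpoly_eval e (s (?X * ?Y) n) = mpoly_eval e (wmult p (s ?X) (s ?Y) n)" for n by simp
  moreover have "(\<lambda>n. mpoly_eval e (s ?X n)) = witt_coord (teich_witt a)"
    "(\<lambda>n. mpoly_eval e (s ?Y n)) = witt_coord (teich_witt b)"
    "(\<lambda>n. mpoly_eval e (s (?X * ?Y) n)) = witt_coord (teich_witt (a * b))"
    by (auto simp: s_def e_def witt_coord_teich_witt mpoly_eval_mult)
  ultimately have "witt_coord (teich_witt (a * b)) = witt_coord (teich_witt a * teich_witt b)"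
    by (simp add: mpoly_eval_wmult times_witt.rep_eq p_def fun_eq_iff)
  then show ?thesis by (simp add: witt_coord_inject)
qed

lemma teich_witt_0 [simp]: "teich_witt 0 = 0" and teich_witt_1 [simp]: "teich_witt 1 = 1"
  by (simp_all add: teich_witt_def wzero_def wone_def zero_witt_def one_witt_def fun_eq_iff Witt_inject)

lemma inj_teich_witt: "inj teich_witt"
  by (rule injI) (metis witt_coord_teich_witt)

text \<open>
  The first step of the \<open>p\<close>-adic expansion in Teichmueller representatives, for Witt vectors whose
  later coordinates have \<open>p\<close>-th roots.
\<close>

lemma witt_decompose:
  fixes x :: "'a::comm_ring_prime_char witt"
  assumes "\<And>i. y i ^ CHAR('a) = witt_coord x (Suc i)"
  shows "x = teich_witt (witt_coord x 0) + of_nat CHAR('a) * Witt y"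
proof -
  have "teich_witt (witt_coord x 0) + of_nat CHAR('a) * Witt y = Witt (witt_coord x)"
    by (subst witt_add_disjoint)
      (auto simp: witt_coord_teich_witt witt_coord_CHAR_mult Witt_inverse assms intro!: arg_cong[of _ _ Witt])
  then show ?thesis by (simp add: witt_coord_inverse)
qed

lemma power_CHAR_diff:
  fixes x y :: "'a::comm_ring_prime_char"
  shows "(x - y) ^ CHAR('a) = x ^ CHAR('a) - y ^ CHAR('a)"
  using freshmans_dream[where x = "x - y" and y = y] by (simp add: algebra_simps)

lemma of_int_power_CHAR: "(of_int c :: 'a::comm_ring_prime_char) ^ CHAR('a) = of_int c"
proof -
  have n: "(of_nat n :: 'a) ^ CHAR('a) = of_nat n" for n
    by (induction n) (simp_all add: freshmans_dream zero_power)
  show ?thesis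
    using n power_CHAR_diff[of "0 :: 'a"] by (cases c rule: int_cases2) (auto simp: zero_power)
qed

text \<open>
  Raising to the power \<open>p\<close> is a ring homomorphism that fixes the integer coefficients. So it commutes
  with the universal Witt polynomials and induces a ring homomorphism on Witt vectors.
\<close>

lemma mpoly_eval_power_CHAR:
  fixes x :: "'v \<Rightarrow> 'a::comm_ring_prime_char"
  shows "mpoly_eval x f ^ CHAR('a) = mpoly_eval (\<lambda>v. x v ^ CHAR('a)) f"
  by (simp add: mpoly_eval_def freshmans_dream_sum power_mult_distrib of_int_power_CHAR
      mono_eval_def prod_power_distrib mult.commute flip: power_mult)

definition witt_frob :: "'a::comm_ring_prime_char witt \<Rightarrow> 'a witt" where
  "witt_frob x = Witt (\<lambda>i. witt_coord x i ^ CHAR('a))"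

lemma witt_coord_frob: "witt_coord (witt_frob x) i = witt_coord (x :: 'a::comm_ring_prime_char witt) i ^ CHAR('a)"
  by (simp add: witt_frob_def Witt_inverse)

lemma witt_frob_add: "witt_frob (x + y) = witt_frob x + witt_frob y"
proof -
  have "(\<lambda>v. case_sum (witt_coord x) (witt_coord y) v ^ CHAR('a)) =
    case_sum (witt_coord (witt_frob x)) (witt_coord (witt_frob y))"
    by (auto simp: witt_coord_frob split: sum.split)
  then have "witt_coord (witt_frob (x + y)) = witt_coord (witt_frob x + witt_frob y)"
    by (auto simp: witt_coord_frob plus_witt.rep_eq wadd_def mpoly_eval_power_CHAR)
  then show ?thesis by (simp add: witt_coord_inject)
qed

lemma witt_frob_mult: "witt_frob (x * y) = witt_frob x * witt_frob y"
proof -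
  have "(\<lambda>v. case_sum (witt_coord x) (witt_coord y) v ^ CHAR('a)) =
    case_sum (witt_coord (witt_frob x)) (witt_coord (witt_frob y))"
    by (auto simp: witt_coord_frob split: sum.split)
  then have "witt_coord (witt_frob (x * y)) = witt_coord (witt_frob x * witt_frob y)"
    by (auto simp: witt_coord_frob times_witt.rep_eq wmult_def mpoly_eval_power_CHAR)
  then show ?thesis by (simp add: witt_coord_inject)
qed

lemma witt_coord_0: "witt_coord 0 i = (0 :: 'a::comm_ring_prime_char)"
  by (simp add: zero_witt.rep_eq wzero_def)

lemma witt_eqI: "(\<And>i. witt_coord x i = witt_coord y i) \<Longrightarrow> x = y"
  by (metis ext witt_coord_inject)

lemma witt_frob_0 [simp]: "witt_frob 0 = (0 :: 'a::comm_ring_prime_char witt)"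
  by (rule witt_eqI) (simp add: witt_coord_frob witt_coord_0 zero_power)

lemma witt_frob_teich_witt: "witt_frob (teich_witt a) = teich_witt ((a::'a::comm_ring_prime_char) ^ CHAR('a))"
  by (rule witt_eqI) (simp add: witt_coord_frob witt_coord_teich_witt zero_power)

lemma witt_frob_1 [simp]: "witt_frob 1 = (1 :: 'a::comm_ring_prime_char witt)"
  using witt_frob_teich_witt[of 1] by simp

lemma witt_coord_frob_funpow:
  "witt_coord ((witt_frob ^^ n) x) i = witt_coord (x :: 'a::comm_ring_prime_char witt) i ^ (CHAR('a) ^ n)"
  by (induction n) (simp_all add: witt_coord_frob power_mult power_Suc2 del: power_Suc)

text \<open>
  This is the geometric series \<open>1 + p^r + p^(2r) + \<dots>\<close> in Witt coordinates: the summands have disjoint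
  supports, and the second factor \<open>y\<close> satisfies \<open>y = 1 + p^r y\<close>. The explicit coordinates show at once
  that the inverse of \<open>1 - p^r\<close> lies in the Witt vectors of the prime field.
\<close>

lemma witt_inverse_one_minus:
  assumes "r > 0"
  shows "(1 - of_nat CHAR('a) ^ r) * Witt (\<lambda>n. if r dvd n then 1 else (0::'a::comm_ring_prime_char)) = 1"
proof -
  let ?y = "Witt (\<lambda>n. if r dvd n then 1 else (0::'a))" and ?P = "of_nat CHAR('a) ^ r :: 'a witt"
  have c: "witt_coord (?P * ?y) i = (if r dvd i \<and> i \<noteq> 0 then 1 else 0)" for i
    using assms by (auto simp: witt_coord_CHAR_power_mult Witt_inverse dvd_minus_self zero_power nat_dvd_not_less)
  have "1 + ?P * ?y = teich_witt 1 + ?P * ?y" by simp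
  also have "\<dots> = Witt (\<lambda>i. witt_coord (teich_witt 1) i + witt_coord (?P * ?y) i)"
    by (intro witt_add_disjoint) (auto simp: c witt_coord_teich_witt simp del: teich_witt_1)
  also have "\<dots> = ?y"
    by (auto simp: c witt_coord_teich_witt simp del: teich_witt_1 intro!: arg_cong[of _ _ Witt])
  finally show ?thesis by (simp add: algebra_simps)
qed


section \<open>Finite subfields of an algebraically closed field\<close>

lemma teich_eq: "teich a = to_fract (teich_witt a)"
  by (simp add: teich_def to_fract_def teich_witt_def)

lemma inj_teich: "inj teich"
  by (metis (no_types, lifting) injI inj_teich_witt injD teich_eq to_fract_eq_iff)

lemma teich_mult: "teich (a * b) = teich a * teich b"
  by (simp add: teich_eq teich_witt_mult)

lemma teich_0 [simp]: "teich 0 = 0" and teich_1 [simp]: "teich 1 = 1"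
  by (simp_all add: teich_eq)

lemma teich_power: "teich (a ^ n) = teich a ^ n"
  by (induction n) (simp_all add: teich_mult)

context
  fixes p b Q :: nat
  assumes p: "p = CHAR('k::{alg_closed_field, field_prime_char})" and b: "b > 0" and Q: "Q = p ^ b"
begin

lemma prime_p: "prime p"
  by (simp add: p)

lemma Q_gt_1: "Q > 1"
  using prime_gt_1_nat[OF prime_p] b Q by (metis one_less_power)

lemma Fq_iff: "(x::'k) \<in> Fq Q \<longleftrightarrow> x ^ Q = x"
  by (simp add: Fq_def)

lemma Fq_add: "x \<in> Fq Q \<Longrightarrow> y \<in> Fq Q \<Longrightarrow> x + (y::'k) \<in> Fq Q"
  using freshmans_dream'[of Q b x y] prime_p by (simp add: Fq_def p Q)

lemma Fq_mult: "x \<in> Fq Q \<Longrightarrow> y \<in> Fq Q \<Longrightarrow> x * (y::'k) \<in> Fq Q"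
  by (simp add: Fq_iff power_mult_distrib)

lemma Fq_0: "0 \<in> (Fq Q :: 'k set)" and Fq_1: "1 \<in> (Fq Q :: 'k set)"
  using Q_gt_1 by (auto simp: Fq_iff zero_power)

lemma Fq_uminus: "x \<in> Fq Q \<Longrightarrow> - (x::'k) \<in> Fq Q"
  using freshmans_dream'[of Q b x "- x"] prime_p Q_gt_1
  by (simp add: Fq_def p Q zero_power add_eq_0_iff)

lemma Fq_power: "x \<in> Fq Q \<Longrightarrow> (x::'k) ^ n \<in> Fq Q"
  by (simp add: Fq_iff flip: power_mult) (simp add: mult.commute power_mult)

lemma Fq_inverse: "x \<in> Fq Q \<Longrightarrow> inverse (x::'k) \<in> Fq Q"
  by (simp add: Fq_iff power_inverse)

lemma Fq_power_minus_1: "x \<in> Fq Q \<Longrightarrow> x \<noteq> 0 \<Longrightarrow> (x::'k) ^ (Q - 1) = 1"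
  using Q_gt_1 by (simp add: Fq_iff power_diff)

text \<open>
  \<open>X^Q - X\<close> splits into linear factors, and its derivative is \<open>- 1\<close> in characteristic \<open>p\<close>, so no root is
  multiple. This gives \<open>Q\<close> elements of the finite field.
\<close>

lemma Fq_split:
  obtains A :: "'k multiset" where "size A = Q" "set_mset A = Fq Q" "\<And>x. x \<in># A \<Longrightarrow> count A x = 1"
proof -
  define P :: "'k poly" where "P = Polynomial.monom 1 Q - Polynomial.monom 1 1"
  have deg: "degree P = Q"
    unfolding P_def using Q_gt_1 by (subst diff_conv_add_uminus, subst degree_add_eq_left) (auto simp: degree_monom_eq)
  have lc: "lead_coeff P = 1"
    unfolding deg using Q_gt_1 by (simp add: P_def)
  have P0: "P \<noteq> 0" using deg Q_gt_1 by auto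
  have poly_P: "poly P x = x ^ Q - x" for x by (simp add: P_def poly_monom)
  have "of_nat Q = (0::'k)" using b by (simp add: Q p)
  then have P': "pderiv P = - 1"
    by (simp add: P_def pderiv_diff pderiv_monom)
  obtain A where A': "size A = degree P" "P = Polynomial.smult (lead_coeff P) (\<Prod>x\<in>#A. [:-x, 1:])"
    using alg_closed_imp_factorization[OF P0] by blast
  have A: "size A = Q" using A'(1) deg by simp
  have PA: "P = (\<Prod>x\<in>#A. [:-x, 1:])" by (rule A'(2)[unfolded lc smult_1_left])
  have count: "count A x = 1" if xA: "x \<in># A" for x
  proof -
    obtain A' where A': "A = add_mset x A'" using multi_member_split[OF xA] by blast
    define R where "R = (\<Prod>x\<in>#A'. [:-x, 1:])"
    have "P = [:-x, 1:] * R" by (subst PA) (simp add: A' R_def)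
    then have "- 1 = poly (pderiv ([:-x, 1:] * R)) x" using P' by simp
    also have "\<dots> = poly R x" unfolding pderiv_mult by (simp add: pderiv_pCons)
    finally have "poly R x \<noteq> 0" by auto
    then have "x \<notin># A'" by (auto simp: R_def poly_prod_mset)
    then show ?thesis by (simp add: A' not_in_iff)
  qed
  have "x \<in># A \<longleftrightarrow> x \<in> Fq Q" for x
  proof -
    have "poly P x = (\<Prod>y\<in>#A. x - y)" by (subst PA) (simp add: poly_prod_mset)
    then have "poly P x = 0 \<longleftrightarrow> x \<in># A" by (auto simp: prod_mset_zero_iff)
    then show ?thesis by (simp add: poly_P Fq_iff)
  qed
  then show ?thesis using that A(1) count by blast
qed

lemma finite_Fq: "finite (Fq Q :: 'k set)" and card_Fq: "card (Fq Q :: 'k set) = Q"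
proof -
  obtain A :: "'k multiset" where A: "size A = Q" "set_mset A = Fq Q" "\<And>x. x \<in># A \<Longrightarrow> count A x = 1"
    using Fq_split by blast
  have "size A = sum (\<lambda>x. 1) (set_mset A)"
    unfolding size_multiset_overloaded_eq by (intro sum.cong) (auto simp: A(3))
  then show "finite (Fq Q :: 'k set)" "card (Fq Q :: 'k set) = Q"
    using A(1) unfolding A(2)[symmetric] by auto
qed

lemma Fq_generator:
  obtains g :: 'k where "g \<in> Fq Q" "g \<noteq> 0" "bij_betw (\<lambda>i. g ^ i) {..<Q - 1} (Fq Q - {0})"
proof -
  define R :: "'k ring" where "R = \<lparr>carrier = Fq Q, mult = (*), one = 1, zero = 0, add = (+)\<rparr>"
  have R [simp]: "carrier R = Fq Q" "x \<otimes>\<^bsub>R\<^esub> y = x * y" "\<one>\<^bsub>R\<^esub> = 1" "\<zero>\<^bsub>R\<^esub> = 0" "x \<oplus>\<^bsub>R\<^esub> y = x + y" for x y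
    by (simp_all add: R_def)
  have "cring R"
  proof (rule cringI)
    show "abelian_group R"
    proof (rule abelian_groupI)
      fix x assume "x \<in> carrier R"
      then show "\<exists>y\<in>carrier R. y \<oplus>\<^bsub>R\<^esub> x = \<zero>\<^bsub>R\<^esub>"
        using Fq_uminus by (intro bexI[of _ "- x"]) auto
    qed (auto simp: Fq_0 intro: Fq_add)
    show "Group.comm_monoid R"
      by (rule comm_monoidI) (auto simp: Fq_1 intro: Fq_mult)
  qed (auto simp: algebra_simps)
  then interpret R: cring R .
  interpret R: field R
  proof (rule R.cring_fieldI)
    show "Units R = carrier R - {\<zero>\<^bsub>R\<^esub>}"
    proof (intro equalityI subsetI)
      fix x assume "x \<in> carrier R - {\<zero>\<^bsub>R\<^esub>}"
      then show "x \<in> Units R"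
        using Fq_inverse by (auto simp: Units_def intro!: bexI[of _ "inverse x"])
    qed (auto simp: Units_def)
  qed
  have pow: "x [^]\<^bsub>R\<^esub> (i::nat) = x ^ i" for x i
    by (induction i) (simp_all add: nat_pow_def mult.commute)
  have "finite (carrier R)" using finite_Fq by simp
  from R.finite_field_mult_group_has_gen[OF this] obtain g where g': "g \<in> carrier (mult_of R)"
    "carrier (mult_of R) = {g [^]\<^bsub>R\<^esub> i | i::nat. i \<in> UNIV}"
    by (elim bexE) (rule that)
  have g: "g \<in> Fq Q" "g \<noteq> 0" "Fq Q - {0} = {g ^ i | i::nat. True}"
    using g' unfolding pow by simp_all
  have g1: "g ^ (Q - 1) = 1" using g Fq_power_minus_1 by blast
  have "(\<lambda>i. g ^ i) ` {..<Q - 1} = Fq Q - {0}"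
  proof (intro equalityI subsetI)
    fix x :: 'k assume "x \<in> Fq Q - {0}"
    then obtain i where x: "x = g ^ i" using g(3) by auto
    have "i = (Q - 1) * (i div (Q - 1)) + i mod (Q - 1)" by simp
    then have "x = g ^ ((Q - 1) * (i div (Q - 1)) + i mod (Q - 1))" using x by (simp only: mult_div_mod_eq)
    then have "x = g ^ (i mod (Q - 1))" by (simp only: power_add power_mult g1 power_one mult_1)
    then show "x \<in> (\<lambda>i. g ^ i) ` {..<Q - 1}" using Q_gt_1 by auto
  next
    fix x :: 'k assume "x \<in> (\<lambda>i. g ^ i) ` {..<Q - 1}"
    then show "x \<in> Fq Q - {0}" using g(1,2) Fq_power by auto
  qed
  moreover have "card (Fq Q - {0::'k}) = Q - 1" using card_Fq Fq_0 by simp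
  ultimately have "bij_betw (\<lambda>i. g ^ i) {..<Q - 1} (Fq Q - {0})"
    by (simp add: bij_betw_def eq_card_imp_inj_on)
  then show ?thesis using that g(1,2) by blast
qed

end


section \<open>Galois groups generated by Frobenius\<close>

text \<open>
  A map that is a ring homomorphism on a subring \<open>B\<close> only. The lemma lets such a map act on the
  coefficients of a polynomial that is given by its roots.
\<close>

lemma coeff_prod_linear_hom:
  fixes g :: "'i \<Rightarrow> 'a::comm_ring_1" and h :: "'a \<Rightarrow> 'a"
  assumes B: "1 \<in> B" "\<And>x y. x \<in> B \<Longrightarrow> y \<in> B \<Longrightarrow> x - y \<in> B"
      "\<And>x y. x \<in> B \<Longrightarrow> y \<in> B \<Longrightarrow> x * y \<in> B"
    and h: "h 1 = 1" "\<And>x y. x \<in> B \<Longrightarrow> y \<in> B \<Longrightarrow> h (x - y) = h x - h y"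
      "\<And>x y. x \<in> B \<Longrightarrow> y \<in> B \<Longrightarrow> h (x * y) = h x * h y"
    and I: "finite I" "\<And>i. i \<in> I \<Longrightarrow> g i \<in> B"
  shows "poly.coeff (\<Prod>i\<in>I. [:- g i, 1:]) n \<in> B \<and>
    h (poly.coeff (\<Prod>i\<in>I. [:- g i, 1:]) n) = poly.coeff (\<Prod>i\<in>I. [:- h (g i), 1:]) n"
  using I
proof (induction I arbitrary: n rule: finite_induct)
  case empty
  have "0 \<in> B" using B(1) B(2)[of 1 1] by simp
  moreover have "h 0 = 0" using h(2)[of 1 1] B(1) by simp
  ultimately show ?case using B(1) h(1) by (cases n) auto
next
  case (insert j I)
  have 0: "0 \<in> B" using B(1) B(2)[of 1 1] by simp
  have h0: "h 0 = 0" using h(2)[of 1 1] B(1) by simp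
  have step: "poly.coeff ([:- c, 1:] * R) n = (case n of 0 \<Rightarrow> 0 | Suc m \<Rightarrow> poly.coeff R m) - c * poly.coeff R n"
    for c and R :: "'a poly"
    by (simp add: coeff_pCons split: nat.split)
  show ?case
    using insert 0 h0
    by (simp only: prod.insert[OF insert.hyps] step) (auto simp: B h split: nat.split)
qed

text \<open>
  An automorphism \<open>\<sigma>\<close> over the fixed ring \<open>A\<close> of \<open>\<phi>\<close> permutes the roots of the polynomial with roots
  \<open>\<zeta>, \<phi> \<zeta>, \<phi>\<^sup>2 \<zeta>, \<dots>\<close>, because the coefficients of that polynomial are fixed by \<open>\<phi>\<close> and hence by \<open>\<sigma>\<close>.
  So \<open>\<sigma>\<close> agrees with a power of \<open>\<phi>\<close> at \<open>\<zeta>\<close>, and therefore everywhere if \<open>\<zeta>\<close> determines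
  automorphisms. This one argument serves both the residue fields and their Witt vectors.
\<close>

lemma Gal_cyclic:
  fixes B :: "'a::idom set"
  assumes B: "1 \<in> B" "\<And>x y. x \<in> B \<Longrightarrow> y \<in> B \<Longrightarrow> x + y \<in> B" "\<And>x. x \<in> B \<Longrightarrow> - x \<in> B"
      "\<And>x y. x \<in> B \<Longrightarrow> y \<in> B \<Longrightarrow> x * y \<in> B"
    and \<phi>: "\<And>x. x \<in> B \<Longrightarrow> \<phi> x \<in> B" "\<phi> 1 = 1"
      "\<And>x y. x \<in> B \<Longrightarrow> y \<in> B \<Longrightarrow> \<phi> (x + y) = \<phi> x + \<phi> y"
      "\<And>x y. x \<in> B \<Longrightarrow> y \<in> B \<Longrightarrow> \<phi> (x * y) = \<phi> x * \<phi> y"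
    and N: "N > 0" "\<And>x. x \<in> B \<Longrightarrow> (\<phi> ^^ N) x = x"
    and A: "A = {x \<in> B. \<phi> x = x}"
    and \<zeta>: "\<zeta> \<in> B" "inj_on (\<lambda>i. (\<phi> ^^ i) \<zeta>) {..<N}"
    and determined: "\<And>\<sigma> \<tau>. \<sigma> \<in> Gal B A \<Longrightarrow> \<tau> \<in> Gal B A \<Longrightarrow> \<sigma> \<zeta> = \<tau> \<zeta> \<Longrightarrow> \<sigma> = \<tau>"
  shows "bij_betw (\<lambda>i. restrict (\<phi> ^^ i) B) {..<N} (Gal B A)"
proof -
  have mem: "(\<phi> ^^ i) x \<in> B" if "x \<in> B" for i x
    by (induction i) (use that \<phi> in auto)
  have hom: "(\<phi> ^^ i) (x + y) = (\<phi> ^^ i) x + (\<phi> ^^ i) y"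
    "(\<phi> ^^ i) (x * y) = (\<phi> ^^ i) x * (\<phi> ^^ i) y" if "x \<in> B" "y \<in> B" for i x y
    by (induction i) (use that mem \<phi> in auto)
  have fixed: "(\<phi> ^^ i) x = x" if "x \<in> A" for i x
    by (induction i) (use that A in auto)
  have pow: "(\<phi> ^^ i) ((\<phi> ^^ (N - i)) x) = x" "(\<phi> ^^ (N - i)) ((\<phi> ^^ i) x) = x" if "x \<in> B" "i < N" for i x
    using that N(2)[of x] by (simp_all flip: funpow_add[THEN fun_cong, unfolded o_apply])
  have Gal: "restrict (\<phi> ^^ i) B \<in> Gal B A" if "i < N" for i
  proof -
    have "bij_betw (restrict (\<phi> ^^ i) B) B B"
      by (rule bij_betw_byWitness[where f' = "\<phi> ^^ (N - i)"]) (use mem pow that in auto)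
    then show ?thesis
      using that B A unfolding Gal_def by (auto simp: hom fixed)
  qed
  have 0: "0 \<in> B" using B(2)[OF B(1) B(3)[OF B(1)]] by simp
  have diff: "x - y \<in> B" if "x \<in> B" "y \<in> B" for x y
    using B(2)[OF that(1) B(3)[OF that(2)]] by simp
  have hom_diff: "h (x - y) = h x - h y"
    if h: "\<And>x y. x \<in> B \<Longrightarrow> y \<in> B \<Longrightarrow> h (x + y) = h x + h y" and "x \<in> B" "y \<in> B" for h :: "'a \<Rightarrow> 'a" and x y
    using h[of "x - y" y] diff that by (simp add: algebra_simps)
  have surj: "\<exists>i<N. \<sigma> = restrict (\<phi> ^^ i) B" if \<sigma>: "\<sigma> \<in> Gal B A" for \<sigma>
  proof -
    define P where "P = (\<Prod>i<N. [:- (\<phi> ^^ i) \<zeta>, 1:])"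
    have \<sigma>_hom: "\<And>x y. x \<in> B \<Longrightarrow> y \<in> B \<Longrightarrow> \<sigma> (x + y) = \<sigma> x + \<sigma> y"
      "\<And>x y. x \<in> B \<Longrightarrow> y \<in> B \<Longrightarrow> \<sigma> (x * y) = \<sigma> x * \<sigma> y" "\<And>x. x \<in> A \<Longrightarrow> \<sigma> x = x"
      using \<sigma> by (auto simp: Gal_def)
    have "1 \<in> A" using A B \<phi> by simp
    then have \<sigma>1: "\<sigma> 1 = 1" by (rule \<sigma>_hom)
    have P_map: "poly.coeff P n \<in> B \<and> h (poly.coeff P n) = poly.coeff (\<Prod>i<N. [:- h ((\<phi> ^^ i) \<zeta>), 1:]) n"
      if h: "h 1 = 1" "\<And>x y. x \<in> B \<Longrightarrow> y \<in> B \<Longrightarrow> h (x + y) = h x + h y"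
        "\<And>x y. x \<in> B \<Longrightarrow> y \<in> B \<Longrightarrow> h (x * y) = h x * h y" for h :: "'a \<Rightarrow> 'a" and n
      unfolding P_def
      by (rule coeff_prod_linear_hom) (assumption | rule B diff mem \<zeta> h hom_diff finite_lessThan)+
    have "(\<Prod>i<N. [:- \<phi> ((\<phi> ^^ i) \<zeta>), 1:]) = P"
    proof -
      obtain M where M: "N = Suc M" using N(1) gr0_implies_Suc by blast
      let ?F = "\<lambda>i. [:- (\<phi> ^^ i) \<zeta>, 1:]"
      have "(\<Prod>i<N. ?F (Suc i)) = (\<Prod>i<M. ?F (Suc i)) * ?F N"
        unfolding M by (rule prod.lessThan_Suc)
      also have "?F N = ?F 0" using N(2) \<zeta>(1) by simp
      also have "(\<Prod>i<M. ?F (Suc i)) * ?F 0 = P"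
        unfolding P_def M by (subst prod.lessThan_Suc_shift) (rule mult.commute)
      finally show ?thesis by simp
    qed
    then have "\<phi> (poly.coeff P n) = poly.coeff P n" "poly.coeff P n \<in> B" for n
      using P_map[of \<phi> n, OF \<phi>(2-4)] by (simp_all only:)
    then have "\<sigma> (poly.coeff P n) = poly.coeff P n" for n
      using \<sigma>_hom(3) A by blast
    then have "P = (\<Prod>i<N. [:- \<sigma> ((\<phi> ^^ i) \<zeta>), 1:])"
      using P_map[of \<sigma>, OF \<sigma>1 \<sigma>_hom(1,2)] by (intro poly_eqI) (simp only:)
    then have "poly P (\<sigma> \<zeta>) = (\<Prod>i<N. \<sigma> \<zeta> - \<sigma> ((\<phi> ^^ i) \<zeta>))"
      by (simp add: poly_prod)
    also have "\<dots> = 0" using N(1) by (intro prod_zero bexI[of _ 0]) auto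
    finally have "(\<Prod>i<N. \<sigma> \<zeta> - (\<phi> ^^ i) \<zeta>) = 0" by (simp add: P_def poly_prod)
    then obtain i where i: "i < N" "\<sigma> \<zeta> = (\<phi> ^^ i) \<zeta>" by (auto simp: prod_zero_iff)
    then have "\<sigma> = restrict (\<phi> ^^ i) B"
      using \<zeta>(1) by (intro determined[OF \<sigma> Gal]) auto
    then show ?thesis using i by blast
  qed
  have "inj_on (\<lambda>i. restrict (\<phi> ^^ i) B) {..<N}"
  proof (rule inj_onI)
    fix i j assume "i \<in> {..<N}" "j \<in> {..<N}" "restrict (\<phi> ^^ i) B = restrict (\<phi> ^^ j) B"
    then show "i = j"
      using \<zeta> by (metis inj_onD restrict_apply)
  qed
  then show ?thesis
    unfolding bij_betw_def using Gal surj by auto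
qed

lemma Gal_hom_power:
  assumes "\<sigma> \<in> Gal B A" "1 \<in> A" "x \<in> B" "\<And>i. x ^ i \<in> B"
  shows "\<sigma> (x ^ i) = \<sigma> x ^ i"
  by (induction i) (use assms in \<open>auto simp: Gal_def\<close>)

lemma funpow_power: "((\<lambda>x::'a::monoid_mult. x ^ n) ^^ i) x = x ^ (n ^ i)"
  by (induction i) (simp_all add: power_mult power_Suc2 del: power_Suc)

text \<open>
  The exponents \<open>q^i\<close> with \<open>i < k\<close> are distinct and, unless \<open>k = 1\<close>, smaller than the order \<open>q^k - 1\<close> of
  a generator \<open>g\<close>.
\<close>

lemma generator_conjugates_inj:
  assumes "inj_on (\<lambda>i. g ^ i) {..<(q::nat) ^ k - 1}" "q > 1"
  shows "inj_on (\<lambda>i. g ^ (q ^ i)) {..<k}"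
proof (cases "k \<le> 1")
  case True
  then show ?thesis by (auto intro!: inj_onI)
next
  case False
  have "q ^ i \<in> {..<q ^ k - 1}" if "i < k" for i
  proof -
    obtain m where m: "k = Suc m" "m > 0" using False by (cases k) auto
    have "q ^ i \<le> q ^ m" using that m assms(2) by (intro power_increasing) auto
    moreover have "q ^ m > 1" using m assms(2) by (intro one_less_power)
    moreover have "2 * q ^ m \<le> q ^ k" using assms(2) m by simp
    ultimately show ?thesis by simp
  qed
  then have "(\<lambda>i. q ^ i) ` {..<k} \<subseteq> {..<q ^ k - 1}" by auto
  moreover have "inj_on (\<lambda>i. q ^ i) {..<k}"
    using assms(2) by (auto intro!: inj_onI dest: power_inject_exp[THEN iffD1, rotated])
  ultimately show ?thesis
    using comp_inj_on[of "\<lambda>i. q ^ i" "{..<k}" "\<lambda>i. g ^ i"] inj_on_subset[OF assms(1)] by (simp add: o_def)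
qed

text \<open>
  A generator of the multiplicative group determines every automorphism of the field, so it can play
  the part of \<open>\<zeta>\<close> in \<open>Gal_cyclic\<close>.
\<close>

lemma Norm_Fq:
  fixes x :: "'k::{alg_closed_field, field_prime_char}"
  assumes q: "q = CHAR('k) ^ a" "a > 0" and k: "k > 0" and x: "x \<in> Fq (q ^ k)"
  shows "Norm (Fq (q ^ k)) (Fq q) x = x ^ (\<Sum>i<k. q ^ i)"
proof -
  let ?Q = "q ^ k"
  have Q: "?Q = CHAR('k) ^ (a * k)" "a * k > 0" using assms by (simp_all add: power_mult)
  have q1: "q > 1" using Q_gt_1[OF refl q(2,1)] .
  note [intro] = Fq_add[OF refl Q(2,1)] Fq_mult[OF refl Q(2,1)] Fq_uminus[OF refl Q(2,1)] Fq_1[OF refl Q(2,1)] Fq_0[OF refl Q(2,1)]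
     Fq_power[OF refl Q(2,1)]
  obtain g :: 'k where g: "g \<in> Fq ?Q" "g \<noteq> 0" "bij_betw (\<lambda>i. g ^ i) {..<?Q - 1} (Fq ?Q - {0})"
    using Fq_generator[OF refl Q(2,1)] by blast
  let ?\<phi> = "\<lambda>x::'k. x ^ q"
  have "bij_betw (\<lambda>i. restrict (?\<phi> ^^ i) (Fq ?Q)) {..<k} (Gal (Fq ?Q) (Fq q))"
  proof (rule Gal_cyclic[where \<zeta> = g])
    show "(x + y) ^ q = x ^ q + y ^ q" for x y :: 'k
      using freshmans_dream'[of q a x y] by (simp add: q)
    show "(?\<phi> ^^ k) x = x" if "x \<in> Fq ?Q" for x
      using that by (simp add: funpow_power Fq_def)
    have "(?\<phi> ^^ k) x = x" if "x ^ q = x" for x :: 'k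
      by (induction k) (simp_all add: that)
    then have fixk: "x ^ (q ^ k) = x" if "x ^ q = x" for x :: 'k using that by (simp add: funpow_power)
    show "Fq q = {x \<in> Fq ?Q. x ^ q = (x :: 'k)}"
      unfolding Fq_def mem_Collect_eq by (rule Collect_cong) (rule iffI, rule conjI, erule fixk, assumption, erule conjunct2)
    show "inj_on (\<lambda>i. (?\<phi> ^^ i) g) {..<k}"
      using generator_conjugates_inj[of g q k] g(3) q1 by (simp add: bij_betw_def funpow_power)
    show "\<sigma> = \<tau>" if \<sigma>: "\<sigma> \<in> Gal (Fq ?Q) (Fq q)" and \<tau>: "\<tau> \<in> Gal (Fq ?Q) (Fq q)" and eq: "\<sigma> g = \<tau> g" for \<sigma> \<tau>
    proof (rule extensionalityI)
      show "\<sigma> \<in> extensional (Fq ?Q)" "\<tau> \<in> extensional (Fq ?Q)" using \<sigma> \<tau> by (auto simp: Gal_def)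
      fix x :: 'k assume x: "x \<in> Fq ?Q"
      have 1: "1 \<in> (Fq q :: 'k set)" "0 \<in> (Fq q :: 'k set)" using q1 by (auto simp: Fq_def)
      show "\<sigma> x = \<tau> x"
      proof (cases "x = 0")
        case True
        then show ?thesis using 1 \<sigma> \<tau> by (auto simp: Gal_def)
      next
        case False
        then obtain i where "x = g ^ i" using g(3) x by (auto simp: bij_betw_def)
        then show ?thesis
          using Gal_hom_power[OF \<sigma> 1(1) g(1) Fq_power[OF refl Q(2,1) g(1)], of i]
            Gal_hom_power[OF \<tau> 1(1) g(1) Fq_power[OF refl Q(2,1) g(1)], of i] eq by simp
      qed
    qed
  qed (use g k q1 in \<open>auto simp: power_mult_distrib\<close>)
  then have "(\<Prod>\<sigma>\<in>Gal (Fq ?Q) (Fq q). \<sigma> x) = (\<Prod>i<k. restrict (?\<phi> ^^ i) (Fq ?Q) x)"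
    by (rule prod.reindex_bij_betw[symmetric, where g = "\<lambda>\<sigma>. \<sigma> x"])
  also have "\<dots> = x ^ (\<Sum>i<k. q ^ i)"
    using x by (simp add: funpow_power power_sum)
  finally show ?thesis by (simp add: Norm_def)
qed


section \<open>Frobenius on unramified extensions\<close>

text \<open>
  This description as a fixed ring of a ring homomorphism makes it obvious that \<open>Zq\<close> is a subring.
\<close>

lemma Zq_iff:
  fixes w :: "'k::{alg_closed_field, field_prime_char} witt"
  shows "to_fract w \<in> Zq (CHAR('k) ^ b) \<longleftrightarrow> (witt_frob ^^ b) w = w"
  unfolding Zq_def to_fract_def[symmetric]
  by (auto simp: Fq_def image_iff witt_coord_frob_funpow[symmetric] intro: witt_eqI)

lemma Zq_cases:
  assumes "x \<in> Zq Q"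
  obtains w where "x = to_fract w" "\<And>i. witt_coord w i \<in> Fq Q"
  using assms unfolding Zq_def to_fract_def[symmetric] by blast

lemma witt_frob_funpow_hom:
  "(witt_frob ^^ b) (x + y) = (witt_frob ^^ b) x + (witt_frob ^^ b) y"
  "(witt_frob ^^ b) (x * y) = (witt_frob ^^ b) x * (witt_frob ^^ b) y"
  "(witt_frob ^^ b) 0 = 0" "(witt_frob ^^ b) 1 = (1 :: 'a::comm_ring_prime_char witt)"
  by (induction b) (simp_all add: witt_frob_add witt_frob_mult)

lemma witt_frob_of_nat: "witt_frob (of_nat n) = (of_nat n :: 'a::comm_ring_prime_char witt)"
  by (induction n) (simp_all add: witt_frob_add)

text \<open>
  Frobenius of the Witt vectors, transported to their image in the field of fractions; only the values
  on this image are meaningful.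
\<close>

definition fract_frob :: "'k::{alg_closed_field, field_prime_char} witt fract \<Rightarrow> 'k witt fract" where
  "fract_frob x = to_fract (witt_frob (inv_into UNIV to_fract x))"

lemma fract_frob_to_fract [simp]: "fract_frob (to_fract w) = to_fract (witt_frob w)"
  by (simp add: fract_frob_def inv_f_f inj_def)

lemma fract_frob_funpow [simp]: "(fract_frob ^^ i) (to_fract w) = to_fract ((witt_frob ^^ i) w)"
  by (induction i) simp_all

lemma fract_frob_teich: "fract_frob (teich a) = teich (a ^ CHAR('k))"
  for a :: "'k::{alg_closed_field, field_prime_char}"
  by (simp add: teich_eq witt_frob_teich_witt)

lemma fract_frob_funpow_teich: "(fract_frob ^^ i) (teich a) = teich (a ^ (CHAR('k) ^ i))"
  for a :: "'k::{alg_closed_field, field_prime_char}"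
  by (induction i) (simp_all add: fract_frob_teich power_mult power_Suc2 del: power_Suc)

lemma to_fract_of_nat [simp]: "to_fract (of_nat n) = of_nat n"
  by (induction n) simp_all

lemma to_fract_power: "to_fract (x ^ n) = to_fract x ^ n"
  by (induction n) simp_all

lemma fract_frob_0_1 [simp]: "fract_frob 0 = (0 :: 'k::{alg_closed_field, field_prime_char} witt fract)" "fract_frob 1 = (1 :: 'k witt fract)"
  using fract_frob_to_fract[of "0 :: 'k witt"] fract_frob_to_fract[of "1 :: 'k witt"] by simp_all

context
  fixes p b Q :: nat
  assumes p: "p = CHAR('k::{alg_closed_field, field_prime_char})" and b: "b > 0" and Q: "Q = p ^ b"
begin

lemma Zq_iff': "to_fract (w :: 'k witt) \<in> Zq Q \<longleftrightarrow> (witt_frob ^^ b) w = w"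
  by (simp add: Q p Zq_iff)

lemma Zq_obtain:
  assumes "(x :: 'k witt fract) \<in> Zq Q"
  obtains w where "x = to_fract w" "(witt_frob ^^ b) w = w"
  using assms Zq_cases Zq_iff' by metis

lemma Zq_add: "x \<in> Zq Q \<Longrightarrow> y \<in> Zq Q \<Longrightarrow> x + (y :: 'k witt fract) \<in> Zq Q"
  by (elim Zq_obtain) (simp add: Zq_iff' witt_frob_funpow_hom flip: to_fract_add)

lemma Zq_mult: "x \<in> Zq Q \<Longrightarrow> y \<in> Zq Q \<Longrightarrow> x * (y :: 'k witt fract) \<in> Zq Q"
  by (elim Zq_obtain) (simp add: Zq_iff' witt_frob_funpow_hom flip: to_fract_mult)

lemma Zq_0: "0 \<in> (Zq Q :: 'k witt fract set)" and Zq_1: "1 \<in> (Zq Q :: 'k witt fract set)"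
  using Zq_iff'[of 0] Zq_iff'[of 1] by (simp_all add: witt_frob_funpow_hom)

lemma Zq_uminus: "x \<in> Zq Q \<Longrightarrow> - (x :: 'k witt fract) \<in> Zq Q"
proof (elim Zq_obtain)
  fix w assume w: "x = to_fract w" "(witt_frob ^^ b) w = w"
  have "(witt_frob ^^ b) (- w) + (witt_frob ^^ b) w = 0"
    by (simp add: witt_frob_funpow_hom flip: witt_frob_funpow_hom(1))
  then have "(witt_frob ^^ b) (- w) = - w" using w(2) by (simp add: add_eq_0_iff2)
  then show ?thesis using w(1) Zq_iff'[of "- w"] by simp
qed

lemma Zq_diff: "x \<in> Zq Q \<Longrightarrow> y \<in> Zq Q \<Longrightarrow> x - (y :: 'k witt fract) \<in> Zq Q"
  using Zq_add[of x "- y"] Zq_uminus[of y] by simp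

lemma Zq_sum: "(\<And>i. i \<in> I \<Longrightarrow> f i \<in> Zq Q) \<Longrightarrow> (\<Sum>i\<in>I. f i :: 'k witt fract) \<in> Zq Q"
  by (induction I rule: infinite_finite_induct) (auto simp: Zq_0 Zq_add)

lemma Zq_of_nat: "of_nat n \<in> (Zq Q :: 'k witt fract set)"
  by (induction n) (auto simp: Zq_0 Zq_1 Zq_add)

lemma Zq_of_int: "of_int n \<in> (Zq Q :: 'k witt fract set)"
  using Zq_of_nat Zq_uminus by (cases n rule: int_cases2) auto

lemma Zq_power: "x \<in> Zq Q \<Longrightarrow> (x :: 'k witt fract) ^ n \<in> Zq Q"
  by (induction n) (auto simp: Zq_1 Zq_mult)

lemma Zq_prod: "(\<And>i. i \<in> I \<Longrightarrow> f i \<in> Zq Q) \<Longrightarrow> (\<Prod>i\<in>I. f i :: 'k witt fract) \<in> Zq Q"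
  by (induction I rule: infinite_finite_induct) (auto simp: Zq_1 Zq_mult)

lemma teich_in_Zq: "a \<in> Fq Q \<Longrightarrow> teich (a :: 'k) \<in> Zq Q"
  using Q_gt_1[OF p b Q] unfolding Zq_def teich_def
  by (intro imageI) (auto simp: Witt_inverse Fq_def zero_power)

lemma fract_frob_Zq:
  fixes x y :: "'k witt fract"
  assumes "x \<in> Zq Q"
  shows "fract_frob x \<in> Zq Q" "(fract_frob ^^ b) x = x"
    "y \<in> Zq Q \<Longrightarrow> fract_frob (x + y) = fract_frob x + fract_frob y"
    "y \<in> Zq Q \<Longrightarrow> fract_frob (x * y) = fract_frob x * fract_frob y"
proof -
  obtain w where w: "x = to_fract w" "(witt_frob ^^ b) w = w" using Zq_obtain assms by blast
  have "(witt_frob ^^ b) (witt_frob w) = witt_frob w"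
    using w(2) by (metis funpow_swap1)
  then show "fract_frob x \<in> Zq Q" "(fract_frob ^^ b) x = x" using w by (auto simp: Zq_iff')
  assume "y \<in> Zq Q"
  then obtain v where v: "y = to_fract v" using Zq_obtain by blast
  show "fract_frob (x + y) = fract_frob x + fract_frob y"
    using w v by (simp add: witt_frob_add flip: to_fract_add)
  show "fract_frob (x * y) = fract_frob x * fract_frob y"
    using w v by (simp add: witt_frob_mult flip: to_fract_mult)
qed

lemma Zp_eq: "Zq p = {x \<in> Zq Q. fract_frob x = (x :: 'k witt fract)}"
proof -
  have 1: "x \<in> Zq p \<longleftrightarrow> x \<in> Zq Q \<and> fract_frob x = x" if "x = to_fract w" for x and w :: "'k witt"
  proof -
    have "witt_frob w = w \<Longrightarrow> (witt_frob ^^ b) w = w" by (induction b) auto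
    then show ?thesis
      using Zq_iff[of w 1] Zq_iff[of w b] that by (auto simp: p Q)
  qed
  have "x \<in> Zq p \<longleftrightarrow> x \<in> Zq Q \<and> fract_frob x = x" for x :: "'k witt fract"
    using 1 Zq_cases by metis
  then show ?thesis by auto
qed

text \<open>
  The residue field is perfect: \<open>c^(p^(b-1))\<close> is a \<open>p\<close>-th root of \<open>c\<close>.
\<close>

lemma Zq_residue_decompose:
  assumes "to_fract (w :: 'k witt) \<in> Zq Q"
  obtains y where "y \<in> Zq Q" "witt_coord w 0 \<in> Fq Q" "to_fract w = teich (witt_coord w 0) + of_nat p * y"
proof -
  obtain w' where "to_fract w = to_fract w'" "\<And>i. witt_coord w' i \<in> Fq Q" using Zq_cases assms by blast
  then have w: "witt_coord w i \<in> Fq Q" for i by (simp only: to_fract_eq_iff)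
  define y where "y i = witt_coord w (Suc i) ^ (p ^ (b - 1))" for i
  have "y i ^ p = witt_coord w (Suc i)" for i
    using w[of "Suc i"] b unfolding y_def power_mult[symmetric] power_Suc2[symmetric]
    by (simp add: Q Fq_def)
  then have "w = teich_witt (witt_coord w 0) + of_nat p * Witt y"
    using witt_decompose[of y w] by (simp add: p)
  moreover have "to_fract (Witt y) \<in> Zq Q"
    unfolding Zq_def to_fract_def[symmetric]
    by (intro imageI) (use w Fq_power[OF p b Q] in \<open>auto simp: Witt_inverse y_def\<close>)
  ultimately show ?thesis
    using w that[of "to_fract (Witt y)"]
    by (metis teich_eq to_fract_add to_fract_mult to_fract_of_nat)
qed

lemma Zq_p_divisible_eq_0:
  assumes "\<And>m. \<exists>y\<in>Zq Q. x = of_nat p ^ m * (y :: 'k witt fract)"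
  shows "x = 0"
proof -
  have "x \<in> Zq Q" using assms[of 0] by auto
  then obtain w where w: "x = to_fract w" by (rule Zq_cases)
  have "witt_coord w i = 0" for i
  proof -
    obtain y where y: "y \<in> Zq Q" "x = of_nat p ^ Suc i * y" using assms by blast
    obtain v where "y = to_fract v" using y(1) by (rule Zq_cases)
    then have "to_fract w = to_fract (of_nat p ^ Suc i * v)"
      using y(2) w by (simp only: to_fract_mult to_fract_of_nat to_fract_power)
    then have "w = of_nat p ^ Suc i * v" by (simp only: to_fract_eq_iff)
    then show ?thesis using witt_coord_CHAR_power_mult[of "Suc i" v i] by (simp add: p)
  qed
  then show ?thesis using w witt_eqI[of w 0] by (simp add: witt_coord_0)
qed

text \<open>
  Take for \<open>\<zeta>\<close> a generator of the group of roots of unity. Two automorphisms that agree at \<open>\<zeta>\<close> agree on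
  all Teichmueller representatives. By the \<open>p\<close>-adic expansion, their values at any \<open>x\<close> then differ by
  multiples of arbitrarily high powers of \<open>p\<close>, hence not at all.
\<close>

lemma Tr_Zq:
  assumes x: "(x :: 'k witt fract) \<in> Zq Q"
  shows "Tr (Zq Q) (Zq p) x = (\<Sum>i<b. (fract_frob ^^ i) x)"
proof -
  obtain g :: 'k where g: "g \<in> Fq Q" "g \<noteq> 0" "bij_betw (\<lambda>i. g ^ i) {..<Q - 1} (Fq Q - {0})"
    using Fq_generator[OF p b Q] by blast
  have 1: "1 \<in> (Zq p :: 'k witt fract set)"
    unfolding Zp_eq by (simp add: Zq_1)
  have "bij_betw (\<lambda>i. restrict (fract_frob ^^ i) (Zq Q)) {..<b} (Gal (Zq Q) (Zq p :: 'k witt fract set))"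
  proof (rule Gal_cyclic[where \<zeta> = "teich g"])
    have p1: "p > 1" using prime_gt_1_nat[OF prime_p[OF p b Q]] .
    have "inj_on (\<lambda>i. g ^ (p ^ i)) {..<b}"
      using generator_conjugates_inj[of g p b] g(3) p1 by (simp add: bij_betw_def Q)
    then show "inj_on (\<lambda>i. (fract_frob ^^ i) (teich g)) {..<b}"
      unfolding fract_frob_funpow_teich p[symmetric]
      using comp_inj_on[OF _ inj_on_subset[OF inj_teich]] by (fastforce simp: o_def)
    show "\<sigma> = \<tau>" if \<sigma>: "\<sigma> \<in> Gal (Zq Q) (Zq p)" and \<tau>: "\<tau> \<in> Gal (Zq Q) (Zq p)"
      and eq: "\<sigma> (teich g) = \<tau> (teich g)" for \<sigma> \<tau> :: "'k witt fract \<Rightarrow> _"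
    proof (rule extensionalityI)
      show "\<sigma> \<in> extensional (Zq Q)" "\<tau> \<in> extensional (Zq Q)" using \<sigma> \<tau> by (auto simp: Gal_def)
      have "0 \<in> (Zq p :: 'k witt fract set)" "of_nat p \<in> (Zq p :: 'k witt fract set)"
        unfolding Zp_eq using fract_frob_to_fract[of "of_nat p :: 'k witt"]
        by (simp_all add: Zq_0 Zq_of_nat witt_frob_of_nat del: fract_frob_to_fract)
      note fixed = this
      note hom = \<sigma>[unfolded Gal_def] \<tau>[unfolded Gal_def]
      have teich: "\<sigma> (teich a) = \<tau> (teich a)" if a: "a \<in> Fq Q" for a
      proof (cases "a = 0")
        case True
        then show ?thesis using fixed hom by auto
      next
        case False
        then obtain i where "a = g ^ i" using g(3) a by (auto simp: bij_betw_def)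
        then show ?thesis
          using Gal_hom_power[OF \<sigma> 1 teich_in_Zq[OF g(1)] Zq_power[OF teich_in_Zq[OF g(1)]], of i]
            Gal_hom_power[OF \<tau> 1 teich_in_Zq[OF g(1)] Zq_power[OF teich_in_Zq[OF g(1)]], of i] eq
          by (simp add: teich_power)
      qed
      have "\<exists>z\<in>Zq Q. \<sigma> x - \<tau> x = of_nat p ^ m * z" if "x \<in> Zq Q" for m x
        using that
      proof (induction m arbitrary: x)
        case 0
        then have "\<sigma> x - \<tau> x \<in> Zq Q" using hom by (intro Zq_diff) (auto simp: bij_betw_def)
        then show ?case by auto
      next
        case (Suc m)
        obtain a y where ay: "a \<in> Fq Q" "y \<in> Zq Q" "x = teich a + of_nat p * y"
          using Zq_cases Zq_residue_decompose Suc.prems by metis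
        have *: "h x = h (teich a) + of_nat p * h y" if h: "h \<in> Gal (Zq Q) (Zq p)" for h
        proof -
          have "h x = h (teich a) + h (of_nat p * y)"
            using h ay teich_in_Zq Zq_mult Zq_of_nat by (simp add: Gal_def)
          also have "h (of_nat p * y) = of_nat p * h y"
            using h ay Zq_of_nat fixed by (simp add: Gal_def)
          finally show ?thesis .
        qed
        obtain z where "z \<in> Zq Q" "\<sigma> y - \<tau> y = of_nat p ^ m * z" using Suc.IH ay by blast
        then have "\<sigma> x - \<tau> x = of_nat p ^ Suc m * z"
          using *[OF \<sigma>] *[OF \<tau>] teich[OF ay(1)] by (simp add: mult.assoc flip: right_diff_distrib)
        then show ?case using \<open>z \<in> Zq Q\<close> by blast
      qed
      then show "\<sigma> x = \<tau> x" if "x \<in> Zq Q" for x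
        using Zq_p_divisible_eq_0[of "\<sigma> x - \<tau> x"] that by auto
    qed
  qed (use b fract_frob_Zq Zp_eq teich_in_Zq[OF g(1)] in \<open>auto simp: Zq_1 Zq_add Zq_mult Zq_uminus\<close>)
  then have "(\<Sum>\<sigma>\<in>Gal (Zq Q) (Zq p). \<sigma> x) = (\<Sum>i<b. restrict (fract_frob ^^ i) (Zq Q) x)"
    by (rule sum.reindex_bij_betw[symmetric, where g = "\<lambda>\<sigma>. \<sigma> x"])
  then show ?thesis using x by (simp add: Tr_def)
qed

end


section \<open>Roots of unity and \<open>p\<close>-adic integrality\<close>

lemma roots_of_unity_card:
  fixes n :: nat
  assumes "n > 0"
  shows "finite {x :: 'a::idom. x ^ n = 1}" "card {x :: 'a. x ^ n = 1} \<le> n"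
proof -
  define P :: "'a poly" where "P = Polynomial.monom 1 n - 1"
  have P: "poly P x = 0 \<longleftrightarrow> x ^ n = 1" for x by (simp add: P_def poly_monom)
  have "poly.coeff P n = 1" using assms by (simp add: P_def)
  then have "P \<noteq> 0" by auto
  moreover have "degree P \<le> n"
    unfolding P_def by (rule degree_diff_le) (auto simp: degree_monom_le)
  ultimately show "finite {x :: 'a. x ^ n = 1}" "card {x :: 'a. x ^ n = 1} \<le> n"
    using poly_roots_finite[of P] card_poly_roots_bound[of P] P by auto
qed

context
  fixes p b Q :: nat
  assumes p: "p = CHAR('k::{alg_closed_field, field_prime_char})" and b: "b > 0" and Q: "Q = p ^ b"
begin

text \<open>
  The Teichmueller representatives are \<open>Q - 1\<close> roots of unity of order dividing \<open>Q - 1\<close>, and a field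
  contains no more than these.
\<close>

lemma mu_eq: "mu Q = teich ` (Fq Q - {0 :: 'k})"
  and mu_eq_roots: "mu Q = {x :: 'k witt fract. x ^ (Q - 1) = 1}"
proof -
  let ?U = "{x :: 'k witt fract. x ^ (Q - 1) = 1}"
  have Q1: "Q - 1 > 0" using Q_gt_1[OF p b Q] by simp
  have T: "teich ` (Fq Q - {0 :: 'k}) \<subseteq> mu Q"
    using teich_in_Zq[OF p b Q] Fq_power_minus_1[OF p b Q]
    by (auto simp: mu_def simp flip: teich_power)
  have "card (Fq Q - {0 :: 'k}) = Q - 1"
    using card_Fq[OF p b Q] Fq_0[OF p b Q] by simp
  then have "card (teich ` (Fq Q - {0 :: 'k})) = Q - 1"
    by (subst card_image) (simp_all add: inj_on_subset[OF inj_teich])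
  moreover have U: "mu Q \<subseteq> ?U" by (auto simp: mu_def)
  moreover note roots_of_unity_card[OF Q1, where 'a = "'k witt fract"]
  ultimately have eq: "teich ` (Fq Q - {0 :: 'k}) = ?U"
    using T by (intro card_seteq) auto
  show "mu Q = teich ` (Fq Q - {0 :: 'k})" by (rule subset_antisym[OF _ T]) (unfold eq, rule U)
  then show "mu Q = ?U" by (simp only: eq)
qed

lemma finite_mu: "finite (mu Q :: 'k witt fract set)"
  unfolding mu_eq using finite_Fq[OF p b Q] by simp

lemma mu_generator:
  obtains \<zeta> :: "'k witt fract" where "\<zeta> \<noteq> 0" "bij_betw (\<lambda>i. \<zeta> ^ i) {..<Q - 1} (mu Q)" "\<zeta> \<in> mu Q"
proof -
  obtain g :: 'k where g: "g \<in> Fq Q" "g \<noteq> 0" "bij_betw (\<lambda>i. g ^ i) {..<Q - 1} (Fq Q - {0})"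
    using Fq_generator[OF p b Q] by blast
  have "bij_betw teich (Fq Q - {0 :: 'k}) (mu Q)"
    unfolding mu_eq using inj_on_subset[OF inj_teich] by (auto simp: bij_betw_def)
  from bij_betw_trans[OF g(3) this] have "bij_betw (\<lambda>i. teich g ^ i) {..<Q - 1} (mu Q)"
    by (simp add: o_def teich_power)
  moreover have "teich g \<noteq> 0"
    using g(2) inj_teich by (metis injD teich_0)
  ultimately show ?thesis using that[of "teich g"] g by (auto simp: mu_eq)
qed

lemma mu_nonzero: "x \<in> mu Q \<Longrightarrow> (x :: 'k witt fract) \<noteq> 0"
  using Q_gt_1[OF p b Q] by (auto simp: mu_def zero_power)

lemma mu_mult: "x \<in> mu Q \<Longrightarrow> y \<in> mu Q \<Longrightarrow> x * (y :: 'k witt fract) \<in> mu Q"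
  using Zq_mult[OF p b Q] by (auto simp: mu_def power_mult_distrib)

lemma mu_power: "x \<in> mu Q \<Longrightarrow> (x :: 'k witt fract) ^ n \<in> mu Q"
  using Zq_power[OF p b Q] by (auto simp: mu_def power_commuting_commutes power_mult[symmetric])
    (simp add: mult.commute[of n] power_mult)

lemma mu_power_Q: "x \<in> mu Q \<Longrightarrow> (x :: 'k witt fract) ^ Q = x"
proof -
  assume x: "x \<in> mu Q"
  have "x ^ Q = x * x ^ (Q - 1)" using Q_gt_1[OF p b Q] by (simp flip: power_Suc)
  then show ?thesis using x by (simp add: mu_def)
qed

lemma mu_inverse: "x \<in> mu Q \<Longrightarrow> inverse (x :: 'k witt fract) \<in> mu Q"
proof -
  assume x: "x \<in> mu Q"
  have "x * x ^ (Q - 2) = x ^ (Q - 1)"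
    using Q_gt_1[OF p b Q] by (simp flip: power_Suc add: Suc_diff_Suc numeral_2_eq_2)
  then have "inverse x = x ^ (Q - 2)"
    using x by (intro inverse_unique) (simp add: mu_def)
  then show ?thesis using mu_power[OF x] by simp
qed

lemma mu_powi: "x \<in> mu Q \<Longrightarrow> (x :: 'k witt fract) powi n \<in> mu Q"
  using mu_power mu_inverse by (cases n rule: int_cases4) (auto simp: power_int_def)

text \<open>
  The hypothesis says that \<open>\<zeta>\<close> generates the group of roots of unity.
\<close>

lemma mu_power_eq_1_iff:
  assumes "bij_betw (\<lambda>i. (\<zeta> :: 'k witt fract) ^ i) {..<Q - 1} (mu Q)" "\<zeta> \<in> mu Q"
  shows "\<zeta> powi n = 1 \<longleftrightarrow> int (Q - 1) dvd n"
proof -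
  let ?m = "int (Q - 1)"
  have Q1: "?m > 0" using Q_gt_1[OF p b Q] by simp
  have nz: "\<zeta> \<noteq> 0" using mu_nonzero assms by blast
  have 1: "\<zeta> powi (?m * j) = 1" for j
    using assms(2) by (simp add: power_int_mult mu_def)
  have "\<zeta> powi n = \<zeta> powi (?m * (n div ?m) + n mod ?m)" by simp
  also have "\<dots> = \<zeta> powi (n mod ?m)"
    using nz 1[of "n div ?m"] by (subst power_int_add) (simp_all del: of_nat_diff)
  also have "\<dots> = \<zeta> ^ nat (n mod ?m)"
    using Q1 by (simp add: power_int_def)
  finally have "\<zeta> powi n = 1 \<longleftrightarrow> \<zeta> ^ nat (n mod ?m) = \<zeta> ^ 0" by simp
  also have "\<dots> \<longleftrightarrow> nat (n mod ?m) = 0"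
  proof -
    have "nat (n mod ?m) < Q - 1" using Q1 by (simp add: nat_less_iff)
    then show ?thesis
      using assms(1) inj_on_eq_iff[of "\<lambda>i. \<zeta> ^ i" "{..<Q - 1}" "nat (n mod ?m)" 0] Q1
      by (auto simp: bij_betw_def)
  qed
  also have "\<dots> \<longleftrightarrow> ?m dvd n"
    using pos_mod_sign[OF Q1, of n] unfolding dvd_eq_mod_eq_0 by linarith
  finally show ?thesis .
qed

text \<open>
  Orthogonality of characters: multiplying \<open>y\<close> by a generator \<open>\<zeta>\<close> permutes the group and multiplies
  the sum by \<open>\<zeta> powi n\<close>.
\<close>

lemma sum_mu_powi:
  "(\<Sum>y\<in>mu Q. (y :: 'k witt fract) powi n) = (if int (Q - 1) dvd n then of_nat (Q - 1) else 0)"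
proof -
  obtain \<zeta> :: "'k witt fract" where \<zeta>: "\<zeta> \<noteq> 0" "bij_betw (\<lambda>i. \<zeta> ^ i) {..<Q - 1} (mu Q)" "\<zeta> \<in> mu Q"
    using mu_generator by blast
  have card: "card (mu Q :: 'k witt fract set) = Q - 1"
    using bij_betw_same_card[OF \<zeta>(2)] by simp
  show ?thesis
  proof (cases "int (Q - 1) dvd n")
    case True
    have "y powi n = 1" if "y \<in> mu Q" for y :: "'k witt fract"
      using True that by (auto simp: power_int_mult mu_def elim!: dvdE)
    then show ?thesis using True card by simp
  next
    case False
    have "bij_betw (\<lambda>y. \<zeta> * y) (mu Q) (mu Q)"
      using \<zeta>(1,3) mu_mult mu_inverse
      by (intro bij_betw_byWitness[where f' = "\<lambda>y. inverse \<zeta> * y"]) (auto simp flip: mult.assoc)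
    from sum.reindex_bij_betw[OF this, of "\<lambda>y. y powi n"]
    have "\<zeta> powi n * (\<Sum>y\<in>mu Q. y powi n) = (\<Sum>y\<in>mu Q. y powi n)"
      by (simp add: power_int_mult_distrib sum_distrib_left)
    then have "(\<zeta> powi n - 1) * (\<Sum>y\<in>mu Q. y powi n) = 0" by (simp add: algebra_simps)
    moreover have "\<zeta> powi n \<noteq> 1" using mu_power_eq_1_iff[OF \<zeta>(2,3)] False by blast
    ultimately show ?thesis using False by simp
  qed
qed

lemma finite_mu_vec: "finite {x :: 'k witt fract ^ 'n. \<forall>i. x $ i \<in> mu Q}"
  and sum_mu_vec_powi:
  "(\<Sum>x\<in>{x :: 'k witt fract ^ 'n. \<forall>i. x $ i \<in> mu Q}. \<Prod>i\<in>UNIV. x $ i powi (w $ i)) =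
    (if \<forall>i. int (Q - 1) dvd w $ i then of_nat (Q - 1) ^ CARD('n) else 0)"
proof -
  let ?X = "{x :: 'k witt fract ^ 'n. \<forall>i. x $ i \<in> mu Q}" and ?Y = "PiE (UNIV :: 'n set) (\<lambda>_. mu Q :: 'k witt fract set)"
  have bij: "bij_betw vec_lambda ?Y ?X"
    by (rule bij_betw_byWitness[where f' = vec_nth]) auto
  show "finite ?X"
    using bij_betw_finite[OF bij] by (simp add: finite_PiE finite_mu)
  have "(\<Sum>x\<in>?X. \<Prod>i\<in>UNIV. x $ i powi (w $ i)) = (\<Sum>g\<in>?Y. \<Prod>i\<in>UNIV. g i powi (w $ i))"
    using sum.reindex_bij_betw[OF bij, of "\<lambda>x. \<Prod>i\<in>UNIV. x $ i powi (w $ i)"] by simp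
  also have "\<dots> = (\<Prod>i\<in>UNIV. \<Sum>y\<in>mu Q. y powi (w $ i))"
    using finite_mu by (subst prod_sum_PiE) auto
  also have "\<dots> = (if \<forall>i. int (Q - 1) dvd w $ i then of_nat (Q - 1) ^ CARD('n) else 0)"
    by (auto simp: sum_mu_powi intro!: prod_zero)
  finally show "(\<Sum>x\<in>?X. \<Prod>i\<in>UNIV. x $ i powi (w $ i)) =
    (if \<forall>i. int (Q - 1) dvd w $ i then of_nat (Q - 1) ^ CARD('n) else 0)" .
qed

lemma Zq_inverse_p_power_minus_1:
  assumes "r > 0"
  shows "inverse (of_nat (p ^ r) - 1) \<in> (Zq Q :: 'k witt fract set)"
proof -
  let ?w = "Witt (\<lambda>n. if r dvd n then 1 else (0::'k))"
  have "(1 - of_nat p ^ r) * to_fract ?w = to_fract ((1 - of_nat p ^ r) * ?w)"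
    by (simp only: to_fract_mult to_fract_diff to_fract_power to_fract_of_nat to_fract_1)
  also have "\<dots> = 1"
    using witt_inverse_one_minus[OF assms, where 'a = 'k] by (simp add: p)
  finally have "(of_nat (p ^ r) - 1) * (- to_fract ?w) = 1"
    by (simp add: algebra_simps)
  then have "inverse (of_nat (p ^ r) - 1) = - to_fract ?w" by (rule inverse_unique)
  moreover have "to_fract ?w \<in> Zq Q"
    unfolding Zq_def to_fract_def[symmetric]
    by (intro imageI) (auto simp: Witt_inverse Fq_0[OF p b Q] Fq_1[OF p b Q])
  ultimately show ?thesis using Zq_uminus[OF p b Q] by simp
qed

text \<open>
  By Euler's theorem \<open>n\<close> divides \<open>p^r - 1\<close> for some \<open>r > 0\<close>, and \<open>p^r - 1\<close> is a unit.
\<close>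

lemma Zq_inverse_of_nat:
  assumes "\<not> p dvd n"
  shows "inverse (of_nat n) \<in> (Zq Q :: 'k witt fract set)"
proof -
  have n: "n > 0" using assms by (cases n) auto
  have "coprime p n" using assms prime_p[OF p b Q] by (simp add: prime_imp_coprime)
  then have "[p ^ totient n = 1] (mod n)" by (rule euler_theorem)
  then obtain c where c: "p ^ totient n - 1 = n * c"
    using prime_gt_0_nat[OF prime_p[OF p b Q]] by (metis cong_to_1_nat dvdE)
  have r: "totient n > 0" using n by simp
  have "p ^ totient n > 1" using r prime_gt_1_nat[OF prime_p[OF p b Q]] by (intro one_less_power)
  then have c': "p ^ totient n = 1 + n * c" "c > 0" using c by (auto intro: gr0I)
  have e: "(of_nat (p ^ totient n) - 1 :: 'k witt fract) = of_nat n * of_nat c"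
    unfolding c'(1) of_nat_add of_nat_mult by simp
  have "inverse (of_nat n) = of_nat c * inverse (of_nat (p ^ totient n) - 1 :: 'k witt fract)"
    unfolding e using n c'(2) by (simp add: field_simps)
  then show ?thesis
    using Zq_inverse_p_power_minus_1[OF r] Zq_mult[OF p b Q] Zq_of_nat[OF p b Q] by simp
qed

end

text \<open>
  A \<open>p\<close>-adic integer \<open>z\<close> is congruent to a natural number \<open>N\<close> modulo any power of \<open>p\<close>. If \<open>p^v\<close> is the exact
  power of \<open>p\<close> dividing \<open>j!\<close>, then \<open>z \<equiv> N\<close> modulo \<open>p^v\<close> makes \<open>z gchoose j\<close> and \<open>N choose j\<close> differ by a
  \<open>p\<close>-adic integer.
\<close>

lemma gbinomial_Zp:
  fixes z :: "'k::{alg_closed_field, field_prime_char} witt fract"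
  assumes p: "p = CHAR('k)" and z: "z \<in> Zq p"
  shows "z gchoose j \<in> Zq p"
proof -
  have b1: "0 < (1::nat)" and pp: "p = p ^ 1" by simp_all
  note ring = Zq_add[OF p b1 pp] Zq_mult[OF p b1 pp] Zq_diff[OF p b1 pp]
    Zq_of_nat[OF p b1 pp] Zq_0[OF p b1 pp] Zq_power[OF p b1 pp]
  have prime: "prime p" using prime_p[OF p b1 pp] .
  have Fp: "\<exists>c. a = of_nat c" if "a \<in> Fq p" for a :: 'k
  proof -
    have "(of_nat :: nat \<Rightarrow> 'k) ` {..<p} = Fq p"
    proof (rule card_subset_eq)
      show "finite (Fq p :: 'k set)" using finite_Fq[OF p b1 pp] .
      have "(of_nat c :: 'k) ^ p = of_nat c" for c
        using of_int_power_CHAR[of "int c", where 'a = 'k] by (simp add: p)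
      then show "(of_nat :: nat \<Rightarrow> 'k) ` {..<p} \<subseteq> Fq p" by (auto simp: Fq_def)
      have "inj_on (of_nat :: nat \<Rightarrow> 'k) {..<p}"
        by (rule inj_onI) (auto simp: of_nat_eq_iff_cong_CHAR cong_less_modulus_unique_nat p)
      then show "card ((of_nat :: nat \<Rightarrow> 'k) ` {..<p}) = card (Fq p :: 'k set)"
        using card_Fq[OF p b1 pp] by (simp add: card_image)
    qed
    then show ?thesis using that by (metis imageE)
  qed
  have approx: "\<exists>N y. y \<in> Zq p \<and> z = of_nat N + of_nat p ^ m * y" if "z \<in> Zq p"
    for m and z :: "'k witt fract"
    using that
  proof (induction m arbitrary: z)
    case 0
    then show ?case by (intro exI[of _ 0] exI[of _ z]) simp
  next
    case (Suc m)
    obtain w where w: "z = to_fract w" using Suc.prems by (rule Zq_cases)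
    obtain y where y: "y \<in> Zq p" "witt_coord w 0 \<in> Fq p" "z = teich (witt_coord w 0) + of_nat p * y"
      using Zq_residue_decompose[OF p b1 pp, of w] Suc.prems w by metis
    obtain c where c: "witt_coord w 0 = of_nat c" using Fp[OF y(2)] by blast
    have "to_fract (of_nat c :: 'k witt) \<in> Zq p" using ring(4) by simp
    then obtain y' where y': "y' \<in> Zq p" "of_nat c = teich (of_nat c :: 'k) + of_nat p * y'"
      using Zq_residue_decompose[OF p b1 pp, of "of_nat c"]
      by (metis witt_coord_of_nat_0 to_fract_of_nat)
    obtain N t where N: "t \<in> Zq p" "y - y' = of_nat N + of_nat p ^ m * t"
      using Suc.IH[of "y - y'"] ring(3) y y' by blast
    have "z = of_nat c + of_nat p * (y - y')"
      using y(3) y'(2) c by (simp add: algebra_simps)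
    then have "z = of_nat (c + p * N) + of_nat p ^ Suc m * t"
      unfolding N(2) by (simp add: algebra_simps)
    then show ?case using N(1) by blast
  qed
  define v where "v = multiplicity p (fact j :: nat)"
  define u where "u = fact j div p ^ v"
  have u: "fact j = p ^ v * u"
    unfolding u_def v_def using multiplicity_dvd by (metis dvd_mult_div_cancel)
  have nu: "\<not> p dvd u"
    unfolding u_def v_def using prime by (intro multiplicity_decompose) (auto simp: prime_gt_1_nat)
  obtain N y where N: "y \<in> Zq p" "z = of_nat N + of_nat p ^ v * y" using approx[OF z] by blast
  have "\<exists>t\<in>Zq p. (\<Prod>i<n. z - of_nat i) = (\<Prod>i<n. of_nat N - of_nat i) + of_nat p ^ v * t" for n
  proof (induction n)
    case 0
    then show ?case using ring(5) by (intro bexI[of _ 0]) simp_all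
  next
    case (Suc n)
    then obtain t where t: "t \<in> Zq p" "(\<Prod>i<n. z - of_nat i) = (\<Prod>i<n. of_nat N - of_nat i) + of_nat p ^ v * t"
      by blast
    let ?P = "\<Prod>i<n. of_nat N - of_nat i :: 'k witt fract"
    have "?P = of_int (\<Prod>i<n. int N - int i)" by simp
    then have P: "?P \<in> Zq p" using Zq_of_int[OF p b1 pp] by metis
    have "(\<Prod>i<Suc n. z - of_nat i) = ?P * (of_nat N - of_nat n) + of_nat p ^ v * (?P * y + t * (z - of_nat n))"
      unfolding prod.lessThan_Suc t(2) by (simp add: N(2) algebra_simps)
    moreover have "?P * y + t * (z - of_nat n) \<in> Zq p" using P t(1) N(1) z ring by simp
    ultimately show ?case by (auto simp: mult.commute)
  qed
  then obtain t where t: "t \<in> Zq p" "(\<Prod>i<j. z - of_nat i) = (\<Prod>i<j. of_nat N - of_nat i) + of_nat p ^ v * t"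
    by blast
  have F: "fact j = (of_nat p ^ v * of_nat u :: 'k witt fract)"
    unfolding of_nat_power[symmetric] of_nat_mult[symmetric] u[symmetric] by simp
  have u0: "(of_nat u :: 'k witt fract) \<noteq> 0" and p0: "(of_nat p :: 'k witt fract) \<noteq> 0"
    using nu prime by (auto intro: gr0I)
  have "of_nat p ^ v * t / fact j = t * inverse (of_nat u)"
    unfolding F using u0 p0 by (simp add: field_simps)
  then have "z gchoose j = (of_nat N gchoose j) + t * inverse (of_nat u)"
    unfolding gbinomial_prod_rev atLeast0LessThan t(2) by (simp only: add_divide_distrib)
  moreover have "(of_nat N gchoose j :: 'k witt fract) \<in> Zq p"
    using ring(4) by (simp flip: binomial_gbinomial)
  ultimately show ?thesis
    using t(1) ring Zq_inverse_of_nat[OF p b1 pp nu] by simp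
qed


section \<open>Exponentials of power series and characteristic determinants\<close>

text \<open>
  \<open>F\<close> is the exponential of the series \<open>\<Sum>k\<ge>1. c k * s^k / k\<close>. The formulation by the logarithmic
  derivative makes sense over rings without division and ignores \<open>c 0\<close>.
\<close>

definition is_exp :: "(nat \<Rightarrow> 'r::comm_ring_1) \<Rightarrow> 'r fps \<Rightarrow> bool" where
  "is_exp c F \<longleftrightarrow> fps_nth F 0 = 1 \<and> fps_deriv F = Abs_fps (\<lambda>i. c (Suc i)) * F"

lemma is_exp_rec:
  assumes "is_exp c F"
  shows "of_nat (Suc m) * fps_nth F (Suc m) = (\<Sum>i\<le>m. c (Suc i) * fps_nth F (m - i))"
proof -
  have "fps_nth (fps_deriv F) m = fps_nth (Abs_fps (\<lambda>i. c (Suc i)) * F) m"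
    using assms by (simp add: is_exp_def)
  then show ?thesis by (simp add: fps_mult_nth atLeast0AtMost)
qed

lemma is_expI:
  assumes "fps_nth F 0 = 1"
    and "\<And>m. of_nat (Suc m) * fps_nth F (Suc m) = (\<Sum>i\<le>m. c (Suc i) * fps_nth F (m - i))"
  shows "is_exp c F"
  unfolding is_exp_def using assms by (auto simp: fps_eq_iff fps_mult_nth atLeast0AtMost)

lemma is_exp_exp_fps:
  fixes c :: "nat \<Rightarrow> 'a::field_char_0 fps"
  shows "is_exp c (exp_fps (Abs_fps (\<lambda>k. if k = 0 then 0 else fps_const (1 / of_nat k) * c k)))"
proof -
  define g where "g = Abs_fps (\<lambda>k. if k = 0 then 0 else fps_const (1 / of_nat k) * c k)"
  define E :: "'a fps fps" where "E = Abs_fps (\<lambda>j. fps_const (1 / fact j))"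
  have g0: "fps_nth g 0 = 0" by (simp add: g_def)
  have "fps_const (of_nat (Suc n)) * fps_const (1 / fact (Suc n)) = (fps_const (1 / fact n) :: 'a fps)" for n
    by (simp del: of_nat_Suc)
  then have "fps_deriv E = E"
    by (intro fps_ext) (simp add: E_def fps_of_nat del: of_nat_Suc fact_Suc)
  then have "fps_deriv (E oo g) = (E oo g) * fps_deriv g"
    using fps_compose_deriv[OF g0, of E] by simp
  moreover have "fps_deriv g = Abs_fps (\<lambda>i. c (Suc i))"
  proof (rule fps_ext)
    fix n
    have "fps_const (of_nat (Suc n)) * (fps_const (1 / of_nat (Suc n)) * c (Suc n)) = c (Suc n)"
      unfolding mult.assoc[symmetric] fps_const_mult by (simp del: of_nat_Suc)
    then show "fps_nth (fps_deriv g) n = fps_nth (Abs_fps (\<lambda>i. c (Suc i))) n"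
      by (simp add: g_def fps_of_nat del: of_nat_Suc)
  qed
  ultimately show ?thesis
    unfolding is_exp_def exp_fps_def g_def[symmetric] E_def[symmetric]
    by (simp add: E_def mult.commute)
qed

lemma fps_nth_mult_cong:
  assumes "\<And>t. t < N \<Longrightarrow> fps_nth x t = fps_nth x' t" "\<And>t. t < N \<Longrightarrow> fps_nth y t = fps_nth y' t" "t < N"
  shows "fps_nth (x * y) t = fps_nth (x' * y') t"
  unfolding fps_mult_nth using assms by (intro sum.cong) auto

text \<open>
  The exponential is compatible with congruences modulo \<open>T^N\<close>, and its coefficient at \<open>s^m\<close> depends only
  on the exponents up to \<open>m\<close>.
\<close>

lemma is_exp_cong:
  fixes c c' :: "nat \<Rightarrow> 'a::field_char_0 fps"
  assumes F: "is_exp c F" and F': "is_exp c' F'"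
    and eq: "\<And>k t. 0 < k \<Longrightarrow> k \<le> M \<Longrightarrow> t < N \<Longrightarrow> fps_nth (c k) t = fps_nth (c' k) t"
  shows "m \<le> M \<Longrightarrow> t < N \<Longrightarrow> fps_nth (fps_nth F m) t = fps_nth (fps_nth F' m) t"
proof (induction m arbitrary: t rule: less_induct)
  case (less m)
  show ?case
  proof (cases m)
    case 0
    then show ?thesis using F F' by (simp add: is_exp_def)
  next
    case (Suc l)
    have "fps_nth (\<Sum>i\<le>l. c (Suc i) * fps_nth F (l - i)) t = fps_nth (\<Sum>i\<le>l. c' (Suc i) * fps_nth F' (l - i)) t"
      unfolding fps_sum_nth
    proof (intro sum.cong fps_nth_mult_cong[where N = N])
      fix i s assume i: "i \<in> {..l}" and "s < N"
      then show "fps_nth (c (Suc i)) s = fps_nth (c' (Suc i)) s"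
        using less.prems Suc by (intro eq) auto
      show "fps_nth (fps_nth F (l - i)) s = fps_nth (fps_nth F' (l - i)) s"
        using less.prems Suc \<open>s < N\<close> by (intro less.IH) auto
    qed (use less.prems in auto)
    then have "of_nat (Suc l) * fps_nth (fps_nth F m) t = of_nat (Suc l) * fps_nth (fps_nth F' m) t"
      unfolding is_exp_rec[OF F, symmetric] is_exp_rec[OF F', symmetric] Suc
      by (simp add: fps_of_nat[symmetric] del: of_nat_Suc)
    then show ?thesis by (simp del: of_nat_Suc)
  qed
qed

lemma is_exp_unique:
  fixes F :: "'a::field_char_0 fps fps"
  assumes "is_exp c F" "is_exp c' F'" "\<And>k. k > 0 \<Longrightarrow> c k = c' k"
  shows "F = F'"
proof (intro fps_ext)
  fix m t
  show "fps_nth (fps_nth F m) t = fps_nth (fps_nth F' m) t"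
    by (rule is_exp_cong[OF assms(1,2), where M = m and N = "Suc t"]) (simp_all add: assms(3))
qed

lemma is_exp_add:
  assumes "is_exp c F" "is_exp c' F'"
  shows "is_exp (\<lambda>k. c k + c' k) (F * F')"
proof -
  have "Abs_fps (\<lambda>i. c (Suc i) + c' (Suc i)) = Abs_fps (\<lambda>i. c (Suc i)) + Abs_fps (\<lambda>i. c' (Suc i))"
    by (rule fps_ext) simp
  then show ?thesis using assms by (simp add: is_exp_def algebra_simps)
qed

text \<open>
  The substitution of \<open>a s\<close> for \<open>s\<close>.
\<close>

lemma is_exp_scale:
  assumes "is_exp c F"
  shows "is_exp (\<lambda>k. a ^ k * c k) (Abs_fps (\<lambda>m. a ^ m * fps_nth F m))"
proof -
  have "a ^ Suc m * (of_nat (Suc m) * fps_nth F (Suc m)) =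
      (\<Sum>i\<le>m. a ^ Suc i * c (Suc i) * (a ^ (m - i) * fps_nth F (m - i)))" for m
    unfolding is_exp_rec[OF assms] sum_distrib_left
  proof (rule sum.cong)
    fix i assume "i \<in> {..m}"
    then have "a ^ Suc m = a ^ Suc i * a ^ (m - i)" unfolding power_add[symmetric] by simp
    then show "a ^ Suc m * (c (Suc i) * fps_nth F (m - i)) = a ^ Suc i * c (Suc i) * (a ^ (m - i) * fps_nth F (m - i))"
      by (simp only: mult_ac)
  qed simp
  then show ?thesis
    using assms by (intro is_expI) (simp_all add: is_exp_def mult.left_commute del: of_nat_Suc power_Suc)
qed

text \<open>
  The power of a matrix whose rows and columns are indexed by an arbitrary finite set.
\<close>

fun mpow :: "'b set \<Rightarrow> ('b \<Rightarrow> 'b \<Rightarrow> 'r::comm_ring_1) \<Rightarrow> nat \<Rightarrow> 'b \<Rightarrow> 'b \<Rightarrow> 'r" where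
  "mpow B A 0 r w = (if r = w then 1 else 0)"
| "mpow B A (Suc k) r w = (\<Sum>t\<in>B. mpow B A k r t * A t w)"

lemma mpow_reindex:
  assumes h: "bij_betw h J B" and "i \<in> J" "j \<in> J"
  shows "mpow J (\<lambda>i j. A (h i) (h j)) k i j = mpow B A k (h i) (h j)"
  using assms(3)
proof (induction k arbitrary: j)
  case 0
  have "h i = h j \<longleftrightarrow> i = j" using h assms(2) 0 by (meson bij_betw_def inj_on_eq_iff)
  then show ?case by simp
next
  case (Suc k)
  have "mpow J (\<lambda>i j. A (h i) (h j)) (Suc k) i j = (\<Sum>t\<in>J. mpow B A k (h i) (h t) * A (h t) (h j))"
    using Suc.IH by simp
  also have "\<dots> = mpow B A (Suc k) (h i) (h j)"
    using sum.reindex_bij_betw[OF h, of "\<lambda>t. mpow B A k (h i) t * A t (h j)"] by simp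
  finally show ?case .
qed

lemma fps_deriv_prod:
  fixes f :: "'i \<Rightarrow> 'r::comm_ring_1 fps"
  shows "finite I \<Longrightarrow> fps_deriv (\<Prod>i\<in>I. f i) = (\<Sum>i\<in>I. fps_deriv (f i) * (\<Prod>j\<in>I - {i}. f j))"
proof (induction I rule: finite_induct)
  case (insert x I)
  have "(\<Prod>j\<in>insert x I - {i}. f j) = f x * (\<Prod>j\<in>I - {i}. f j)" if "i \<in> I" for i
  proof -
    have "insert x I - {i} = insert x (I - {i})" using insert.hyps that by auto
    then show ?thesis using insert.hyps by simp
  qed
  then have "(\<Sum>i\<in>I. fps_deriv (f i) * (\<Prod>j\<in>insert x I - {i}. f j)) = f x * fps_deriv (\<Prod>i\<in>I. f i)"
    unfolding insert.IH sum_distrib_left by (intro sum.cong) (auto simp: mult_ac)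
  moreover have "insert x I - {x} = I" using insert.hyps by auto
  ultimately show ?case using insert.hyps by (simp add: add.commute mult.commute)
qed simp

context
  fixes n :: nat and A :: "nat \<Rightarrow> nat \<Rightarrow> 'r::comm_ring_1"
begin

text \<open>
  The matrix \<open>1 - s A\<close> over the power series in \<open>s\<close>.
\<close>

definition charmat :: "'r fps mat" where
  "charmat = mat n n (\<lambda>(i,j). (if i = j then 1 else 0) - fps_X * fps_const (A i j))"

lemma charmat_carrier: "charmat \<in> carrier_mat n n"
  by (simp add: charmat_def)

lemma charmat_nth: "i < n \<Longrightarrow> j < n \<Longrightarrow> charmat $$ (i, j) = (if i = j then 1 else 0) - fps_X * fps_const (A i j)"
  by (simp add: charmat_def)

text \<open>
  Jacobi's formula: differentiating row \<open>i\<close> replaces it by the row of derivatives, and Laplace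
  expansion along this row involves only cofactors of the original matrix.
\<close>

lemma fps_deriv_det_charmat:
  "fps_deriv (det charmat) = - (\<Sum>i<n. \<Sum>l<n. fps_const (A i l) * cofactor charmat i l)"
proof -
  define N where "N i = mat n n (\<lambda>(j,l). if j = i then - fps_const (A i l) else charmat $$ (j, l))" for i
  have N_carrier: "N i \<in> carrier_mat n n" for i by (simp add: N_def)
  have sgn: "fps_deriv (signof \<pi> * P) = signof \<pi> * fps_deriv P" for \<pi> and P :: "'r fps"
    by (simp add: sign_def)
  have deriv_nth: "fps_deriv (charmat $$ (i, j)) = - fps_const (A i j)" if "i < n" "j < n" for i j
    using that by (simp add: charmat_nth)
  have "fps_deriv (det charmat) =
    (\<Sum>\<pi> | \<pi> permutes {0..<n}. signof \<pi> * (\<Sum>i=0..<n. - fps_const (A i (\<pi> i)) * (\<Prod>j\<in>{0..<n} - {i}. charmat $$ (j, \<pi> j))))"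
    unfolding det_def'[OF charmat_carrier] fps_deriv_sum sgn
  proof (intro sum.cong refl arg_cong2[where f = "(*)"])
    fix \<pi> assume "\<pi> \<in> {\<pi>. \<pi> permutes {0..<n}}"
    then have "\<pi> i < n" if "i < n" for i using that permutes_in_image[of \<pi> "{0..<n}" i] by simp
    then show "fps_deriv (\<Prod>i=0..<n. charmat $$ (i, \<pi> i)) =
      (\<Sum>i=0..<n. - fps_const (A i (\<pi> i)) * (\<Prod>j\<in>{0..<n} - {i}. charmat $$ (j, \<pi> j)))"
      by (subst fps_deriv_prod) (auto simp: deriv_nth)
  qed
  also have "\<dots> = (\<Sum>i=0..<n. \<Sum>\<pi> | \<pi> permutes {0..<n}. signof \<pi> * (- fps_const (A i (\<pi> i)) * (\<Prod>j\<in>{0..<n} - {i}. charmat $$ (j, \<pi> j))))"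
    unfolding sum_distrib_left by (rule sum.swap)
  also have "\<dots> = (\<Sum>i=0..<n. det (N i))"
    unfolding det_def'[OF N_carrier]
  proof (intro sum.cong refl arg_cong2[where f = "(*)"])
    fix i \<pi> assume i: "i \<in> {0..<n}" and "\<pi> \<in> {\<pi>. \<pi> permutes {0..<n}}"
    then have lt: "\<pi> j < n" if "j < n" for j using that permutes_in_image[of \<pi> "{0..<n}" j] by simp
    have "(\<Prod>j=0..<n. N i $$ (j, \<pi> j)) = N i $$ (i, \<pi> i) * (\<Prod>j\<in>{0..<n} - {i}. N i $$ (j, \<pi> j))"
      using i by (intro prod.remove) auto
    also have "\<dots> = - fps_const (A i (\<pi> i)) * (\<Prod>j\<in>{0..<n} - {i}. charmat $$ (j, \<pi> j))"
      using i lt by (intro arg_cong2[where f = "(*)"] prod.cong) (auto simp: N_def)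
    finally show "- fps_const (A i (\<pi> i)) * (\<Prod>j\<in>{0..<n} - {i}. charmat $$ (j, \<pi> j)) = (\<Prod>j=0..<n. N i $$ (j, \<pi> j))" ..
  qed
  also have "\<dots> = (\<Sum>i<n. \<Sum>l<n. - fps_const (A i l) * cofactor charmat i l)"
    unfolding atLeast0LessThan
  proof (rule sum.cong)
    fix i assume i: "i \<in> {..<n}"
    have "mat_delete (N i) i l = mat_delete charmat i l" if "l < n" for l
      using i that by (intro eq_matI) (auto simp: mat_delete_def N_def charmat_def)
    then show "det (N i) = (\<Sum>l<n. - fps_const (A i l) * cofactor charmat i l)"
      using i by (subst laplace_expansion_row[OF N_carrier, of i]) (auto simp: cofactor_def N_def intro!: sum.cong)
  qed simp
  finally show ?thesis by (simp only: mult_minus_left sum_negf)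
qed

text \<open>
  An entry of the identity \<open>adj (M) M = det (M)\<close> for \<open>M = 1 - s A\<close>, solved for the cofactor. Iterating
  it gives the expansion \<open>adj (M) = det (M) \<Sum> s^k A^k\<close> of the next lemma.
\<close>

lemma cofactor_charmat:
  assumes ij: "i < n" "j < n"
  shows "cofactor charmat j i =
    (if i = j then det charmat else 0) + fps_X * (\<Sum>l<n. cofactor charmat l i * fps_const (A l j))"
proof -
  have "(if i = j then det charmat else 0) = (adj_mat charmat * charmat) $$ (i, j)"
    using ij by (subst adj_mat(3)[OF charmat_carrier]) simp
  also have "\<dots> = (\<Sum>l<n. cofactor charmat l i * charmat $$ (l, j))"
    using ij charmat_carrier by (simp add: adj_mat_def scalar_prod_def atLeast0LessThan)
  also have "\<dots> = (\<Sum>l<n. (if l = j then cofactor charmat l i else 0) - fps_X * (cofactor charmat l i * fps_const (A l j)))"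
    using ij by (intro sum.cong) (auto simp: charmat_nth algebra_simps)
  also have "\<dots> = cofactor charmat j i - fps_X * (\<Sum>l<n. cofactor charmat l i * fps_const (A l j))"
    using ij by (simp add: sum_subtractf sum_distrib_left sum.delta)
  finally show ?thesis by simp
qed

lemma cofactor_charmat_nth:
  assumes "i < n" "j < n"
  shows "fps_nth (cofactor charmat j i) s = (\<Sum>k\<le>s. mpow {..<n} A k i j * fps_nth (det charmat) (s - k))"
  using assms(2)
proof (induction s arbitrary: j)
  case 0
  then show ?case by (subst cofactor_charmat[OF assms(1)]) simp_all
next
  case (Suc s)
  have "fps_nth (cofactor charmat j i) (Suc s) =
      (if i = j then fps_nth (det charmat) (Suc s) else 0) + (\<Sum>l<n. fps_nth (cofactor charmat l i) s * A l j)"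
    by (subst cofactor_charmat[OF assms(1) Suc.prems]) (simp add: fps_sum_nth)
  also have "(\<Sum>l<n. fps_nth (cofactor charmat l i) s * A l j) =
      (\<Sum>l<n. \<Sum>k\<le>s. mpow {..<n} A k i l * A l j * fps_nth (det charmat) (s - k))"
    by (simp add: Suc.IH sum_distrib_left sum_distrib_right mult_ac)
  also have "\<dots> = (\<Sum>k\<le>s. mpow {..<n} A (Suc k) i j * fps_nth (det charmat) (s - k))"
    by (subst sum.swap) (simp add: sum_distrib_right)
  finally show ?case
    by (subst sum.atMost_Suc_shift) simp
qed

text \<open>
  Expanding the product, a set \<open>R\<close> of rows contributes \<open>- s A\<close> and the others contribute the identity
  matrix, which forces \<open>\<pi>\<close> to fix every point outside \<open>R\<close>.
\<close>

lemma charmat_prod_nth: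
  assumes "\<pi> permutes {0..<n}"
  shows "fps_nth (\<Prod>i=0..<n. charmat $$ (i, \<pi> i)) m =
    (\<Sum>R | R \<subseteq> {0..<n} \<and> card R = m \<and> \<pi> permutes R. (- 1) ^ m * (\<Prod>i\<in>R. A i (\<pi> i)))"
proof -
  have lt: "\<pi> i < n" if "i < n" for i using that permutes_in_image[OF assms, of i] by simp
  have "(\<Prod>i=0..<n. charmat $$ (i, \<pi> i)) = (\<Prod>i=0..<n. fps_const (- A i (\<pi> i)) * fps_X + (if i = \<pi> i then 1 else 0))"
    using lt by (intro prod.cong) (auto simp: charmat_nth)
  also have "\<dots> = (\<Sum>R\<in>Pow {0..<n}. (\<Prod>i\<in>R. fps_const (- A i (\<pi> i)) * fps_X) * (\<Prod>i\<in>{0..<n} - R. if i = \<pi> i then 1 else 0))"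
    by (rule prod_add) simp
  also have "\<dots> = (\<Sum>R\<in>Pow {0..<n}. if \<pi> permutes R then fps_const ((- 1) ^ card R * (\<Prod>i\<in>R. A i (\<pi> i))) * fps_X ^ card R else 0)"
  proof (rule sum.cong)
    fix R assume R: "R \<in> Pow {0..<n}"
    then have fin: "finite R" using finite_subset by auto
    have "\<pi> permutes R \<longleftrightarrow> (\<forall>i\<in>{0..<n} - R. i = \<pi> i)"
      using permutes_superset[OF assms, of R] permutes_not_in[of \<pi> R] by (metis Diff_iff)
    then have "(\<Prod>i\<in>{0..<n} - R. if i = \<pi> i then 1 else 0) = (if \<pi> permutes R then 1 else (0 :: 'r fps))"
      by (auto intro!: prod_zero)
    moreover have "(\<Prod>i\<in>R. fps_const (- A i (\<pi> i)) * fps_X) = fps_const ((- 1) ^ card R * (\<Prod>i\<in>R. A i (\<pi> i))) * fps_X ^ card R"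
      using fin
    proof (induction R rule: finite_induct)
      case (insert x R)
      have "fps_const (- A x (\<pi> x)) * fps_X * (fps_const ((- 1) ^ card R * (\<Prod>i\<in>R. A i (\<pi> i))) * fps_X ^ card R) =
          (fps_const (- A x (\<pi> x)) * fps_const ((- 1) ^ card R * (\<Prod>i\<in>R. A i (\<pi> i)))) * fps_X ^ Suc (card R)"
        by (simp only: power_Suc mult_ac)
      then show ?case using insert by (simp add: mult_ac)
    qed simp
    ultimately show "(\<Prod>i\<in>R. fps_const (- A i (\<pi> i)) * fps_X) * (\<Prod>i\<in>{0..<n} - R. if i = \<pi> i then 1 else 0) =
      (if \<pi> permutes R then fps_const ((- 1) ^ card R * (\<Prod>i\<in>R. A i (\<pi> i))) * fps_X ^ card R else 0)"
      by simp
  qed simp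
  also have "fps_nth \<dots> m = (\<Sum>R\<in>Pow {0..<n}. if card R = m \<and> \<pi> permutes R then (- 1) ^ m * (\<Prod>i\<in>R. A i (\<pi> i)) else 0)"
    unfolding fps_sum_nth by (intro sum.cong) (auto simp: fps_X_power_nth)
  also have "\<dots> = (\<Sum>R | R \<subseteq> {0..<n} \<and> card R = m \<and> \<pi> permutes R. (- 1) ^ m * (\<Prod>i\<in>R. A i (\<pi> i)))"
    by (subst sum.inter_filter[symmetric]) (auto intro!: sum.cong)
  finally show ?thesis .
qed

lemma det_charmat_nth:
  "fps_nth (det charmat) m = (\<Sum>\<pi> | \<pi> permutes {0..<n}. signof \<pi> *
    (\<Sum>R | R \<subseteq> {0..<n} \<and> card R = m \<and> \<pi> permutes R. (- 1) ^ m * (\<Prod>i\<in>R. A i (\<pi> i))))"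
proof -
  have "fps_nth (signof \<pi> * P) m = signof \<pi> * fps_nth P m" for \<pi> and P :: "'r fps"
    by (simp add: sign_def)
  then show ?thesis
    unfolding det_def'[OF charmat_carrier] fps_sum_nth
    by (intro sum.cong) (simp_all add: charmat_prod_nth)
qed

text \<open>
  The identity \<open>det (1 - s A) = exp (- \<Sum> tr (A^k) s^k / k)\<close>, obtained by comparing logarithmic
  derivatives.
\<close>

lemma is_exp_det_charmat:
  "is_exp (\<lambda>k. - (\<Sum>i<n. mpow {..<n} A k i i)) (det charmat)"
proof (rule is_expI)
  have *: "(\<Sum>R | R \<subseteq> {0..<n} \<and> card R = 0 \<and> \<pi> permutes R. (- 1) ^ 0 * (\<Prod>i\<in>R. A i (\<pi> i))) = (if \<pi> = id then 1 else 0)" for \<pi>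
  proof -
    have "{R. R \<subseteq> {0..<n} \<and> card R = 0 \<and> \<pi> permutes R} = (if \<pi> = id then {{}} else {})"
      using finite_subset[of _ "{0..<n}"] by (auto simp: permutes_empty card_eq_0_iff)
    then show ?thesis by simp
  qed
  show "fps_nth (det charmat) 0 = 1"
    unfolding det_charmat_nth *
    by (simp add: if_distrib sum.delta finite_permutations permutes_id cong: if_cong)
next
  fix m
  have "of_nat (Suc m) * fps_nth (det charmat) (Suc m) = fps_nth (fps_deriv (det charmat)) m" by simp
  also have "\<dots> = - (\<Sum>i<n. \<Sum>l<n. A i l * (\<Sum>k\<le>m. mpow {..<n} A k l i * fps_nth (det charmat) (m - k)))"
    unfolding fps_deriv_det_charmat by (simp add: fps_sum_nth cofactor_charmat_nth)
  also have "\<dots> = - (\<Sum>l<n. \<Sum>i<n. \<Sum>k\<le>m. mpow {..<n} A k l i * A i l * fps_nth (det charmat) (m - k))"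
    by (subst sum.swap) (simp add: sum_distrib_left mult_ac)
  also have "\<dots> = - (\<Sum>l<n. \<Sum>k\<le>m. mpow {..<n} A (Suc k) l l * fps_nth (det charmat) (m - k))"
  proof -
    have "(\<Sum>i<n. \<Sum>k\<le>m. mpow {..<n} A k l i * A i l * fps_nth (det charmat) (m - k)) =
      (\<Sum>k\<le>m. mpow {..<n} A (Suc k) l l * fps_nth (det charmat) (m - k))" for l
      by (subst sum.swap) (simp add: sum_distrib_right)
    then show ?thesis by simp
  qed
  also have "\<dots> = (\<Sum>k\<le>m. - (\<Sum>l<n. mpow {..<n} A (Suc k) l l) * fps_nth (det charmat) (m - k))"
    by (subst sum.swap) (simp only: sum_distrib_right sum_negf mult_minus_left)
  finally show "of_nat (Suc m) * fps_nth (det charmat) (Suc m) =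
    (\<Sum>k\<le>m. - (\<Sum>l<n. mpow {..<n} A (Suc k) l l) * fps_nth (det charmat) (m - k))" .
qed

text \<open>
  In this form the expansion of the determinant transfers any additive property of products along
  permuted index sets to its coefficients. It is used once for growth and once for integrality.
\<close>

lemma det_charmat_nth_mem:
  assumes I: "0 \<in> I" "\<And>x y. x \<in> I \<Longrightarrow> y \<in> I \<Longrightarrow> x + y \<in> I" "\<And>x. x \<in> I \<Longrightarrow> - x \<in> I"
    and A: "\<And>R \<pi>. R \<subseteq> {..<n} \<Longrightarrow> card R = m \<Longrightarrow> \<pi> permutes R \<Longrightarrow> (\<Prod>i\<in>R. A i (\<pi> i)) \<in> I"
  shows "fps_nth (det charmat) m \<in> I"
proof -
  have sum: "sum f S \<in> I" if "\<And>x. x \<in> S \<Longrightarrow> f x \<in> I" for f and S :: "'s set"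
    using that by (induction S rule: infinite_finite_induct) (auto intro: I)
  have pm: "(- 1) ^ k * x \<in> I" if "x \<in> I" for x k
    using that I(3) by (cases "even k") auto
  have sgn: "signof \<pi> * x \<in> I" if "x \<in> I" for x and \<pi> :: "nat \<Rightarrow> nat"
    using that I(3) by (simp add: sign_def)
  show ?thesis
    unfolding det_charmat_nth
    using A by (intro sum sgn pm) (auto simp: atLeast0LessThan)
qed

end


section \<open>Laurent polynomials and the trace formula\<close>

definition xpow :: "'a::field ^ 'n \<Rightarrow> int ^ 'n \<Rightarrow> 'a" where
  "xpow x v = (\<Prod>i\<in>UNIV. x $ i powi v $ i)"

lemma xpow_0 [simp]: "xpow x 0 = 1"
  by (simp add: xpow_def)

lemma xpow_add: "(\<And>i. (x :: 'a::field ^ 'n) $ i \<noteq> 0) \<Longrightarrow> xpow x (v + w) = xpow x v * xpow x w"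
  by (simp add: xpow_def power_int_add prod.distrib)

lemma xpow_scale: "xpow x (int c *s v) = xpow (\<chi> i. x $ i ^ c) v"
  by (simp add: xpow_def power_int_mult)

lemma xpow_scale': "xpow x (int c *s v) = xpow x v ^ c"
  by (simp add: xpow_def power_int_mult mult.commute[of "int c"] prod_power_distrib)

definition leval :: "'a::field ^ 'n \<Rightarrow> (int ^ 'n \<Rightarrow>\<^sub>0 'a fps) \<Rightarrow> 'a fps" where
  "leval x H = (\<Sum>v\<in>Poly_Mapping.keys H. Poly_Mapping.lookup H v * fps_const (xpow x v))"

lemma leval_superset:
  assumes "finite S" "Poly_Mapping.keys H \<subseteq> S"
  shows "leval x H = (\<Sum>v\<in>S. Poly_Mapping.lookup H v * fps_const (xpow x v))"
  unfolding leval_def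
  by (rule sum.mono_neutral_left) (use assms in \<open>auto simp: in_keys_iff\<close>)

lemma leval_single [simp]: "leval x (Poly_Mapping.single v c) = c * fps_const (xpow x v)"
  by (subst leval_superset[of "{v}"]) auto

lemma leval_0 [simp]: "leval x 0 = 0"
  by (simp add: leval_def)

lemma leval_1 [simp]: "leval x 1 = 1"
  by (metis leval_single xpow_0 fps_const_1_eq_1 mult_1 single_one)

lemma leval_add: "leval x (F + H) = leval x F + leval x H"
proof -
  let ?S = "Poly_Mapping.keys F \<union> Poly_Mapping.keys H"
  have "leval x (F + H) = (\<Sum>v\<in>?S. Poly_Mapping.lookup (F + H) v * fps_const (xpow x v))"
    by (rule leval_superset) (simp, rule keys_add)
  also have "\<dots> = leval x F + leval x H"
    by (simp add: lookup_add distrib_right sum.distrib leval_superset[of ?S])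
  finally show ?thesis .
qed

lemma leval_sum: "leval x (\<Sum>i\<in>I. h i) = (\<Sum>i\<in>I. leval x (h i))"
  by (induction I rule: infinite_finite_induct) (auto simp: leval_add)

lemma leval_mult:
  fixes x :: "'a::field ^ 'n"
  assumes "\<And>i. x $ i \<noteq> 0"
  shows "leval x (F * H) = leval x F * leval x H"
proof -
  have "F * H = (\<Sum>v\<in>Poly_Mapping.keys F. \<Sum>w\<in>Poly_Mapping.keys H.
      Poly_Mapping.single (v + w) (Poly_Mapping.lookup F v * Poly_Mapping.lookup H w))"
    by (subst (1 2) poly_mapping_sum_single) (simp add: sum_product mult_single)
  then have "leval x (F * H) = (\<Sum>v\<in>Poly_Mapping.keys F. \<Sum>w\<in>Poly_Mapping.keys H.
      (Poly_Mapping.lookup F v * fps_const (xpow x v)) * (Poly_Mapping.lookup H w * fps_const (xpow x w)))"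
    by (simp add: leval_sum xpow_add[OF assms] mult_ac flip: fps_const_mult)
  then show ?thesis by (simp add: leval_def sum_product)
qed

lemma leval_diff: "leval x (F - H) = leval x F - leval x H"
  using leval_add[of x "F - H" H] by simp

lemma leval_of_nat [simp]: "leval x (of_nat k) = of_nat k"
  by (induction k) (auto simp: leval_add)

lemma leval_prod: "(\<And>i. (x :: 'a::field ^ 'n) $ i \<noteq> 0) \<Longrightarrow> leval x (\<Prod>i\<in>I. h i) = (\<Prod>i\<in>I. leval x (h i))"
  by (induction I rule: infinite_finite_induct) (auto simp: leval_mult)

lemma lookup_mult_single:
  fixes H :: "'g::ab_group_add \<Rightarrow>\<^sub>0 'r::comm_ring_1"
  shows "Poly_Mapping.lookup (H * Poly_Mapping.single w c) v = Poly_Mapping.lookup H (v - w) * c"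
proof -
  have "H * Poly_Mapping.single w c = (\<Sum>u\<in>Poly_Mapping.keys H. Poly_Mapping.single (u + w) (Poly_Mapping.lookup H u * c))"
    by (subst poly_mapping_sum_single) (simp add: sum_distrib_right mult_single)
  then have "Poly_Mapping.lookup (H * Poly_Mapping.single w c) v =
      (\<Sum>u\<in>Poly_Mapping.keys H. if u = v - w then Poly_Mapping.lookup H u * c else 0)"
    by (auto simp: lookup_sum lookup_single when_def algebra_simps intro!: sum.cong)
  then show ?thesis by (simp add: sum.delta in_keys_iff)
qed

definition vnorm :: "int ^ 'n \<Rightarrow> nat" where
  "vnorm v = (\<Sum>i\<in>UNIV. nat \<bar>v $ i\<bar>)"

lemma vnorm_0 [simp]: "vnorm 0 = 0"
  by (simp add: vnorm_def)

lemma vnorm_add: "vnorm (v + w) \<le> vnorm v + vnorm w"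
  unfolding vnorm_def sum.distrib[symmetric] by (intro sum_mono) auto

lemma vnorm_uminus [simp]: "vnorm (- v) = vnorm v"
  by (simp add: vnorm_def)

lemma vnorm_scale: "vnorm (int c *s v) = c * vnorm v"
  by (simp add: vnorm_def sum_distrib_left abs_mult nat_mult_distrib)

lemma vnorm_diff: "vnorm (v - w) \<le> vnorm v + vnorm w"
  using vnorm_add[of v "- w"] by simp

lemma finite_vnorm_le: "finite {v :: int ^ 'n. vnorm v \<le> M}"
proof -
  have "{v :: int ^ 'n. vnorm v \<le> M} \<subseteq> vec_lambda ` (PiE UNIV (\<lambda>_. {- int M..int M}))"
  proof
    fix v :: "int ^ 'n" assume v: "v \<in> {v. vnorm v \<le> M}"
    have "nat \<bar>v $ i\<bar> \<le> M" for i
    proof -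
      have "nat \<bar>v $ i\<bar> \<le> vnorm v" unfolding vnorm_def by (rule member_le_sum) auto
      then show ?thesis using v by simp
    qed
    then have "\<bar>v $ i\<bar> \<le> int M" for i using nat_le_iff by blast
    then have "vec_nth v \<in> PiE UNIV (\<lambda>_. {- int M..int M})" by (auto simp: abs_le_iff minus_le_iff)
    then show "v \<in> vec_lambda ` (PiE UNIV (\<lambda>_. {- int M..int M}))"
      by (intro image_eqI[of _ _ "vec_nth v"]) simp_all
  qed
  then show ?thesis by (rule finite_subset) (intro finite_imageI finite_PiE; simp)
qed

text \<open>
  The substitution of \<open>x^q\<close> for \<open>x\<close> in a Laurent polynomial.
\<close>

definition dilate :: "nat \<Rightarrow> (int ^ 'n \<Rightarrow>\<^sub>0 'a::comm_ring_1) \<Rightarrow> (int ^ 'n \<Rightarrow>\<^sub>0 'a)" where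
  "dilate q H = (\<Sum>v\<in>Poly_Mapping.keys H. Poly_Mapping.single (int q *s v) (Poly_Mapping.lookup H v))"

lemma leval_dilate: "leval x (dilate q H) = leval (\<chi> i. x $ i ^ q) H"
  unfolding dilate_def leval_sum leval_single xpow_scale by (simp add: leval_def)

lemma lookup_mult_dilate:
  "Poly_Mapping.lookup (G * dilate q H) v =
    (\<Sum>t\<in>Poly_Mapping.keys H. Poly_Mapping.lookup G (v - int q *s t) * Poly_Mapping.lookup H t)"
  by (simp add: dilate_def sum_distrib_left lookup_sum lookup_mult_single)

text \<open>
  The Laurent polynomial \<open>G(x) G(x^q) \<dots> G(x^(q^(k-1)))\<close>.
\<close>

fun frob_prod :: "nat \<Rightarrow> (int ^ 'n \<Rightarrow>\<^sub>0 'a::comm_ring_1) \<Rightarrow> nat \<Rightarrow> (int ^ 'n \<Rightarrow>\<^sub>0 'a)" where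
  "frob_prod q G 0 = 1"
| "frob_prod q G (Suc k) = G * dilate q (frob_prod q G k)"

lemma leval_frob_prod:
  fixes x :: "'a::field ^ 'n"
  assumes "\<And>i. x $ i \<noteq> 0"
  shows "leval x (frob_prod q G k) = (\<Prod>j<k. leval (\<chi> i. x $ i ^ (q ^ j)) G)"
  using assms
proof (induction k arbitrary: x)
  case (Suc k)
  show ?case
    by (simp add: prod.lessThan_Suc_shift leval_mult[OF Suc.prems] leval_dilate Suc.IH Suc.prems
        del: prod.lessThan_Suc flip: power_mult)
qed simp

lemma geometric_sum_Suc: "(\<Sum>j<Suc k. q ^ j) = 1 + q * (\<Sum>j<k. q ^ j :: nat)"
  by (subst sum.lessThan_Suc_shift) (simp add: sum_distrib_left)

lemma fps_const_sum: "fps_const (\<Sum>i\<in>I. f i) = (\<Sum>i\<in>I. fps_const (f i))"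
  by (rule fps_ext) (simp add: fps_sum_nth)

lemma geometric_sum_nat:
  assumes "q > 0"
  shows "(q - 1) * (\<Sum>j<k. q ^ j) = q ^ k - (1::nat)"
proof -
  obtain q' where q: "q = Suc q'" using assms gr0_implies_Suc by blast
  have "q' * (\<Sum>j<k. Suc q' ^ j) + 1 = Suc q' ^ k"
    by (induction k) (simp_all add: algebra_simps)
  then show ?thesis using q by (metis add_diff_cancel_right' diff_Suc_1)
qed

lemma keys_frob_prod:
  assumes "\<forall>v\<in>Poly_Mapping.keys G. vnorm v \<le> L"
  shows "v \<in> Poly_Mapping.keys (frob_prod q G k) \<Longrightarrow> vnorm v \<le> L * (\<Sum>j<k. q ^ j)"
proof (induction k arbitrary: v)
  case 0
  then show ?case by (auto simp: in_keys_iff lookup_one when_def split: if_splits)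
next
  case (Suc k)
  then have "Poly_Mapping.lookup (G * dilate q (frob_prod q G k)) v \<noteq> 0"
    by (simp add: in_keys_iff)
  then obtain t where t: "t \<in> Poly_Mapping.keys (frob_prod q G k)" "Poly_Mapping.lookup G (v - int q *s t) \<noteq> 0"
    unfolding lookup_mult_dilate by (metis (no_types, lifting) mult_zero_left sum.neutral)
  have "vnorm v \<le> vnorm (v - int q *s t) + vnorm (int q *s t)"
    using vnorm_add[of "v - int q *s t" "int q *s t"] by simp
  also have "\<dots> \<le> L + q * (L * (\<Sum>j<k. q ^ j))"
    using assms[THEN bspec, of "v - int q *s t"] t(2) Suc.IH[OF t(1)] by (simp add: vnorm_scale in_keys_iff add_mono)
  also have "\<dots> = L * (\<Sum>j<Suc k. q ^ j)"
    unfolding geometric_sum_Suc by (simp add: algebra_simps)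
  finally show ?case .
qed

definition box :: "int ^ 'n \<Rightarrow> nat \<Rightarrow> (int ^ 'n) set" where
  "box d L = {v. vnorm v \<le> L + vnorm d}"

text \<open>
  The matrix of Dwork's operator on monomials: multiplication by \<open>x^(-d) G\<close> followed by the
  operator that keeps the exponents divisible by \<open>q\<close> and divides them by \<open>q\<close>.
\<close>

definition dwork_matrix :: "nat \<Rightarrow> (int ^ 'n \<Rightarrow>\<^sub>0 'a::zero) \<Rightarrow> int ^ 'n \<Rightarrow> int ^ 'n \<Rightarrow> int ^ 'n \<Rightarrow> 'a" where
  "dwork_matrix q G d r w = Poly_Mapping.lookup G (int q *s r - w + d)"

lemma finite_box: "finite (box d L)"
  by (simp add: box_def finite_vnorm_le)

context
  fixes q :: nat and G :: "int ^ 'n \<Rightarrow>\<^sub>0 'a::field fps" and d :: "int ^ 'n" and L :: nat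
  assumes q: "q \<ge> 2" and L: "\<forall>v\<in>Poly_Mapping.keys G. vnorm v \<le> L"
begin

text \<open>
  The box is invariant under the matrix, because division of exponents by \<open>q \<ge> 2\<close> is contracting. So
  cutting the infinite matrix down to the box loses nothing in the computation of its powers.
\<close>

lemma dwork_matrix_nonzero_box:
  assumes "w \<in> (box d L)" "(dwork_matrix q G d) t w \<noteq> 0"
  shows "t \<in> (box d L)"
proof -
  have "int q *s t = (int q *s t - w + d) + w - d" by simp
  then have "vnorm (int q *s t) \<le> vnorm (int q *s t - w + d) + vnorm w + vnorm d"
    by (metis add_le_mono1 order_trans vnorm_add vnorm_diff)
  also have "\<dots> \<le> L + (L + vnorm d) + vnorm d"
    using L assms by (intro add_mono) (auto simp: box_def dwork_matrix_def in_keys_iff)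
  finally have "q * vnorm t \<le> 2 * (L + vnorm d)" by (simp add: vnorm_scale)
  also have "\<dots> \<le> q * (L + vnorm d)" using q by (intro mult_right_mono) auto
  finally show ?thesis using q by (simp add: box_def)
qed

text \<open>
  The \<open>k\<close>-th power of Dwork's operator for \<open>q\<close> and \<open>x^(-d) G(x)\<close> is the operator for \<open>q^k\<close> and
  the product of \<open>x^(-d q^j) G(x^(q^j))\<close> over \<open>j < k\<close>. The sum over \<open>j\<close> of the \<open>q^j\<close> that
  multiplies \<open>d\<close> is the resulting exponent shift.
\<close>

lemma mpow_dwork_matrix:
  assumes "w \<in> (box d L)"
  shows "mpow (box d L) (dwork_matrix q G d) k r w =
    Poly_Mapping.lookup (frob_prod q G k) (int (q ^ k) *s r - w + int (\<Sum>j<k. q ^ j) *s d)"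
  using assms
proof (induction k arbitrary: w)
  case 0
  then show ?case by (auto simp: lookup_one when_def)
next
  case (Suc k)
  define s where "s = (\<Sum>j<k. q ^ j)"
  define u where "u = int (q ^ k) *s r + int s *s d"
  let ?F = "frob_prod q G k"
  let ?f = "\<lambda>t. Poly_Mapping.lookup ?F (u - t) * (dwork_matrix q G d) t w"
  have "mpow (box d L) (dwork_matrix q G d) (Suc k) r w = (\<Sum>t\<in>(box d L). ?f t)"
    by (simp add: Suc.IH u_def s_def algebra_simps)
  also have "\<dots> = (\<Sum>t\<in>(\<lambda>t. u - t) ` Poly_Mapping.keys ?F. ?f t)"
  proof (rule sum.mono_neutral_cong)
    fix t assume "t \<in> (\<lambda>t. u - t) ` Poly_Mapping.keys ?F - (box d L)"
    then show "?f t = 0" using dwork_matrix_nonzero_box[OF Suc.prems, of t] by auto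
  next
    fix t assume t: "t \<in> (box d L) - (\<lambda>t. u - t) ` Poly_Mapping.keys ?F"
    have "u - t \<notin> Poly_Mapping.keys ?F"
    proof
      assume "u - t \<in> Poly_Mapping.keys ?F"
      then have "u - (u - t) \<in> (\<lambda>t. u - t) ` Poly_Mapping.keys ?F" by (rule imageI)
      then show False using t by simp
    qed
    then show "?f t = 0" by (simp add: in_keys_iff)
  qed (simp_all add: finite_box)
  also have "\<dots> = (\<Sum>t\<in>Poly_Mapping.keys ?F. ?f (u - t))"
    by (subst sum.reindex) (auto simp: inj_on_def)
  also have "\<dots> = Poly_Mapping.lookup (G * dilate q ?F) (int (q ^ Suc k) *s r - w + int (\<Sum>j<Suc k. q ^ j) *s d)"
    unfolding lookup_mult_dilate
  proof (rule sum.cong)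
    fix t assume "t \<in> Poly_Mapping.keys ?F"
    have eq: "int q *s (u - t) - w + d = int (q ^ Suc k) *s r - w + int (\<Sum>j<Suc k. q ^ j) *s d - int q *s t"
      unfolding geometric_sum_Suc s_def[symmetric] u_def
      by (simp add: Finite_Cartesian_Product.vec_eq_iff algebra_simps)
    show "?f (u - t) = Poly_Mapping.lookup G (int (q ^ Suc k) *s r - w + int (\<Sum>j<Suc k. q ^ j) *s d - int q *s t) * Poly_Mapping.lookup ?F t"
      unfolding dwork_matrix_def eq diff_diff_eq2 add_diff_cancel_left' by (rule mult.commute)
  qed simp
  finally show ?case by simp
qed

text \<open>
  Orthogonality leaves the coefficients of \<open>frob_prod q G k\<close> at the exponents \<open>(q^k - 1) r + s d\<close>,
  where \<open>s\<close> is the sum of the \<open>q^j\<close>; these are the diagonal entries of the \<open>k\<close>-th power. A coefficient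
  with \<open>r\<close> outside the box vanishes.
\<close>

lemma dwork_trace_formula:
  fixes X :: "('a ^ 'n) set" and k :: nat
  assumes k: "k > 0" and nz': "\<forall>x\<in>X. \<forall>i. x $ i \<noteq> 0"
    and orth: "\<And>w. (\<Sum>x\<in>X. xpow x w) = (if \<forall>i. int (q ^ k - 1) dvd w $ i then c else 0)"
  shows "(\<Sum>x\<in>X. fps_const (xpow x (- (int (\<Sum>j<k. q ^ j) *s d))) * (\<Prod>j<k. leval (\<chi> i. x $ i ^ (q ^ j)) G)) =
    fps_const c * (\<Sum>r\<in>(box d L). mpow (box d L) (dwork_matrix q G d) k r r)"
proof -
  have nz: "x $ i \<noteq> 0" if "x \<in> X" for x :: "'a ^ 'n" and i using nz' that by blast
  define s where "s = (\<Sum>j<k. q ^ j)"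
  let ?F = "frob_prod q G k"
  define P where "P v \<longleftrightarrow> (\<forall>i. int (q ^ k - 1) dvd (v - int s *s d) $ i)" for v
  have Q: "q ^ k - 1 = (q - 1) * s"
    unfolding s_def using q by (intro geometric_sum_nat[symmetric]) simp
  have s0: "s > 0" unfolding s_def using k q by (intro sum_pos) auto
  have Q1: "1 \<le> q ^ k" using q by simp
  have "(\<Sum>x\<in>X. fps_const (xpow x (- (int s *s d))) * (\<Prod>j<k. leval (\<chi> i. x $ i ^ (q ^ j)) G)) =
      (\<Sum>x\<in>X. \<Sum>v\<in>Poly_Mapping.keys ?F. Poly_Mapping.lookup ?F v * fps_const (xpow x (v - int s *s d)))"
  proof (rule sum.cong)
    fix x assume x: "x \<in> X"
    have "xpow x (v - int s *s d) = xpow x (- (int s *s d)) * xpow x v" for v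
      using xpow_add[of x "- (int s *s d)" v] nz[OF x] by (simp add: algebra_simps)
    then show "fps_const (xpow x (- (int s *s d))) * (\<Prod>j<k. leval (\<chi> i. x $ i ^ (q ^ j)) G) =
      (\<Sum>v\<in>Poly_Mapping.keys ?F. Poly_Mapping.lookup ?F v * fps_const (xpow x (v - int s *s d)))"
      unfolding leval_frob_prod[OF nz[OF x], symmetric]
      by (simp add: leval_def sum_distrib_left mult_ac flip: fps_const_mult)
  qed simp
  also have "\<dots> = (\<Sum>v\<in>Poly_Mapping.keys ?F. Poly_Mapping.lookup ?F v * fps_const (\<Sum>x\<in>X. xpow x (v - int s *s d)))"
    by (subst sum.swap) (simp add: fps_const_sum sum_distrib_left)
  also have "\<dots> = fps_const c * (\<Sum>v\<in>Poly_Mapping.keys ?F. if P v then Poly_Mapping.lookup ?F v else 0)"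
    unfolding orth P_def sum_distrib_left by (intro sum.cong) auto
  also have "(\<Sum>v\<in>Poly_Mapping.keys ?F. if P v then Poly_Mapping.lookup ?F v else 0) =
      (\<Sum>v\<in>(\<lambda>r. int (q ^ k - 1) *s r + int s *s d) ` (box d L). Poly_Mapping.lookup ?F v)"
  proof (rule sum.mono_neutral_cong)
    fix v assume v: "v \<in> Poly_Mapping.keys ?F - (\<lambda>r. int (q ^ k - 1) *s r + int s *s d) ` (box d L)"
    have "\<not> P v"
    proof
      assume "P v"
      then have "\<exists>r. \<forall>i. (v - int s *s d) $ i = int (q ^ k - 1) * r i" unfolding P_def dvd_def by metis
      then obtain r where r: "\<And>i. (v - int s *s d) $ i = int (q ^ k - 1) * r i" by blast
      define r' where "r' = vec_lambda r"
      have vr: "v = int (q ^ k - 1) *s r' + int s *s d"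
        unfolding Finite_Cartesian_Product.vec_eq_iff using r by (simp add: r'_def algebra_simps)
      have "s * ((q - 1) * vnorm r') = vnorm (int (q ^ k - 1) *s r')"
        by (simp only: vnorm_scale Q mult_ac)
      also have "\<dots> = vnorm (v - int s *s d)" using vr by simp
      also have "\<dots> \<le> L * s + s * vnorm d"
      proof -
        have "vnorm v \<le> L * s" unfolding s_def by (rule keys_frob_prod[OF L]) (use v in auto)
        then show ?thesis
          using vnorm_diff[of v "int s *s d"] unfolding vnorm_scale by linarith
      qed
      also have "\<dots> = s * (L + vnorm d)" by (simp add: algebra_simps)
      finally have "(q - 1) * vnorm r' \<le> L + vnorm d" using s0 by simp
      moreover have "1 * vnorm r' \<le> (q - 1) * vnorm r'" using q by (intro mult_right_mono) auto
      ultimately have "vnorm r' \<le> L + vnorm d" by linarith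
      then have "r' \<in> (box d L)" by (simp add: box_def)
      then show False using v vr by blast
    qed
    then show "(if P v then Poly_Mapping.lookup ?F v else 0) = 0" by simp
  next
    fix v assume "v \<in> Poly_Mapping.keys ?F \<inter> (\<lambda>r. int (q ^ k - 1) *s r + int s *s d) ` (box d L)"
    then have "P v" unfolding P_def by auto
    then show "(if P v then Poly_Mapping.lookup ?F v else 0) = Poly_Mapping.lookup ?F v" by simp
  qed (auto simp: finite_box in_keys_iff)
  also have "\<dots> = (\<Sum>r\<in>(box d L). Poly_Mapping.lookup ?F (int (q ^ k - 1) *s r + int s *s d))"
  proof (subst sum.reindex)
    have "q ^ k > 1" using k q by (intro one_less_power) auto
    then have "int (q ^ k - 1) \<noteq> 0" by linarith
    then show "inj_on (\<lambda>r. int (q ^ k - 1) *s r + int s *s d) (box d L)"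
      unfolding inj_on_def Finite_Cartesian_Product.vec_eq_iff vector_add_component vector_smult_component
        add_right_cancel mult_cancel_left by blast
  qed (simp add: o_def)
  also have "\<dots> = (\<Sum>r\<in>(box d L). mpow (box d L) (dwork_matrix q G d) k r r)"
  proof (rule sum.cong)
    fix r assume "r \<in> (box d L)"
    have "int (q ^ k - 1) *s r + int s *s d = int (q ^ k) *s r - r + int s *s d"
      using Q1 by (simp add: Finite_Cartesian_Product.vec_eq_iff of_nat_diff algebra_simps)
    then show "Poly_Mapping.lookup ?F (int (q ^ k - 1) *s r + int s *s d) = mpow (box d L) (dwork_matrix q G d) k r r"
      by (simp add: mpow_dwork_matrix[OF \<open>r \<in> (box d L)\<close>] s_def)
  qed simp
  finally show ?thesis by (simp add: s_def)
qed

end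


section \<open>The exponential sums as sums over orbits of Frobenius\<close>

definition coord_power :: "'a::monoid_mult ^ 'n \<Rightarrow> nat \<Rightarrow> 'a ^ 'n" where
  "coord_power x m = (\<chi> i. x $ i ^ m)"

lemma coord_power_coord_power: "coord_power (coord_power x m) n = coord_power x (m * n)"
  by (simp add: coord_power_def power_mult)

lemma xpow_coord_power: "xpow (coord_power x c) v = xpow x v ^ c"
  unfolding coord_power_def xpow_scale[symmetric] by (rule xpow_scale')

lemma fps_const_prod: "(\<Prod>i\<in>I. fps_const (h i)) = fps_const (\<Prod>i\<in>I. h i :: 'a::comm_ring_1)"
  by (induction I rule: infinite_finite_induct) simp_all

lemma fps_binomial_sum: "fps_binomial (\<Sum>i\<in>I. f i) = (\<Prod>i\<in>I. fps_binomial (f i :: 'a::field_char_0))"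
  by (induction I rule: infinite_finite_induct) (auto simp: fps_binomial_add_mult)

lemma sum_nat_blocks: "(\<Sum>i<a * k. h i) = (\<Sum>j<k. \<Sum>i<a. h (i + a * j))" for h :: "nat \<Rightarrow> 'b::comm_monoid_add"
proof (induction k)
  case (Suc k)
  have "(\<Sum>i<m + n. h i) = (\<Sum>i<m. h i) + (\<Sum>i<n. h (i + m))" for m n
    by (induction n) (simp_all add: ac_simps)
  from this[of "a * k" a] have "(\<Sum>i<a * Suc k. h i) = (\<Sum>i<a * k. h i) + (\<Sum>i<a. h (i + a * k))"
    by (simp add: add.commute)
  then show ?case using Suc by simp
qed simp

definition torus :: "nat \<Rightarrow> nat \<Rightarrow> ('k::{alg_closed_field, field_prime_char} witt fract ^ 'n) set" where
  "torus q k = {x. \<forall>i. x $ i \<in> mu (q ^ k)}"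

text \<open>
  The part of the trace of \<open>f x\<close> that comes from the first \<open>a\<close> powers of Frobenius, for \<open>x\<close> a vector of
  roots of unity. The full trace is the sum of its values at \<open>x^(q^j)\<close>.
\<close>

definition frob_trace :: "nat \<Rightarrow> nat \<Rightarrow> (int ^ 'n \<Rightarrow>\<^sub>0 'a) \<Rightarrow> 'a ^ 'n \<Rightarrow> 'a::field" where
  "frob_trace p a f x = (\<Sum>i<a. \<Sum>u\<in>Poly_Mapping.keys f. (Poly_Mapping.lookup f u * xpow x u) ^ (p ^ i))"

definition weight :: "nat \<Rightarrow> nat \<Rightarrow> (int ^ 'n \<Rightarrow>\<^sub>0 'a) \<Rightarrow> int ^ 'n \<Rightarrow> 'a ^ 'n \<Rightarrow> 'a::field_char_0 fps" where
  "weight p a f d x = fps_const (xpow x (- d)) * fps_binomial (frob_trace p a f x)"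

context
  fixes p a q :: nat and f :: "int ^ 'n \<Rightarrow>\<^sub>0 'k::{alg_closed_field, field_prime_char} witt fract" and d :: "int ^ 'n"
  assumes p: "p = CHAR('k)" and a: "a > 0" and q: "q = p ^ a"
    and f: "\<forall>u\<in>Poly_Mapping.keys f. Poly_Mapping.lookup f u \<in> mu q"
begin

lemma q_ge_2: "q \<ge> 2"
  using Q_gt_1[OF p a q] by simp

context
  fixes k :: nat
  assumes k: "k > 0"
begin

lemma q_power_eq: "q ^ k = p ^ (a * k)" "a * k > 0"
  using a k by (simp_all add: q power_mult)

lemma mu_q_subset: "mu q \<subseteq> (mu (q ^ k) :: 'k witt fract set)"
proof -
  have "x \<in> Fq (q ^ k)" if "x \<in> Fq q" for x :: 'k
  proof -
    have "x ^ (q ^ k) = x" using that by (induction k) (simp_all add: Fq_def power_mult)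
    then show ?thesis by (simp add: Fq_def)
  qed
  then show ?thesis
    unfolding mu_eq[OF p a q] mu_eq[OF p q_power_eq(2,1)] by blast
qed

lemma torus_nonzero: "x \<in> torus q k \<Longrightarrow> (x :: 'k witt fract ^ 'n) $ i \<noteq> 0"
  unfolding torus_def using mu_nonzero[OF p q_power_eq(2,1)] by blast

lemma torus_term:
  assumes "x \<in> torus q k" "u \<in> Poly_Mapping.keys f"
  shows "Poly_Mapping.lookup f u * xpow x u \<in> mu (q ^ k)"
proof -
  have 1: "1 \<in> (mu (q ^ k) :: 'k witt fract set)" using Zq_1[OF p q_power_eq(2,1)] by (simp add: mu_def)
  have "(\<Prod>i\<in>I. x $ i powi u $ i) \<in> mu (q ^ k)" for I
  proof (induction I rule: infinite_finite_induct)
    case (insert i I)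
    then show ?case
      using mu_mult[OF p q_power_eq(2,1)] mu_powi[OF p q_power_eq(2,1)] assms(1) by (simp add: torus_def)
  qed (simp_all add: 1)
  then show ?thesis
    unfolding xpow_def using bspec[OF f assms(2)] mu_q_subset mu_mult[OF p q_power_eq(2,1)] by blast
qed

lemma Tr_laurent_eval:
  assumes x: "(x :: 'k witt fract ^ 'n) \<in> torus q k"
  shows "Tr (Zq (q ^ k)) (Zq p) (laurent_eval f x) = (\<Sum>j<k. frob_trace p a f (coord_power x (q ^ j)))"
    and "Tr (Zq (q ^ k)) (Zq p) (laurent_eval f x) \<in> Zq p"
proof -
  let ?Q = "q ^ k"
  let ?m = "\<lambda>u. Poly_Mapping.lookup f u * xpow x u"
  note Z = q_power_eq(2,1)
  have m: "?m u \<in> mu ?Q" if "u \<in> Poly_Mapping.keys f" for u using torus_term[OF x that] .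
  have mu_Zq: "y \<in> Zq ?Q" if "y \<in> mu ?Q" for y :: "'k witt fract" using that by (simp add: mu_def)
  have e: "laurent_eval f x = (\<Sum>u\<in>Poly_Mapping.keys f. ?m u)"
    by (simp add: laurent_eval_def xpow_def)
  have e_Zq: "laurent_eval f x \<in> Zq ?Q"
    unfolding e by (intro Zq_sum[OF p Z] mu_Zq m)
  have frob_mu: "(fract_frob ^^ i) y = y ^ (p ^ i)" if "y \<in> mu ?Q" for y :: "'k witt fract" and i
    using that unfolding mu_eq[OF p Z] by (auto simp: fract_frob_funpow_teich p teich_power)
  have frob_Zq: "(fract_frob ^^ i) y \<in> Zq ?Q" if "y \<in> Zq ?Q" for y :: "'k witt fract" and i
    by (induction i) (use that fract_frob_Zq(1)[OF p Z] in auto)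
  have frob_sum: "fract_frob (\<Sum>i\<in>I. h i) = (\<Sum>i\<in>I. fract_frob (h i))"
    if "\<And>i. i \<in> I \<Longrightarrow> h i \<in> Zq ?Q" for I and h :: "'i \<Rightarrow> 'k witt fract"
    using that
    by (induction I rule: infinite_finite_induct)
      (simp_all add: fract_frob_Zq(3)[OF p Z] Zq_sum[OF p Z])
  have frob_e: "(fract_frob ^^ i) (laurent_eval f x) = (\<Sum>u\<in>Poly_Mapping.keys f. ?m u ^ (p ^ i))" for i
  proof -
    have "(fract_frob ^^ i) (laurent_eval f x) = (\<Sum>u\<in>Poly_Mapping.keys f. (fract_frob ^^ i) (?m u))"
      unfolding e
      by (induction i) (simp_all add: frob_sum frob_Zq mu_Zq m)
    then show ?thesis by (simp add: frob_mu m)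
  qed
  have T: "Tr (Zq ?Q) (Zq p) (laurent_eval f x) = (\<Sum>i<a * k. (fract_frob ^^ i) (laurent_eval f x))"
    using Tr_Zq[OF p Z e_Zq] .
  also have "\<dots> = (\<Sum>j<k. \<Sum>i<a. \<Sum>u\<in>Poly_Mapping.keys f. ?m u ^ (p ^ (i + a * j)))"
    unfolding frob_e by (rule sum_nat_blocks)
  also have "\<dots> = (\<Sum>j<k. frob_trace p a f (coord_power x (q ^ j)))"
    unfolding frob_trace_def
  proof (intro sum.cong refl)
    fix j i u assume u: "u \<in> Poly_Mapping.keys f"
    have "Poly_Mapping.lookup f u ^ (q ^ j) = Poly_Mapping.lookup f u"
      by (induction j) (simp_all add: power_mult mu_power_Q[OF p a q bspec[OF f u]])
    then have "?m u ^ (q ^ j) = Poly_Mapping.lookup f u * xpow (coord_power x (q ^ j)) u"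
      by (simp add: power_mult_distrib xpow_coord_power)
    moreover have "?m u ^ (p ^ (i + a * j)) = (?m u ^ (q ^ j)) ^ (p ^ i)"
      by (simp only: q power_add power_mult mult.commute[of "p ^ i"])
    ultimately show "?m u ^ (p ^ (i + a * j)) = (Poly_Mapping.lookup f u * xpow (coord_power x (q ^ j)) u) ^ (p ^ i)"
      by simp
  qed
  finally show "Tr (Zq ?Q) (Zq p) (laurent_eval f x) = (\<Sum>j<k. frob_trace p a f (coord_power x (q ^ j)))" .
  have "fract_frob (\<Sum>i<a * k. (fract_frob ^^ i) (laurent_eval f x)) = (\<Sum>i<a * k. (fract_frob ^^ Suc i) (laurent_eval f x))"
    by (simp add: frob_sum frob_Zq e_Zq)
  also have "\<dots> + laurent_eval f x = (\<Sum>i<Suc (a * k). (fract_frob ^^ i) (laurent_eval f x))"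
    by (subst sum.lessThan_Suc_shift) (simp add: add.commute)
  also have "\<dots> = (\<Sum>i<a * k. (fract_frob ^^ i) (laurent_eval f x)) + laurent_eval f x"
    using fract_frob_Zq(2)[OF p Z e_Zq] by simp
  finally have "fract_frob (\<Sum>i<a * k. (fract_frob ^^ i) (laurent_eval f x)) = (\<Sum>i<a * k. (fract_frob ^^ i) (laurent_eval f x))"
    by (simp only: add_right_cancel)
  moreover have "(\<Sum>i<a * k. (fract_frob ^^ i) (laurent_eval f x)) \<in> Zq ?Q"
    by (intro Zq_sum[OF p Z] frob_Zq e_Zq)
  ultimately show "Tr (Zq ?Q) (Zq p) (laurent_eval f x) \<in> Zq p"
    unfolding T by (subst Zp_eq[OF p Z]) simp
qed

text \<open>
  On roots of unity the lifted norm is raising to the power \<open>1 + q + \<dots> + q^(k-1)\<close>.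
\<close>

lemma omega_char_ext_eq:
  assumes x: "(x :: 'k witt fract ^ 'n) \<in> torus q k"
  shows "omega_char_ext d q k x = xpow x (- (int (\<Sum>j<k. q ^ j) *s d))"
    and "omega_char_ext d q k x \<in> Zq q"
proof -
  let ?s = "\<Sum>j<k. q ^ j"
  have 1: "teich (Norm (Fq (q ^ k)) (Fq q) (inv_into UNIV teich (x $ i))) = (x $ i) ^ ?s"
    "teich (Norm (Fq (q ^ k)) (Fq q) (inv_into UNIV teich (x $ i))) \<in> mu q" for i
  proof -
    have "x $ i \<in> teich ` (Fq (q ^ k) - {0})" using x mu_eq[OF p q_power_eq(2,1)] by (auto simp: torus_def)
    then obtain y where y: "x $ i = teich y" "y \<in> Fq (q ^ k)" "y \<noteq> 0" by blast
    have n: "Norm (Fq (q ^ k)) (Fq q) y = y ^ ?s"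
      using Norm_Fq[of q a k y] q p a k y(2) by simp
    have i: "inv_into UNIV teich (x $ i) = y" unfolding y(1) by (rule inv_f_f[OF inj_teich])
    show "teich (Norm (Fq (q ^ k)) (Fq q) (inv_into UNIV teich (x $ i))) = (x $ i) ^ ?s"
      unfolding i n by (simp add: y(1) teich_power)
    have "q ^ k = 1 + (q - 1) * ?s"
      using geometric_sum_nat[of q k] q_ge_2 by simp
    moreover have "q * ?s + 1 = ?s + q ^ k"
      using geometric_sum_Suc[of q k] by simp
    then have "y ^ (q * ?s) * y = y ^ ?s * y ^ (q ^ k)"
      by (simp flip: power_add power_Suc2 add: add.commute)
    then have "(y ^ ?s) ^ q = y ^ ?s"
      using y(2,3) by (simp add: Fq_def mult.commute flip: power_mult)
    then have "y ^ ?s \<in> Fq q - {0}" using y(3) by (simp add: Fq_def)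
    then show "teich (Norm (Fq (q ^ k)) (Fq q) (inv_into UNIV teich (x $ i))) \<in> mu q"
      unfolding i n mu_eq[OF p a q] by blast
  qed
  show "omega_char_ext d q k x = xpow x (- (int ?s *s d))"
    by (simp add: omega_char_ext_def omega_char_def 1(1) xpow_def power_int_mult[symmetric]
        power_int_power[symmetric] mult_ac flip: power_int_of_nat)
  have "teich (Norm (Fq (q ^ k)) (Fq q) (inv_into UNIV teich (x $ i))) powi m \<in> Zq q" for i m
    using mu_powi[OF p a q 1(2)] by (simp add: mu_def)
  then show "omega_char_ext d q k x \<in> Zq q"
    unfolding omega_char_ext_def omega_char_def
    by (intro Zq_prod[OF p a q]) simp
qed

text \<open>
  Character and additive character are both multiplicative along the orbit of \<open>x\<close>, so their product
  over \<open>Fq (q ^ k)\<close> is assembled from local factors at \<open>x, x^q, x^(q^2), \<dots>\<close>.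
\<close>

lemma weight_prod:
  assumes x: "(x :: 'k witt fract ^ 'n) \<in> torus q k"
  shows "(\<Prod>j<k. weight p a f d (coord_power x (q ^ j))) =
    fps_const (omega_char_ext d q k x) * fps_binomial (Tr (Zq (q ^ k)) (Zq p) (laurent_eval f x))"
proof -
  have "(\<Prod>j<k. xpow (coord_power x (q ^ j)) (- d)) = (\<Prod>j<k. xpow x (- d) ^ (q ^ j))"
    by (simp only: xpow_coord_power)
  also have "\<dots> = xpow x (- d) ^ (\<Sum>j<k. q ^ j)" by (rule power_sum[symmetric])
  also have "\<dots> = omega_char_ext d q k x"
    unfolding omega_char_ext_eq(1)[OF x] xpow_scale'[symmetric]
    by (rule arg_cong[of _ _ "xpow x"]) (simp add: Finite_Cartesian_Product.vec_eq_iff)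
  finally have "(\<Prod>j<k. fps_const (xpow (coord_power x (q ^ j)) (- d))) = fps_const (omega_char_ext d q k x)"
    by (simp add: fps_const_prod)
  then show ?thesis
    unfolding weight_def prod.distrib Tr_laurent_eval(1)[OF x] fps_binomial_sum by simp
qed

lemma S_sum_eq: "S_sum f d q k = (\<Sum>x\<in>torus q k. \<Prod>j<k. weight p a f d (coord_power x (q ^ j)))"
  unfolding S_sum_def torus_def[symmetric] p[symmetric] by (simp add: weight_prod)

end

end


section \<open>Growth of the \<open>T\<close>-adic orders\<close>

text \<open>
  This says \<open>D * ord_T x \<ge> n\<close>, avoiding division and the order of \<open>0\<close>.
\<close>

definition ord_ge :: "nat \<Rightarrow> nat \<Rightarrow> 'a::comm_ring_1 fps \<Rightarrow> bool" where
  "ord_ge D n x \<longleftrightarrow> (\<forall>t. fps_nth x t \<noteq> 0 \<longrightarrow> n \<le> D * t)"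

lemma ord_ge_0 [simp]: "ord_ge D n 0" and ord_ge_zero [simp]: "ord_ge D 0 x"
  by (auto simp: ord_ge_def)

lemma ord_ge_add: "ord_ge D n x \<Longrightarrow> ord_ge D n y \<Longrightarrow> ord_ge D n (x + y)"
  unfolding ord_ge_def by (metis add.right_neutral fps_add_nth)

lemma ord_ge_mono: "ord_ge D n x \<Longrightarrow> m \<le> n \<Longrightarrow> ord_ge D m x"
  unfolding ord_ge_def by (meson order_trans)

lemma ord_ge_mult:
  assumes "ord_ge D m x" "ord_ge D n y"
  shows "ord_ge D (m + n) (x * y)"
  unfolding ord_ge_def
proof (intro allI impI)
  fix t assume "fps_nth (x * y) t \<noteq> 0"
  then obtain i where i: "i \<le> t" "fps_nth x i * fps_nth y (t - i) \<noteq> 0"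
    unfolding fps_mult_nth by (metis (no_types, lifting) atLeastAtMost_iff sum.neutral)
  then have "fps_nth x i \<noteq> 0" "fps_nth y (t - i) \<noteq> 0" by auto
  then have "m + n \<le> D * i + D * (t - i)"
    using assms unfolding ord_ge_def by (intro add_mono) auto
  then show "m + n \<le> D * t" using i(1) by (simp flip: distrib_left)
qed

lemma ord_ge_prod:
  "finite I \<Longrightarrow> (\<And>i. i \<in> I \<Longrightarrow> ord_ge D (n i) (x i)) \<Longrightarrow> ord_ge D (\<Sum>i\<in>I. n i) (\<Prod>i\<in>I. x i)"
  by (induction I rule: finite_induct) (auto intro: ord_ge_mult)

text \<open>
  The \<open>T\<close>-adic orders of the coefficients grow at least like \<open>|v| / D\<close>. Such Laurent polynomials form
  a ring.
\<close>

definition tame :: "nat \<Rightarrow> (int ^ 'n \<Rightarrow>\<^sub>0 'a::comm_ring_1 fps) \<Rightarrow> bool" where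
  "tame D H \<longleftrightarrow> (\<forall>v. ord_ge D (vnorm v) (Poly_Mapping.lookup H v))"

lemma tame_single_0: "tame D (Poly_Mapping.single 0 c)"
  unfolding tame_def by (auto simp: lookup_single when_def)

lemma tame_1: "tame D 1"
  using tame_single_0[of D 1] by (simp add: single_one)

lemma tame_add: "tame D F \<Longrightarrow> tame D H \<Longrightarrow> tame D (F + H)"
  unfolding tame_def by (auto simp: lookup_add intro: ord_ge_add)

lemma tame_sum: "(\<And>i. i \<in> I \<Longrightarrow> tame D (h i)) \<Longrightarrow> tame D (\<Sum>i\<in>I. h i)"
proof (induction I rule: infinite_finite_induct)
  case (insert i I)
  then show ?case by (auto intro: tame_add)
qed (auto simp: tame_def)

lemma tame_mult:
  assumes "tame D F" "tame D (H :: int ^ 'n \<Rightarrow>\<^sub>0 'a::comm_ring_1 fps)"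
  shows "tame D (F * H)"
proof -
  have "F * H = (\<Sum>w\<in>Poly_Mapping.keys H. F * Poly_Mapping.single w (Poly_Mapping.lookup H w))"
    unfolding sum_distrib_left[symmetric] poly_mapping_sum_single[symmetric] ..
  moreover have "tame D (F * Poly_Mapping.single w (Poly_Mapping.lookup H w))" for w
    unfolding tame_def lookup_mult_single
  proof
    fix v
    have "vnorm v \<le> vnorm (v - w) + vnorm w" using vnorm_add[of "v - w" w] by simp
    then show "ord_ge D (vnorm v) (Poly_Mapping.lookup F (v - w) * Poly_Mapping.lookup H w)"
      using assms unfolding tame_def by (intro ord_ge_mono[OF ord_ge_mult]) auto
  qed
  ultimately show ?thesis by (auto intro: tame_sum)
qed

lemma tame_prod: "(\<And>i. i \<in> I \<Longrightarrow> tame D (h i)) \<Longrightarrow> tame D (\<Prod>i\<in>I. h i)"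
  by (induction I rule: infinite_finite_induct) (auto intro: tame_mult tame_1)

lemma tame_T_mult:
  assumes "\<And>v. v \<in> Poly_Mapping.keys H \<Longrightarrow> vnorm v \<le> D"
  shows "tame D (H * Poly_Mapping.single 0 fps_X)"
  unfolding tame_def lookup_mult_single ord_ge_def
proof (intro allI impI)
  fix v t assume nz: "fps_nth (Poly_Mapping.lookup H (v - 0) * fps_X) t \<noteq> 0"
  then have "v \<in> Poly_Mapping.keys H" by (auto simp: in_keys_iff split: if_splits)
  moreover have "t > 0" using nz by (auto intro: gr0I)
  ultimately show "vnorm v \<le> D * t"
    using assms[of v] by (metis One_nat_def Suc_leI dual_order.trans mult.right_neutral mult_le_mono2)
qed

text \<open>
  For \<open>P\<close> with coefficients in \<open>K\<close>, this is the truncation modulo \<open>T^N\<close> of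
  \<open>(1 + T)^P = \<Sum> (P gchoose j) T^j\<close>. The \<open>j\<close> factors \<open>T\<close> are distributed over the \<open>j\<close> linear factors
  of the binomial coefficient, so that each of these becomes tame.
\<close>

definition binomial_trunc :: "nat \<Rightarrow> (int ^ 'n \<Rightarrow>\<^sub>0 'a::field_char_0 fps) \<Rightarrow> (int ^ 'n \<Rightarrow>\<^sub>0 'a fps)" where
  "binomial_trunc N P = (\<Sum>j<N. Poly_Mapping.single 0 (fps_const (1 / fact j)) *
     (\<Prod>i<j. (P - of_nat i) * Poly_Mapping.single 0 fps_X))"

lemma tame_binomial_trunc:
  assumes "\<And>v. v \<in> Poly_Mapping.keys P \<Longrightarrow> vnorm v \<le> D"
  shows "tame D (binomial_trunc N P)"
proof -
  have "tame D ((P - of_nat i) * Poly_Mapping.single 0 fps_X)" for i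
  proof (rule tame_T_mult)
    fix v assume "v \<in> Poly_Mapping.keys (P - of_nat i)"
    then have "v \<in> Poly_Mapping.keys P \<or> v = 0"
      by (auto simp: in_keys_iff lookup_minus lookup_of_nat when_def split: if_splits)
    then show "vnorm v \<le> D" using assms by auto
  qed
  then show ?thesis
    unfolding binomial_trunc_def by (intro tame_sum tame_mult[OF tame_single_0] tame_prod)
qed

lemma leval_binomial_trunc:
  fixes x :: "'a::field_char_0 ^ 'n"
  assumes x: "\<And>i. x $ i \<noteq> 0" and P: "leval x P = fps_const c" and t: "t < N"
  shows "fps_nth (leval x (binomial_trunc N P)) t = fps_nth (fps_binomial c) t"
proof -
  have "leval x (binomial_trunc N P) = (\<Sum>j<N. fps_const (1 / fact j) * (\<Prod>i<j. fps_const (c - of_nat i) * fps_X))"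
    unfolding binomial_trunc_def leval_sum leval_mult[OF x] leval_prod[OF x] leval_diff P leval_of_nat
    by (simp flip: fps_of_nat)
  also have "\<dots> = (\<Sum>j<N. fps_const (c gchoose j) * fps_X ^ j)"
  proof (rule sum.cong)
    fix j
    have "(\<Prod>i<j. fps_const (c - of_nat i) * fps_X) = fps_const (\<Prod>i<j. c - of_nat i) * fps_X ^ j"
      by (simp add: prod.distrib fps_const_prod)
    then show "fps_const (1 / fact j) * (\<Prod>i<j. fps_const (c - of_nat i) * fps_X) = fps_const (c gchoose j) * fps_X ^ j"
      by (simp add: gbinomial_prod_rev atLeast0LessThan flip: mult.assoc)
  qed simp
  finally show ?thesis
    using t by (simp add: fps_sum_nth fps_X_power_nth if_distrib[where f = "(*) _"] cong: if_cong)
qed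

definition frob_trace_poly :: "nat \<Rightarrow> nat \<Rightarrow> (int ^ 'n \<Rightarrow>\<^sub>0 'a) \<Rightarrow> (int ^ 'n \<Rightarrow>\<^sub>0 'a::field fps)" where
  "frob_trace_poly p a f = (\<Sum>i<a. \<Sum>u\<in>Poly_Mapping.keys f.
     Poly_Mapping.single (int (p ^ i) *s u) (fps_const (Poly_Mapping.lookup f u ^ (p ^ i))))"

lemma leval_frob_trace_poly: "leval x (frob_trace_poly p a f) = fps_const (frob_trace p a f x)"
  unfolding frob_trace_poly_def leval_sum leval_single xpow_scale' frob_trace_def power_mult_distrib fps_const_sum
  by simp

lemma poly_mapping_bounded: "\<exists>L. \<forall>v\<in>Poly_Mapping.keys (H :: int ^ 'n \<Rightarrow>\<^sub>0 'r::zero). vnorm v \<le> L"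
  by (intro exI[of _ "\<Sum>v\<in>Poly_Mapping.keys H. vnorm v"] ballI member_le_sum) auto

text \<open>
  All but finitely many vectors have norm at least \<open>C\<close>.
\<close>

lemma sum_vnorm_superlinear:
  "\<exists>K. \<forall>R :: (int ^ 'n) set. finite R \<longrightarrow> C * card R \<le> (\<Sum>r\<in>R. vnorm r) + K"
proof (intro exI allI impI)
  fix R :: "(int ^ 'n) set" assume R: "finite R"
  let ?Z = "{v :: int ^ 'n. vnorm v \<le> C}"
  have "C * card R = (\<Sum>r\<in>R. C)" by simp
  also have "\<dots> \<le> (\<Sum>r\<in>R. vnorm r + (if r \<in> ?Z then C else 0))"
    by (rule sum_mono) auto
  also have "\<dots> = (\<Sum>r\<in>R. vnorm r) + C * card (R \<inter> ?Z)"
    unfolding sum.distrib sum.inter_restrict[OF R, symmetric] by simp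
  also have "\<dots> \<le> (\<Sum>r\<in>R. vnorm r) + C * card ?Z"
    using finite_vnorm_le by (intro add_left_mono mult_left_mono card_mono) auto
  finally show "C * card R \<le> (\<Sum>r\<in>R. vnorm r) + C * card ?Z" .
qed

context
  fixes p a q :: nat and f :: "int ^ 'n \<Rightarrow>\<^sub>0 'k::{alg_closed_field, field_prime_char} witt fract" and d :: "int ^ 'n"
  assumes p: "p = CHAR('k)" and a: "a > 0" and q: "q = p ^ a"
    and f: "\<forall>u\<in>Poly_Mapping.keys f. Poly_Mapping.lookup f u \<in> mu q"
begin

lemma C_fun_is_exp:
  "is_exp (\<lambda>k. fps_const (- 1 / (of_nat q ^ k - 1) ^ CARD('n)) * S_sum f d q k) (C_fun f d q)"
proof -
  have "C_fun f d q = exp_fps (Abs_fps (\<lambda>k. if k = 0 then 0 else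
      fps_const (1 / of_nat k) * (fps_const (- 1 / (of_nat q ^ k - 1) ^ CARD('n)) * S_sum f d q k)))"
    unfolding C_fun_def by (intro arg_cong[of _ _ exp_fps] arg_cong[of _ _ Abs_fps] ext) (simp flip: mult.assoc)
  then show ?thesis by (simp only: is_exp_exp_fps)
qed

lemma of_nat_q_power_minus_1:
  assumes "k > 0"
  shows "(of_nat q ^ k - 1 :: 'k witt fract) = of_nat (q ^ k - 1)" "(of_nat q ^ k - 1 :: 'k witt fract) \<noteq> 0"
proof -
  have q1: "q ^ k > 1" using q_ge_2[OF p a q f] assms by (intro one_less_power) auto
  then show eq: "(of_nat q ^ k - 1 :: 'k witt fract) = of_nat (q ^ k - 1)" by (simp add: of_nat_diff)
  show "(of_nat q ^ k - 1 :: 'k witt fract) \<noteq> 0"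
    unfolding eq of_nat_eq_0_iff using q1 by linarith
qed

text \<open>
  The truncation order \<open>N\<close> and the box depend on \<open>t\<close>, but \<open>D\<close> does not, since all truncations are tame
  with the same constant.
\<close>

lemma C_fun_coeff_support:
  "\<exists>D>0. \<forall>m t. fps_nth (fps_nth (C_fun f d q) m) t \<noteq> 0 \<longrightarrow>
    (\<exists>R :: (int ^ 'n) set. finite R \<and> card R = m \<and> (\<Sum>r\<in>R. vnorm r) \<le> D * t + m * vnorm d)"
proof -
  obtain D0 where D0: "\<And>v. v \<in> Poly_Mapping.keys (frob_trace_poly p a f) \<Longrightarrow> vnorm v \<le> D0"
    using poly_mapping_bounded by blast
  \<comment> \<open>\<open>D0\<close> may be \<open>0\<close>, but later one divides by \<open>D\<close>.\<close>
  define D where "D = Suc D0"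
  have D: "vnorm v \<le> D" if "v \<in> Poly_Mapping.keys (frob_trace_poly p a f)" for v using D0[OF that] by (simp add: D_def)
  have "\<exists>R :: (int ^ 'n) set. finite R \<and> card R = m \<and> (\<Sum>r\<in>R. vnorm r) \<le> D * t + m * vnorm d"
    if nz: "fps_nth (fps_nth (C_fun f d q) m) t \<noteq> 0" for m t
  proof -
    define N where "N = Suc t"
    define G where "G = binomial_trunc N (frob_trace_poly p a f)"
    have G: "tame D G" unfolding G_def using D by (rule tame_binomial_trunc)
    obtain L where L: "\<forall>v\<in>Poly_Mapping.keys G. vnorm v \<le> L" using poly_mapping_bounded by blast
    let ?B = "box d L" and ?A = "dwork_matrix q G d"
    note q2 = q_ge_2[OF p a q f]
    have finB: "finite ?B" by (rule finite_box)
    have trace: "fps_nth (fps_const (- 1 / (of_nat q ^ k - 1) ^ CARD('n)) * S_sum f d q k) s =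
        fps_nth (- (\<Sum>r\<in>?B. mpow ?B ?A k r r)) s" if k: "k > 0" and s: "s < N" for k s
    proof -
      let ?c = "of_nat (q ^ k - 1) ^ CARD('n) :: 'k witt fract"
      note q_power_eq = q_power_eq[OF p a q f k]
      note e = of_nat_q_power_minus_1[OF k]
      have c: "?c \<noteq> 0" using e(2) unfolding e(1) power_eq_0_iff by iprover
      have "fps_nth (S_sum f d q k) s = (\<Sum>x\<in>torus q k.
          fps_nth (fps_const (xpow x (- (int (\<Sum>j<k. q ^ j) *s d))) * (\<Prod>j<k. leval (coord_power x (q ^ j)) G)) s)"
        unfolding S_sum_eq[OF p a q f k] fps_sum_nth
      proof (rule sum.cong)
        fix x :: "'k witt fract ^ 'n" assume x: "x \<in> torus q k"
        have nzx: "coord_power x (q ^ j) $ i \<noteq> 0" for i j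
          using torus_nonzero[OF p a q f k x] by (simp add: coord_power_def)
        have "(\<Prod>j<k. weight p a f d (coord_power x (q ^ j))) =
          fps_const (xpow x (- (int (\<Sum>j<k. q ^ j) *s d))) * (\<Prod>j<k. fps_binomial (frob_trace p a f (coord_power x (q ^ j))))"
          unfolding weight_prod[OF p a q f k x] omega_char_ext_eq(1)[OF p a q f k x]
            Tr_laurent_eval(1)[OF p a q f k x] fps_binomial_sum ..
        also have "fps_nth \<dots> s = fps_nth (fps_const (xpow x (- (int (\<Sum>j<k. q ^ j) *s d))) * (\<Prod>j<k. leval (coord_power x (q ^ j)) G)) s"
        proof (rule fps_nth_mult_cong[OF refl _ s])
          fix s' assume "s' < N"
          have "fps_nth (\<Prod>j\<in>J. fps_binomial (frob_trace p a f (coord_power x (q ^ j)))) s' =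
            fps_nth (\<Prod>j\<in>J. leval (coord_power x (q ^ j)) G) s'" for J
            using \<open>s' < N\<close>
          proof (induction J arbitrary: s' rule: infinite_finite_induct)
            case (insert j J)
            have "fps_nth (fps_binomial (frob_trace p a f (coord_power x (q ^ j)))) s'' =
              fps_nth (leval (coord_power x (q ^ j)) G) s''" if "s'' < N" for s''
              unfolding G_def
              by (rule leval_binomial_trunc[OF nzx leval_frob_trace_poly that, symmetric])
            then show ?case
              unfolding prod.insert[OF insert.hyps]
              by (rule fps_nth_mult_cong) (use insert in auto)
          qed simp_all
          then show "fps_nth (\<Prod>j<k. fps_binomial (frob_trace p a f (coord_power x (q ^ j)))) s' =
            fps_nth (\<Prod>j<k. leval (coord_power x (q ^ j)) G) s'" .
        qed
        finally show "fps_nth (\<Prod>j<k. weight p a f d (coord_power x (q ^ j))) s = \<dots>" .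
      qed simp
      also have "\<dots> = fps_nth (fps_const ?c * (\<Sum>r\<in>?B. mpow ?B ?A k r r)) s"
      proof -
        have "(\<Sum>x\<in>(torus q k :: ('k witt fract ^ 'n) set). xpow x w) = (if \<forall>i. int (q ^ k - 1) dvd w $ i then ?c else 0)" for w
          unfolding torus_def xpow_def by (rule sum_mu_vec_powi[OF p q_power_eq(2,1)])
        moreover have "\<forall>x\<in>torus q k. \<forall>i. (x :: 'k witt fract ^ 'n) $ i \<noteq> 0"
          using torus_nonzero[OF p a q f k] by blast
        ultimately have "(\<Sum>x\<in>torus q k. fps_const (xpow x (- (int (\<Sum>j<k. q ^ j) *s d))) *
            (\<Prod>j<k. leval (\<chi> i. x $ i ^ (q ^ j)) G)) = fps_const ?c * (\<Sum>r\<in>?B. mpow ?B ?A k r r)"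
          by (intro dwork_trace_formula[OF q2 L k])
        then
        show ?thesis unfolding fps_sum_nth[symmetric] coord_power_def by simp
      qed
      finally have "fps_nth (S_sum f d q k) s = ?c * fps_nth (\<Sum>r\<in>?B. mpow ?B ?A k r r) s"
        by (simp only: fps_mult_left_const_nth)
      then show ?thesis
        unfolding e(1) fps_mult_left_const_nth fps_neg_nth using c by (simp only:) (simp del: of_nat_diff)
    qed
    obtain h where h: "bij_betw h {..<card ?B} ?B"
      using ex_bij_betw_nat_finite[OF finB] by (auto simp: atLeast0LessThan)
    define n where "n = card ?B"
    define A' where "A' = (\<lambda>i j. ?A (h i) (h j))"
    have tr: "(\<Sum>i<n. mpow {..<n} A' k i i) = (\<Sum>r\<in>?B. mpow ?B ?A k r r)" for k
    proof -
      have "(\<Sum>i<n. mpow {..<n} A' k i i) = (\<Sum>i<card ?B. mpow ?B ?A k (h i) (h i))"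
        unfolding A'_def n_def by (intro sum.cong mpow_reindex[OF h]) auto
      also have "\<dots> = (\<Sum>r\<in>?B. mpow ?B ?A k r r)" by (rule sum.reindex_bij_betw[OF h])
      finally show ?thesis .
    qed
    have "fps_nth (fps_nth (C_fun f d q) m) t = fps_nth (fps_nth (det (charmat n A')) m) t"
      by (rule is_exp_cong[OF C_fun_is_exp is_exp_det_charmat, where M = m and N = N])
        (simp_all only: tr trace N_def lessI order_refl)
    moreover have "fps_nth (det (charmat n A')) m \<in>
      {x. \<forall>t. fps_nth x t \<noteq> 0 \<longrightarrow> (\<exists>R :: (int ^ 'n) set. finite R \<and> card R = m \<and> (\<Sum>r\<in>R. vnorm r) \<le> D * t + m * vnorm d)}"
    proof (rule det_charmat_nth_mem)
      fix R \<pi> assume R: "R \<subseteq> {..<n}" "card R = m" "\<pi> permutes R"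
      have finR: "finite R" using R(1) finite_subset by blast
      have inj: "inj_on h R" using h R(1) unfolding n_def by (auto simp: bij_betw_def intro: inj_on_subset)
      let ?w = "\<lambda>i. int q *s h i - h (\<pi> i) + d"
      have ord: "ord_ge D (\<Sum>i\<in>R. vnorm (?w i)) (\<Prod>i\<in>R. A' i (\<pi> i))"
        using G finR unfolding A'_def dwork_matrix_def tame_def by (intro ord_ge_prod) auto
      have "2 * vnorm (h i) \<le> vnorm (?w i) + vnorm (h (\<pi> i)) + vnorm d" for i
      proof -
        have "vnorm (int q *s h i) = vnorm (?w i + h (\<pi> i) - d)" by simp
        also have "\<dots> \<le> vnorm (?w i) + vnorm (h (\<pi> i)) + vnorm d"
          by (meson add_le_mono1 order_trans vnorm_add vnorm_diff)
        finally have "q * vnorm (h i) \<le> vnorm (?w i) + vnorm (h (\<pi> i)) + vnorm d" by (simp only: vnorm_scale)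
        moreover have "2 * vnorm (h i) \<le> q * vnorm (h i)" using q2 by (rule mult_le_mono1)
        ultimately show ?thesis by (rule order_trans[rotated])
      qed
      then have "(\<Sum>i\<in>R. 2 * vnorm (h i)) \<le> (\<Sum>i\<in>R. vnorm (?w i) + vnorm (h (\<pi> i)) + vnorm d)"
        by (rule sum_mono)
      also have "\<dots> = (\<Sum>i\<in>R. vnorm (?w i)) + (\<Sum>i\<in>R. vnorm (h i)) + m * vnorm d"
        using sum.permute[OF R(3), of "\<lambda>i. vnorm (h i)"] R(2) by (simp add: sum.distrib o_def)
      finally have "(\<Sum>i\<in>R. vnorm (h i)) \<le> (\<Sum>i\<in>R. vnorm (?w i)) + m * vnorm d"
        by (simp flip: sum_distrib_left)
      moreover have "(\<Sum>r\<in>h ` R. vnorm r) = (\<Sum>i\<in>R. vnorm (h i))" using inj by (simp add: sum.reindex)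
      moreover have "finite (h ` R)" "card (h ` R) = m" using finR inj R(2) by (auto simp: card_image)
      ultimately show "(\<Prod>i\<in>R. A' i (\<pi> i)) \<in>
        {x. \<forall>t. fps_nth x t \<noteq> 0 \<longrightarrow> (\<exists>R :: (int ^ 'n) set. finite R \<and> card R = m \<and> (\<Sum>r\<in>R. vnorm r) \<le> D * t + m * vnorm d)}"
        using ord unfolding ord_ge_def
        by (intro CollectI allI impI exI[of _ "h ` R"]) (force intro: order_trans add_le_mono1)
    next
      fix x y :: "'k witt fract fps"
      let ?I = "{x :: 'k witt fract fps. \<forall>t. fps_nth x t \<noteq> 0 \<longrightarrow> (\<exists>R :: (int ^ 'n) set. finite R \<and> card R = m \<and> (\<Sum>r\<in>R. vnorm r) \<le> D * t + m * vnorm d)}"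
      assume x: "x \<in> ?I" and y: "y \<in> ?I"
      show "x + y \<in> ?I"
      proof (intro CollectI allI impI)
        fix t assume "fps_nth (x + y) t \<noteq> 0"
        then have "fps_nth x t \<noteq> 0 \<or> fps_nth y t \<noteq> 0" by auto
        then show "\<exists>R :: (int ^ 'n) set. finite R \<and> card R = m \<and> (\<Sum>r\<in>R. vnorm r) \<le> D * t + m * vnorm d"
          using x y by blast
      qed
    qed auto
    ultimately show ?thesis using nz by simp
  qed
  then show ?thesis by (intro exI[of _ D]) (auto simp: D_def)
qed

lemma C_fun_ord_T: "(\<lambda>m. ord_T (fps_nth (C_fun f d q) m) / ereal (real m)) \<longlonglongrightarrow> \<infinity>"
  unfolding tendsto_PInfty
proof
  fix b :: real
  obtain D where D: "D > 0" and supp: "\<And>m t. fps_nth (fps_nth (C_fun f d q) m) t \<noteq> 0 \<Longrightarrow>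
    \<exists>R :: (int ^ 'n) set. finite R \<and> card R = m \<and> (\<Sum>r\<in>R. vnorm r) \<le> D * t + m * vnorm d"
    using C_fun_coeff_support by blast
  \<comment> \<open>The additional \<open>1\<close> absorbs the constant \<open>K\<close> as soon as \<open>m > K\<close>.\<close>
  define B where "B = nat \<lceil>b\<rceil> + 1"
  define C where "C = B * D + vnorm d"
  obtain K where K: "\<And>R :: (int ^ 'n) set. finite R \<Longrightarrow> C * card R \<le> (\<Sum>r\<in>R. vnorm r) + K"
    using sum_vnorm_superlinear by blast
  show "\<forall>\<^sub>F m in sequentially. ereal b < ord_T (fps_nth (C_fun f d q) m) / ereal (real m)"
    using eventually_gt_at_top[of K]
  proof eventually_elim
    fix m assume m: "K < m"
    let ?x = "fps_nth (C_fun f d q) m"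
    show "ereal b < ord_T ?x / ereal (real m)"
    proof (cases "?x = 0")
      case True
      then show ?thesis using m by (simp add: ord_T_def)
    next
      case False
      define t where "t = subdegree ?x"
      have "fps_nth ?x t \<noteq> 0" using False by (simp add: t_def)
      then obtain R :: "(int ^ 'n) set" where R: "finite R" "card R = m" "(\<Sum>r\<in>R. vnorm r) \<le> D * t + m * vnorm d"
        using supp by blast
      have "C * m \<le> D * t + m * vnorm d + K" using K[OF R(1)] R(2,3) by simp
      then have "B * D * m \<le> D * t + K" unfolding C_def by (simp add: algebra_simps)
      also have "\<dots> < D * t + D * m" using m D by (simp add: less_le_trans[of K m])
      finally have "D * (B * m) < D * (t + m)" by (simp add: algebra_simps)
      then have "B * m < t + m" using D by simp
      then have "nat \<lceil>b\<rceil> * m < t" by (simp add: B_def algebra_simps)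
      then have "real (nat \<lceil>b\<rceil>) * real m < real t" by (simp flip: of_nat_mult)
      moreover have "b * real m \<le> real (nat \<lceil>b\<rceil>) * real m"
        by (intro mult_right_mono) (auto simp: real_nat_ceiling_ge)
      ultimately have "b * real m < real t" by (rule le_less_trans[rotated])
      then have "b < real t / real m" using m by (simp add: pos_less_divide_eq)
      then show ?thesis using False m by (simp add: ord_T_def t_def)
    qed
  qed
qed

end


section \<open>Integrality\<close>

text \<open>
  A finite set permuted by \<open>\<phi>\<close> is a disjoint union of cycles; only the product of \<open>w\<close> along a whole
  cycle need lie in \<open>I\<close>.
\<close>

lemma prod_over_orbits_mem:
  fixes \<phi> :: "'b \<Rightarrow> 'b" and w :: "'b \<Rightarrow> 'r::comm_monoid_mult"
  assumes I: "1 \<in> I" "\<And>x y. x \<in> I \<Longrightarrow> y \<in> I \<Longrightarrow> x * y \<in> I"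
    and Y: "finite Y" "\<phi> ` Y = Y" "\<And>x. x \<in> Y \<Longrightarrow> \<exists>l>0. (\<phi> ^^ l) x = x"
    and cycle: "\<And>x l. x \<in> Y \<Longrightarrow> l > 0 \<Longrightarrow> (\<phi> ^^ l) x = x \<Longrightarrow> (\<Prod>j<l. w ((\<phi> ^^ j) x)) \<in> I"
  shows "(\<Prod>x\<in>Y. w x) \<in> I"
  using Y cycle
proof (induction "card Y" arbitrary: Y rule: less_induct)
  case less
  show ?case
  proof (cases "Y = {}")
    case True
    then show ?thesis using I by simp
  next
    case False
    then obtain x where x: "x \<in> Y" by blast
    define l where "l = (LEAST l. l > 0 \<and> (\<phi> ^^ l) x = x)"
    have "l > 0 \<and> (\<phi> ^^ l) x = x"
      unfolding l_def by (rule LeastI_ex) (rule less.prems(3)[OF x])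
    then have l: "l > 0" "(\<phi> ^^ l) x = x" by auto
    have min: "(\<phi> ^^ l') x \<noteq> x" if "0 < l'" "l' < l" for l'
      using not_less_Least[of l' "\<lambda>l. l > 0 \<and> (\<phi> ^^ l) x = x"] that unfolding l_def by auto
    define Orb where "Orb = (\<lambda>j. (\<phi> ^^ j) x) ` {..<l}"
    have no_coll: False if "i < j" "j < l" "(\<phi> ^^ i) x = (\<phi> ^^ j) x" for i j
    proof -
      have "(\<phi> ^^ (l - j)) ((\<phi> ^^ i) x) = (\<phi> ^^ (l - j)) ((\<phi> ^^ j) x)" using that by simp
      then have "(\<phi> ^^ (l - j + i)) x = (\<phi> ^^ (l - j + j)) x" by (simp only: funpow_add o_apply)
      moreover have "l - j + j = l" using that by simp
      ultimately have eq: "(\<phi> ^^ (l - j + i)) x = x" using l(2) by simp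
      have "0 < l - j + i" "l - j + i < l" using that by linarith+
      from min[OF this] eq show False by (rule notE)
    qed
    have inj_O: "inj_on (\<lambda>j. (\<phi> ^^ j) x) {..<l}"
    proof (rule inj_onI)
      fix i j assume ij: "i \<in> {..<l}" "j \<in> {..<l}" "(\<phi> ^^ i) x = (\<phi> ^^ j) x"
      show "i = j"
      proof (rule linorder_cases[of i j])
        assume "i < j"
        then show ?thesis using no_coll[OF _ _ ij(3)] ij(2) by simp
      next
        assume "j < i"
        then show ?thesis using no_coll[OF _ _ ij(3)[symmetric]] ij(1) by simp
      qed
    qed
    have mem: "(\<phi> ^^ j) x \<in> Y" for j
      by (induction j) (use x less.prems(2) in auto)
    then have OY: "Orb \<subseteq> Y" by (auto simp: Orb_def)
    have inj: "inj_on \<phi> Y" using less.prems(1,2) by (simp add: eq_card_imp_inj_on)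
    have "\<phi> y \<in> Orb" if "y \<in> Orb" for y
    proof -
      obtain j where j: "j < l" "y = (\<phi> ^^ j) x" using \<open>y \<in> Orb\<close> by (auto simp: Orb_def)
      show ?thesis
      proof (cases "Suc j = l")
        case True
        then have "\<phi> y = (\<phi> ^^ 0) x" using j(2) l(2) by (metis funpow.simps(2) funpow_0 o_apply)
        then show ?thesis unfolding Orb_def using l(1) by (intro image_eqI[of _ _ 0]) simp_all
      next
        case False
        then have "\<phi> y = (\<phi> ^^ Suc j) x" "Suc j < l" using j by auto
        then show ?thesis unfolding Orb_def by (intro image_eqI[of _ _ "Suc j"]) auto
      qed
    qed
    then have "\<phi> ` Orb \<subseteq> Orb" by auto
    then have "\<phi> ` Orb = Orb"
      using inj_on_subset[OF inj OY] by (intro endo_inj_surj) (auto simp: Orb_def)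
    then have "\<phi> ` (Y - Orb) = Y - Orb"
      using inj_on_image_set_diff[OF inj, of Y Orb] less.prems(2) OY by auto
    moreover have "x \<in> Orb" unfolding Orb_def using l(1) by (intro image_eqI[of _ _ 0]) auto
    then have "card (Y - Orb) < card Y" using x less.prems(1) by (intro psubset_card_mono) auto
    ultimately have "(\<Prod>x\<in>Y - Orb. w x) \<in> I"
      using less.prems by (intro less.hyps) auto
    moreover have "(\<Prod>x\<in>Orb. w x) \<in> I"
      unfolding Orb_def using less.prems(4)[OF x l] by (simp add: prod.reindex[OF inj_O] o_def)
    moreover have "(\<Prod>x\<in>Y. w x) = (\<Prod>x\<in>Y - Orb. w x) * (\<Prod>x\<in>Orb. w x)"
      using less.prems(1) OY by (intro prod.subset_diff) auto
    ultimately show ?thesis using I(2) by simp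
  qed
qed

text \<open>
  Powers of the weighted matrix of a map \<open>\<phi>\<close>. Its \<open>k\<close>-th trace is a sum over the points fixed by the
  \<open>k\<close>-th iterate of \<open>\<phi>\<close>.
\<close>

lemma mpow_weighted_map:
  assumes X: "finite X" "\<And>x. x \<in> X \<Longrightarrow> \<phi> x \<in> X" and r: "r \<in> X"
  shows "mpow X (\<lambda>x y. if y = \<phi> x then w x else 0) k r s =
    (if s = (\<phi> ^^ k) r then \<Prod>j<k. w ((\<phi> ^^ j) r) else 0)"
proof (induction k arbitrary: s)
  case (Suc k)
  have "(\<phi> ^^ k) r \<in> X" by (induction k) (use X r in auto)
  then have "mpow X (\<lambda>x y. if y = \<phi> x then w x else 0) (Suc k) r s =
      (\<Sum>t\<in>X. if t = (\<phi> ^^ k) r then (\<Prod>j<k. w ((\<phi> ^^ j) r)) * (if s = \<phi> t then w t else 0) else 0)"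
    by (simp add: Suc.IH if_distrib[of "\<lambda>x. x * _"] cong: if_cong)
  also have "\<dots> = (\<Prod>j<k. w ((\<phi> ^^ j) r)) * (if s = \<phi> ((\<phi> ^^ k) r) then w ((\<phi> ^^ k) r) else 0)"
    using X(1) \<open>(\<phi> ^^ k) r \<in> X\<close> by (simp add: sum.delta)
  finally show ?case by simp
qed auto

definition Zq_fps :: "nat \<Rightarrow> 'k::{alg_closed_field, field_prime_char} witt fract fps set" where
  "Zq_fps q = {x. \<forall>t. fps_nth x t \<in> Zq q}"

context
  fixes p a q :: nat and f :: "int ^ 'n \<Rightarrow>\<^sub>0 'k::{alg_closed_field, field_prime_char} witt fract" and d :: "int ^ 'n"
  assumes p: "p = CHAR('k)" and a: "a > 0" and q: "q = p ^ a"
    and f: "\<forall>u\<in>Poly_Mapping.keys f. Poly_Mapping.lookup f u \<in> mu q"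
begin

lemma Zq_fps_closed:
  fixes x y :: "'k witt fract fps" and z :: "'k witt fract"
  shows "0 \<in> (Zq_fps q :: 'k witt fract fps set)" "1 \<in> (Zq_fps q :: 'k witt fract fps set)" "x \<in> Zq_fps q \<Longrightarrow> y \<in> Zq_fps q \<Longrightarrow> x + y \<in> Zq_fps q"
  "x \<in> Zq_fps q \<Longrightarrow> - x \<in> Zq_fps q" "x \<in> Zq_fps q \<Longrightarrow> y \<in> Zq_fps q \<Longrightarrow> x * y \<in> Zq_fps q"
  "z \<in> Zq q \<Longrightarrow> fps_const z \<in> Zq_fps q"
  using Zq_0[OF p a q] Zq_1[OF p a q]
  by (auto simp: Zq_fps_def fps_mult_nth intro: Zq_add[OF p a q] Zq_uminus[OF p a q]
      Zq_sum[OF p a q] Zq_mult[OF p a q])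

lemma Zq_fps_sum: "(\<And>i. i \<in> I \<Longrightarrow> (h i :: 'k witt fract fps) \<in> Zq_fps q) \<Longrightarrow> (\<Sum>i\<in>I. h i) \<in> Zq_fps q"
  by (induction I rule: infinite_finite_induct) (auto intro: Zq_fps_closed)

lemma weight_prod_integral:
  assumes k: "k > 0" and x: "(x :: 'k witt fract ^ 'n) \<in> torus q k"
  shows "(\<Prod>j<k. weight p a f d (coord_power x (q ^ j))) \<in> Zq_fps q"
proof -
  have "fps_binomial (Tr (Zq (q ^ k)) (Zq p) (laurent_eval f x)) \<in> Zq_fps q"
    using gbinomial_Zp[OF p Tr_laurent_eval(2)[OF p a q f k x]] Zp_eq[OF p a q] by (auto simp: Zq_fps_def)
  then show ?thesis
    unfolding weight_prod[OF p a q f k x]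
    by (intro Zq_fps_closed omega_char_ext_eq(2)[OF p a q f k x])
qed

text \<open>
  The points of the torus over \<open>Fq (q ^ k)\<close> are the fixed points of the \<open>k\<close>-th power of Frobenius. This
  lets the tori for different \<open>k\<close> be treated inside one set.
\<close>

lemma torus_iff:
  assumes k: "k > 0"
  shows "(x :: 'k witt fract ^ 'n) \<in> torus q k \<longleftrightarrow> (\<forall>i. x $ i \<noteq> 0) \<and> coord_power x (q ^ k) = x"
proof -
  have "y ^ (q ^ k - 1) = 1 \<longleftrightarrow> y \<noteq> 0 \<and> y ^ (q ^ k) = y" for y :: "'k witt fract"
  proof -
    have "q ^ k > 1" using q_ge_2[OF p a q f] k by (intro one_less_power) auto
    then have e: "q ^ k = Suc (q ^ k - 1)" "q ^ k - 1 \<noteq> 0" by linarith+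
    have "y ^ (q ^ k) = y * y ^ (q ^ k - 1)" by (subst e(1)) simp
    then show ?thesis using e(2) by (cases "y = 0") (auto simp: zero_power)
  qed
  then show ?thesis
    unfolding torus_def mu_eq_roots[OF p q_power_eq(2,1)[OF p a q f k]]
    by (auto simp: coord_power_def Finite_Cartesian_Product.vec_eq_iff)
qed

text \<open>
  The Euler product of the \<open>L\<close>-function, written as the determinant \<open>det (1 - s M)\<close> of the weighted
  permutation matrix \<open>M\<close> of \<open>x \<mapsto> x^q\<close>. For the coefficient at \<open>s^m\<close> only the points of degree at most \<open>m\<close>
  matter, which makes \<open>M\<close> finite. The weight of a single point need not be integral, but its product
  along an orbit is a summand of an exponential sum and is.
\<close>

lemma L_function_integral:
  assumes F: "is_exp (\<lambda>k. - S_sum f d q k) F"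
  shows "fps_nth F m \<in> Zq_fps q"
proof -
  define X :: "('k witt fract ^ 'n) set" where "X = (\<Union>k\<in>{1..m}. torus q k)"
  let ?\<phi> = "\<lambda>x :: 'k witt fract ^ 'n. coord_power x q"
  let ?w = "weight p a f d"
  let ?A = "\<lambda>x y. if y = ?\<phi> x then ?w x else 0"
  have \<phi>_pow: "(?\<phi> ^^ j) x = coord_power x (q ^ j)" for j x
    by (induction j) (simp_all add: coord_power_coord_power mult.commute, simp add: coord_power_def)
  have finX: "finite X"
    unfolding X_def torus_def
    by (intro finite_UN_I finite_mu_vec[OF p q_power_eq(2,1)[OF p a q f]]) auto
  have nzX: "x $ i \<noteq> 0" if "x \<in> X" for x :: "'k witt fract ^ 'n" and i
    using that torus_iff unfolding X_def by force
  have perX: "\<exists>l>0. (?\<phi> ^^ l) x = x" if "x \<in> X" for x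
  proof -
    obtain l where "l \<in> {1..m}" "x \<in> torus q l" using \<open>x \<in> X\<close> unfolding X_def by blast
    then show ?thesis using torus_iff[of l x] unfolding \<phi>_pow by (intro exI[of _ l]) auto
  qed
  have \<phi>X: "?\<phi> x \<in> X" if "x \<in> X" for x
  proof -
    obtain l where l: "l \<in> {1..m}" "x \<in> torus q l" using \<open>x \<in> X\<close> unfolding X_def by blast
    then have x: "coord_power x (q ^ l) = x" "\<And>i. x $ i \<noteq> 0" using torus_iff[of l x] by auto
    have "coord_power (?\<phi> x) (q ^ l) = coord_power (coord_power x (q ^ l)) q"
      unfolding coord_power_coord_power by (simp only: mult.commute)
    moreover have "?\<phi> x $ i \<noteq> 0" for i using x(2) by (simp add: coord_power_def)
    ultimately have "?\<phi> x \<in> torus q l"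
      using torus_iff[of l "?\<phi> x"] l(1) x(1) by simp
    then show ?thesis using l(1) unfolding X_def by blast
  qed
  have trace: "(\<Sum>r\<in>X. mpow X ?A k r r) = S_sum f d q k" if k: "0 < k" "k \<le> m" for k
  proof -
    have "(\<Sum>r\<in>X. mpow X ?A k r r) = (\<Sum>r\<in>X. if r = coord_power r (q ^ k) then \<Prod>j<k. ?w (coord_power r (q ^ j)) else 0)"
      by (intro sum.cong refl) (simp only: mpow_weighted_map[OF finX \<phi>X] \<phi>_pow)
    also have "\<dots> = (\<Sum>r\<in>{r \<in> X. r = coord_power r (q ^ k)}. \<Prod>j<k. ?w (coord_power r (q ^ j)))"
      by (rule sum.inter_filter[OF finX, symmetric])
    also have "{r \<in> X. r = coord_power r (q ^ k)} = torus q k"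
    proof (intro equalityI subsetI)
      fix x assume "x \<in> {r \<in> X. r = coord_power r (q ^ k)}"
      then show "x \<in> torus q k" using nzX[of x] torus_iff[OF k(1), of x] by auto
    next
      fix x :: "'k witt fract ^ 'n" assume x: "x \<in> torus q k"
      then have "x \<in> X" using k unfolding X_def by (intro UN_I[of k]) auto
      then show "x \<in> {r \<in> X. r = coord_power r (q ^ k)}" using x torus_iff[OF k(1), of x] by auto
    qed
    finally show ?thesis using S_sum_eq[OF p a q f k(1)] by simp
  qed
  obtain h where h: "bij_betw h {..<card X} X"
    using ex_bij_betw_nat_finite[OF finX] by (auto simp: atLeast0LessThan)
  define n where "n = card X"
  define A' where "A' = (\<lambda>i j. ?A (h i) (h j))"
  have tr: "(\<Sum>i<n. mpow {..<n} A' k i i) = (\<Sum>r\<in>X. mpow X ?A k r r)" for k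
  proof -
    have "(\<Sum>i<n. mpow {..<n} A' k i i) = (\<Sum>i<card X. mpow X ?A k (h i) (h i))"
      unfolding A'_def n_def by (intro sum.cong mpow_reindex[OF h]) auto
    also have "\<dots> = (\<Sum>r\<in>X. mpow X ?A k r r)" by (rule sum.reindex_bij_betw[OF h])
    finally show ?thesis .
  qed
  have "fps_nth F m = fps_nth (det (charmat n A')) m"
  proof (rule fps_ext)
    fix t
    show "fps_nth (fps_nth F m) t = fps_nth (fps_nth (det (charmat n A')) m) t"
      by (rule is_exp_cong[OF F is_exp_det_charmat, where M = m and N = "Suc t"])
        (simp_all only: tr trace lessI order_refl)
  qed
  also have "\<dots> \<in> Zq_fps q"
  proof (rule det_charmat_nth_mem)
    fix R \<pi> assume R: "R \<subseteq> {..<n}" "card R = m" "\<pi> permutes R"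
    have finR: "finite R" using R(1) finite_subset by blast
    have inj: "inj_on h R" using h R(1) unfolding n_def by (auto simp: bij_betw_def intro: inj_on_subset)
    have hX: "h ` R \<subseteq> X" using h R(1) unfolding n_def by (auto simp: bij_betw_def)
    show "(\<Prod>i\<in>R. A' i (\<pi> i)) \<in> Zq_fps q"
    proof (cases "\<forall>i\<in>R. h (\<pi> i) = ?\<phi> (h i)")
      case True
      have "?\<phi> ` h ` R = h ` \<pi> ` R" unfolding image_image using True by (intro image_cong) auto
      then have inv: "?\<phi> ` h ` R = h ` R" using permutes_image[OF R(3)] by simp
      have "(\<Prod>x\<in>h ` R. ?w x) \<in> Zq_fps q"
      proof (rule prod_over_orbits_mem[where \<phi> = ?\<phi>, OF Zq_fps_closed(2,5) _ inv])
        fix x l assume xl: "x \<in> h ` R" "0 < l" "(?\<phi> ^^ l) x = x"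
        then have "x \<in> torus q l" using torus_iff[of l x] nzX[of x] hX unfolding \<phi>_pow by auto
        then show "(\<Prod>j<l. ?w ((?\<phi> ^^ j) x)) \<in> Zq_fps q"
          unfolding \<phi>_pow using xl(2) by (intro weight_prod_integral)
      qed (use finR perX hX in auto)
      then show ?thesis
        using True unfolding A'_def by (simp add: prod.reindex[OF inj])
    next
      case False
      then have "(\<Prod>i\<in>R. A' i (\<pi> i)) = 0" unfolding A'_def using finR by (auto intro!: prod_zero)
      then show ?thesis using Zq_fps_closed(1) by simp
    qed
  qed (auto intro: Zq_fps_closed)
  finally show ?thesis .
qed

text \<open>
  The hypothesis on \<open>c'\<close> says \<open>q^k c' k = c' k + c k\<close>, that is, \<open>F'(q s) = F'(s) F(s)\<close>. Comparing
  coefficients gives \<open>(q^m - 1) F'\<^sub>m = \<Sum>i<m. F'\<^sub>i F\<^sub>m\<^sub>-\<^sub>i\<close>.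
\<close>

lemma divide_by_q_power_minus_1_integral:
  fixes F F' :: "'k witt fract fps fps"
  assumes F: "is_exp c F" "\<And>m. fps_nth F m \<in> Zq_fps q"
    and F': "is_exp c' F'" and c': "\<And>k. k > 0 \<Longrightarrow> fps_const (of_nat q ^ k - 1) * c' k = c k"
  shows "fps_nth F' m \<in> Zq_fps q"
proof (induction m rule: less_induct)
  case (less m)
  let ?q = "fps_const (of_nat q) :: 'k witt fract fps"
  have "Abs_fps (\<lambda>m. ?q ^ m * fps_nth F' m) = F' * F"
  proof (rule is_exp_unique[OF is_exp_scale[OF F'] is_exp_add[OF F' F(1)]])
    fix k :: nat assume "k > 0"
    then show "?q ^ k * c' k = c' k + c k"
      unfolding c'[OF \<open>k > 0\<close>, symmetric] by (simp add: algebra_simps fps_const_power flip: fps_const_sub)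
  qed
  then have "fps_nth (Abs_fps (\<lambda>m. ?q ^ m * fps_nth F' m)) m = fps_nth (F' * F) m" by (rule arg_cong)
  then have "?q ^ m * fps_nth F' m = (\<Sum>i=0..m. fps_nth F' i * fps_nth F (m - i))"
    unfolding fps_nth_Abs_fps fps_mult_nth .
  also have "\<dots> = (\<Sum>i<m. fps_nth F' i * fps_nth F (m - i)) + fps_nth F' m"
    using F(1) by (simp add: atLeast0AtMost is_exp_def flip: lessThan_Suc_atMost)
  finally have eq: "fps_const (of_nat q ^ m - 1) * fps_nth F' m = (\<Sum>i<m. fps_nth F' i * fps_nth F (m - i))"
    by (simp add: algebra_simps fps_const_power flip: fps_const_sub)
  show ?case
  proof (cases "m = 0")
    case True
    then show ?thesis using F' Zq_fps_closed(2) by (simp add: is_exp_def)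
  next
    case False
    let ?u = "inverse (of_nat q ^ m - 1) :: 'k witt fract"
    have "?u \<in> Zq q"
      using Zq_inverse_p_power_minus_1[OF p a q, of "a * m"] a False by (simp add: q power_mult)
    moreover have "(of_nat q ^ m - 1 :: 'k witt fract) \<noteq> 0"
      using False by (intro of_nat_q_power_minus_1(2)[OF p a q f]) simp
    then have "fps_nth F' m = fps_const ?u * (fps_const (of_nat q ^ m - 1) * fps_nth F' m)"
      by (simp flip: mult.assoc)
    moreover have "(\<Sum>i<m. fps_nth F' i * fps_nth F (m - i)) \<in> Zq_fps q"
      using less.IH F(2) by (intro Zq_fps_sum Zq_fps_closed(5)) auto
    ultimately show ?thesis
      unfolding eq using Zq_fps_closed(5,6) by simp
  qed
qed

lemma C_fun_integral: "fps_nth (C_fun f d q) m \<in> Zq_fps q"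
proof -
  define c where "c j k = fps_const (- 1 / (of_nat q ^ k - 1) ^ j) * S_sum f d q k" for j k
  have "\<exists>F. is_exp (c j) F \<and> (\<forall>m. fps_nth F m \<in> Zq_fps q)" for j
  proof (induction j)
    case 0
    let ?F = "exp_fps (Abs_fps (\<lambda>k. if k = 0 then 0 else fps_const (1 / of_nat k) * - S_sum f d q k))"
    have F: "is_exp (\<lambda>k. - S_sum f d q k) ?F" by (rule is_exp_exp_fps)
    have "c 0 = (\<lambda>k. - S_sum f d q k)"
      by (rule ext, rule fps_ext) (simp add: c_def)
    then show ?case using F L_function_integral[OF F] by auto
  next
    case (Suc j)
    then obtain F where F: "is_exp (c j) F" "\<And>m. fps_nth F m \<in> Zq_fps q" by blast
    let ?F' = "exp_fps (Abs_fps (\<lambda>k. if k = 0 then 0 else fps_const (1 / of_nat k) * c (Suc j) k))"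
    have F': "is_exp (c (Suc j)) ?F'" by (rule is_exp_exp_fps)
    have "fps_const (of_nat q ^ k - 1) * c (Suc j) k = c j k" if "k > 0" for k
    proof -
      have "(of_nat q ^ k - 1 :: 'k witt fract) \<noteq> 0"
        by (rule of_nat_q_power_minus_1(2)[OF p a q f that])
      then have "fps_const (of_nat q ^ k - 1) * fps_const (- 1 / (of_nat q ^ k - 1) ^ Suc j) =
          (fps_const (- 1 / (of_nat q ^ k - 1) ^ j) :: 'k witt fract fps)"
        unfolding fps_const_mult by (intro arg_cong[of _ _ fps_const]) (simp add: field_simps)
      then show ?thesis unfolding c_def mult.assoc[symmetric] by (rule arg_cong)
    qed
    then show ?case using F' divide_by_q_power_minus_1_integral[OF F F'] by blast
  qed
  then obtain F where "is_exp (c CARD('n)) F" "\<And>m. fps_nth F m \<in> Zq_fps q" by blast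
  moreover have "C_fun f d q = F"
    using C_fun_is_exp[OF p a q f, of d] calculation(1) unfolding c_def by (rule is_exp_unique) simp
  ultimately show ?thesis by simp
qed

end


section \<open>The \<open>C\<close>-function is \<open>T\<close>-adically entire\<close>

theorem theorem1p7:
  fixes p a q :: nat
    and f :: "int ^ 'n \<Rightarrow>\<^sub>0 'k::{alg_closed_field, field_prime_char} witt fract"
    and d :: "int ^ 'n"
  assumes "p = CHAR('k)" and "a \<ge> 1" and "q = p ^ a"
    and "\<forall>u\<in>Poly_Mapping.keys f. Poly_Mapping.lookup f u \<in> mu q"
    and "\<not> Poly_Mapping.keys f \<subseteq> {0}"
  shows "T_adic_entire (Zq q) (C_fun f d q)"
proof -
  have a: "a > 0" using assms(2) by simp
  note C = C_fun_integral[OF assms(1) a assms(3,4)] C_fun_ord_T[OF assms(1) a assms(3,4)]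
  show ?thesis
    unfolding T_adic_entire_def using C by (auto simp: Zq_fps_def)
qed

end
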